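(* Let $G$ be the Cartesian product of the grandparent graph $\mathrm{GP}(2)$ and the $d$-regular tree $T_d$, $d\ge2$, and let $\Gamma=\mathrm{Aut}(G)$, with the forests below defined using the relative weight function $\mathbf{w}_\Gamma$. Then, for every $\beta>0$, $\mathfrak{F}_\beta(G,\boldsymbol{U})=\mathfrak{W}_\beta(G,\boldsymbol{U})$ a.s. In particular, $\mathrm{FMaxSF}(G,\boldsymbol{U})=\mathrm{WMaxSF}(G,\boldsymbol{U})$ a.s., while when $d\ge18$, $p_h(G,\Gamma)<p_u(G)$.
   Context: Grandparent graph: let $T_{1,k}$ be the $(k+1)$-regular tree with edges oriented so that every vertex has exactly one outgoing and $k$ incoming edges. $\mathrm{GP}(k)$, $k\ge2$, is obtained from $T_{1,k}$ by connecting every vertex to the unique vertex at distance $2$ from it reachable along outgoing edges; it is considered as an undirected graph. Relative weights: writing $G=(V,E)$, $\mathbf{w}_\Gamma^y(x):=|\Gamma_x y|/|\Gamma_y x|$ for $x,y\in V$, where $\Gamma_v=\{\gamma\in\Gamma:\gamma v=v\}$. Changing the reference point $y$ multiplies $\mathbf{w}_\Gamma^y(\cdot)$ by a positive constant, which does not affect the notions below; fix $o\in V$ and write $\mathbf{w}=\mathbf{w}_\Gamma^o$. A set of vertices is ($\mathbf{w}_\Gamma$-)heavy if its total weight $\sum_v\mathbf{w}(v)$ is infinite. Forests: $\boldsymbol{U}=(U_e)_{e\in E}$ are i.i.d. $\mathrm{Uniform}[0,1]$ labels. For an edge $e=(x,y)$ put $\mathbf{w}(e)=\min\{\mathbf{w}(x),\mathbf{w}(y)\}$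 and, for $\beta\in[0,\infty)$, $X_{e,\beta}=\mathbf{w}(e)^\beta(1-U_e)$. Define orders on $E$: $e\prec_{\mathbf{w}}e'$ iff $\mathbf{w}(e)<\mathbf{w}(e')$, or $\mathbf{w}(e)=\mathbf{w}(e')$ and $1-U_e<1-U_{e'}$; $e\prec_\beta e'$ iff $X_{e,\beta}<X_{e',\beta}$, or $X_{e,\beta}=X_{e',\beta}$ and $1-U_e<1-U_{e'}$. For each order, the free forest is obtained from $G$ by simultaneously deleting the least edge in every finite cycle, and the wired forest is obtained by additionally deleting every edge that is least on some bi-infinite simple path. The free and wired forests are denoted $\mathrm{FMaxSF}(G,\boldsymbol{U})$, $\mathrm{WMaxSF}(G,\boldsymbol{U})$ for $\prec_{\mathbf{w}}$, and $\mathfrak{F}_\beta(G,\boldsymbol{U})$, $\mathfrak{W}_\beta(G,\boldsymbol{U})$ for $\prec_\beta$. Thresholds: let $\mathbb{P}_p$ be the law of Bernoulli$(p)$ bond percolation on $G$ (each edge present independently with probability $p$); clusters are connected components. $p_h(G,\Gamma)=\inf\{p\in[0,1]:\mathbb{P}_p(\text{there is a heavy cluster})=1\}$ and $p_u(G)=\inf\{p\in[0,1]:\mathbb{P}_p(\text{there is exactly one infinite cluster})=1\}$. *)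

theory Defs
  imports "HOL-Probability.Probability"
begin

section \<open>Graphs\<close>

text \<open>
  A simple undirected graph whose vertex set is the whole type \<open>'v\<close> is given by its set of edges,
  an edge being a two-element set of vertices.
\<close>

type_synonym 'v edges = "'v set set"

definition simple_graph :: "'v edges \<Rightarrow> bool" where
  "simple_graph E \<longleftrightarrow> (\<forall>e\<in>E. card e = 2)"

definition neighbours :: "'v edges \<Rightarrow> 'v \<Rightarrow> 'v set" where
  "neighbours E v = {u. {v, u} \<in> E}"

definition regular :: "nat \<Rightarrow> 'v edges \<Rightarrow> bool" where
  "regular d E \<longleftrightarrow> (\<forall>v. finite (neighbours E v) \<and> card (neighbours E v) = d)"

definition linked :: "'v edges \<Rightarrow> 'v \<Rightarrow> 'v \<Rightarrow> bool" where
  "linked E = (\<lambda>u v. {u, v} \<in> E)\<^sup>*\<^sup>*"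

definition clusters :: "'v edges \<Rightarrow> 'v set set" where
  "clusters E = {{u. linked E v u} | v. True}"

text \<open>Cycles and bi-infinite simple paths are represented by their sets of edges.\<close>

definition cycles :: "'v edges \<Rightarrow> 'v edges set" where
  "cycles E = {C. \<exists>vs. 3 \<le> length vs \<and> distinct vs \<and> C \<subseteq> E \<and>
     C = {{vs ! i, vs ! (Suc i mod length vs)} | i. i < length vs}}"

definition biinfinite_paths :: "'v edges \<Rightarrow> 'v edges set" where
  "biinfinite_paths E = {P. \<exists>\<gamma> :: int \<Rightarrow> 'v. inj \<gamma> \<and> P \<subseteq> E \<and>
     P = {{\<gamma> i, \<gamma> (i + 1)} | i. True}}"

definition regular_tree :: "nat \<Rightarrow> 'v edges \<Rightarrow> bool" where
  "regular_tree d E \<longleftrightarrow>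
     simple_graph E \<and> (\<forall>u v. linked E u v) \<and> cycles E = {} \<and> regular d E"

definition cartesian_product :: "'a edges \<Rightarrow> 'b edges \<Rightarrow> ('a \<times> 'b) edges" where
  "cartesian_product E F =
     {{(x, y), (x', y)} | x x' y. {x, x'} \<in> E} \<union> {{(x, y), (x, y')} | x y y'. {y, y'} \<in> F}"


section \<open>The grandparent graph\<close>

definition underlying :: "('v \<Rightarrow> 'v \<Rightarrow> bool) \<Rightarrow> 'v edges" where
  "underlying A = {{x, y} | x y. A x y}"

text \<open>
  The oriented tree \<open>T\<^sub>1\<^sub>,\<^sub>k\<close>, determined up to isomorphism; \<open>A x y\<close> means that there is an
  arc from \<open>x\<close> to \<open>y\<close>.  For \<open>k \<ge> 2\<close> a model on \<open>int \<times> nat\<close> has the arcs from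
  \<open>(h, n)\<close> to \<open>(h + 1, n div k)\<close>.
\<close>

definition oriented_tree :: "nat \<Rightarrow> ('v \<Rightarrow> 'v \<Rightarrow> bool) \<Rightarrow> bool" where
  "oriented_tree k A \<longleftrightarrow>
     regular_tree (k + 1) (underlying A) \<and>
     (\<forall>x y. A x y \<longrightarrow> \<not> A y x) \<and>
     (\<forall>x. \<exists>!y. A x y) \<and>
     (\<forall>x. finite {y. A y x} \<and> card {y. A y x} = k)"

definition grandparent_graph :: "('v \<Rightarrow> 'v \<Rightarrow> bool) \<Rightarrow> 'v edges" where
  "grandparent_graph A = underlying A \<union> {{x, z} | x y z. A x y \<and> A y z}"


section \<open>Automorphisms and relative weights\<close>

definition Aut :: "'v edges \<Rightarrow> ('v \<Rightarrow> 'v) set" where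
  "Aut E = {g. bij g \<and> (\<forall>u v. {g u, g v} \<in> E \<longleftrightarrow> {u, v} \<in> E)}"

definition stabilizer :: "('v \<Rightarrow> 'v) set \<Rightarrow> 'v \<Rightarrow> ('v \<Rightarrow> 'v) set" where
  "stabilizer \<Gamma> v = {g \<in> \<Gamma>. g v = v}"

text \<open>
  In \<open>rel_weight \<Gamma> y x\<close> the vertex \<open>y\<close> is the reference point.  If the graph is connected and
  locally finite, all the stabilizer orbits are finite.
\<close>

definition rel_weight :: "('v \<Rightarrow> 'v) set \<Rightarrow> 'v \<Rightarrow> 'v \<Rightarrow> real" where
  "rel_weight \<Gamma> y x =
     real (card ((\<lambda>g. g y) ` stabilizer \<Gamma> x)) / real (card ((\<lambda>g. g x) ` stabilizer \<Gamma> y))"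

definition edge_weight :: "('v \<Rightarrow> real) \<Rightarrow> 'v set \<Rightarrow> real" where
  "edge_weight w e = Min (w ` e)"

definition heavy :: "('v \<Rightarrow> real) \<Rightarrow> 'v set \<Rightarrow> bool" where
  "heavy w S \<longleftrightarrow> (\<Sum>\<^sub>\<infinity>v\<in>S. ennreal (w v)) = \<infinity>"


section \<open>Free and wired forests\<close>

text \<open>
  The labels form a point of the product space over the edge set, with independent uniform
  coordinates.
\<close>

definition uniform_labels :: "'v edges \<Rightarrow> ('v set \<Rightarrow> real) measure" where
  "uniform_labels E = Pi\<^sub>M E (\<lambda>_. uniform_measure lborel {0..1})"

definition X :: "('v \<Rightarrow> real) \<Rightarrow> real \<Rightarrow> ('v set \<Rightarrow> real) \<Rightarrow> 'v set \<Rightarrow> real" where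
  "X w \<beta> U e = edge_weight w e powr \<beta> * (1 - U e)"

definition less_weight :: "('v \<Rightarrow> real) \<Rightarrow> ('v set \<Rightarrow> real) \<Rightarrow> 'v set \<Rightarrow> 'v set \<Rightarrow> bool" where
  "less_weight w U e e' \<longleftrightarrow>
     edge_weight w e < edge_weight w e' \<or>
     edge_weight w e = edge_weight w e' \<and> 1 - U e < 1 - U e'"

definition less_beta ::
  "('v \<Rightarrow> real) \<Rightarrow> real \<Rightarrow> ('v set \<Rightarrow> real) \<Rightarrow> 'v set \<Rightarrow> 'v set \<Rightarrow> bool" where
  "less_beta w \<beta> U e e' \<longleftrightarrow>
     X w \<beta> U e < X w \<beta> U e' \<or> X w \<beta> U e = X w \<beta> U e' \<and> 1 - U e < 1 - U e'"

definition least_edge :: "('v set \<Rightarrow> 'v set \<Rightarrow> bool) \<Rightarrow> 'v edges \<Rightarrow> 'v set \<Rightarrow> bool" where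
  "least_edge R S e \<longleftrightarrow> e \<in> S \<and> (\<forall>e'\<in>S. e' \<noteq> e \<longrightarrow> R e e')"

definition free_forest :: "('v set \<Rightarrow> 'v set \<Rightarrow> bool) \<Rightarrow> 'v edges \<Rightarrow> 'v edges" where
  "free_forest R E = E - {e. \<exists>C\<in>cycles E. least_edge R C e}"

definition wired_forest :: "('v set \<Rightarrow> 'v set \<Rightarrow> bool) \<Rightarrow> 'v edges \<Rightarrow> 'v edges" where
  "wired_forest R E = free_forest R E - {e. \<exists>P\<in>biinfinite_paths E. least_edge R P e}"

definition FMaxSF :: "'v edges \<Rightarrow> ('v \<Rightarrow> real) \<Rightarrow> ('v set \<Rightarrow> real) \<Rightarrow> 'v edges" where
  "FMaxSF E w U = free_forest (less_weight w U) E"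

definition WMaxSF :: "'v edges \<Rightarrow> ('v \<Rightarrow> real) \<Rightarrow> ('v set \<Rightarrow> real) \<Rightarrow> 'v edges" where
  "WMaxSF E w U = wired_forest (less_weight w U) E"

definition F_beta :: "'v edges \<Rightarrow> ('v \<Rightarrow> real) \<Rightarrow> real \<Rightarrow> ('v set \<Rightarrow> real) \<Rightarrow> 'v edges" where
  "F_beta E w \<beta> U = free_forest (less_beta w \<beta> U) E"

definition W_beta :: "'v edges \<Rightarrow> ('v \<Rightarrow> real) \<Rightarrow> real \<Rightarrow> ('v set \<Rightarrow> real) \<Rightarrow> 'v edges" where
  "W_beta E w \<beta> U = wired_forest (less_beta w \<beta> U) E"


section \<open>Percolation thresholds\<close>

definition bernoulli_percolation :: "'v edges \<Rightarrow> real \<Rightarrow> ('v set \<Rightarrow> bool) measure" where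
  "bernoulli_percolation E p = Pi\<^sub>M E (\<lambda>_. measure_pmf (bernoulli_pmf p))"

definition open_edges :: "'v edges \<Rightarrow> ('v set \<Rightarrow> bool) \<Rightarrow> 'v edges" where
  "open_edges E \<omega> = {e \<in> E. \<omega> e}"

text \<open>
  Probability one is expressed by \<open>AE\<close>.  The dependence of the heaviness threshold on the group is
  through the weight function \<open>w = rel_weight \<Gamma> y\<close>; as changing \<open>y\<close> rescales \<open>w\<close>, the value does
  not depend on the reference point.
\<close>

definition p_h :: "'v edges \<Rightarrow> ('v \<Rightarrow> real) \<Rightarrow> real" where
  "p_h E w = Inf {p \<in> {0..1}.
     AE \<omega> in bernoulli_percolation E p. \<exists>C\<in>clusters (open_edges E \<omega>). heavy w C}"

definition p_u :: "'v edges \<Rightarrow> real" where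
  "p_u E = Inf {p \<in> {0..1}.
     AE \<omega> in bernoulli_percolation E p. \<exists>!C. C \<in> clusters (open_edges E \<omega>) \<and> infinite C}"

end

(* Relative weights double along the arcs of the grandparent graph and are constant on the fibres
   {x} x T.  Both orders therefore make the edges above a given edge e an independent percolation (given
   the label of e) in which an edge of large weight is open with probability close to 1, summably in
   the height.  By Borel-Cantelli all upward rays are eventually open and, high enough, joined to each
   other: they form a single "sky" cluster.  Every infinite cluster reaches the sky, because its heights
   are bounded below, so that it either visits arbitrarily high ancestors in finitely many fibres or
   enters infinitely many fresh fibres, from each of which it has a fixed chance to climb.  Hence the two
   ends of a bi-infinite path on which e is least are joined without e, and e is least on a cycle.

   For the thresholds, percolation in one fibre {x} x T already gives heavy clusters when p (d - 1) > 1.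
   Conversely, with r = 1 / sqrt (d - 1), the number of walks of length n from a vertex at tree
   distance m of a fibre GP x {t} to that fibre is at most (8 + 2 sqrt (d - 1))^n r^m, so for
   p (8 + 2 sqrt (d - 1)) < 1 a finite set is unlikely to be connected to a far away fibre.  If the
   infinite cluster were unique, a large finite set and its reflection in such a fibre would both meet
   it with high probability, and would be connected across that fibre.  Finally
   8 + 2 sqrt (d - 1) < d - 1 if and only if d >= 18. *)

theory Submission
  imports Defs
begin

section \<open>Paths and cycles\<close>

text \<open>The automorphism group of the product is never determined. The weights need only that
  automorphisms preserve the parent relation, because the kinds of edges differ in the number of
  triangles through them, and that enough reflections exchanging sibling subtrees exist. The orbit
  sizes along a parent edge are then 1 and 2, those along a tree edge are both \<open>d\<close>, and
  the cocycle identity spreads these ratios over the graph. The obstacle for the forests is that the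
  edges above \<open>e\<close> are open with probabilities depending on the level, so that this
  percolation is not invariant under automorphisms that shift levels and uniqueness arguments for
  invariant percolation do not apply. What remains is independence, summability, and a lower bound,
  uniform in the starting point, for an upward ray to be open. For \<open>p_u\<close>, a union bound
  with the full degree would only give 1 / (8 + d), which lies below the bound 1 / (d - 1) for
  \<open>p_h\<close>. Weighting by the distance to the target fibre replaces the degree
  \<open>d\<close> of the tree by its spectral radius 2 sqrt (d - 1).\<close>

lemma linked_refl [simp]: "linked E v v"
  by (simp add: linked_def)

lemma linked_edge: "{u, v} \<in> E \<Longrightarrow> linked E u v"
  by (auto simp: linked_def)

lemma linked_trans: "linked E u v \<Longrightarrow> linked E v x \<Longrightarrow> linked E u x"
  by (auto simp: linked_def)

lemma linked_sym: "linked E u v \<Longrightarrow> linked E v u"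
  unfolding linked_def
  by (rule sympD[OF sympI[THEN symp_rtranclp]]) (auto simp: insert_commute)

lemma linked_mono: "linked E u v \<Longrightarrow> E \<subseteq> F \<Longrightarrow> linked F u v"
  unfolding linked_def by (erule rtranclp_mono[THEN predicate2D, rotated]) auto

lemma linked_induct [consumes 1, case_names refl step]:
  assumes "linked E u v" "P u"
    and "\<And>y z. linked E u y \<Longrightarrow> {y, z} \<in> E \<Longrightarrow> P y \<Longrightarrow> P z"
  shows "P v"
  using assms(1) unfolding linked_def
proof (induction rule: rtranclp_induct)
  case base
  show ?case by (rule assms(2))
next
  case (step y z)
  then show ?case using assms(3)[of y z] by (simp add: linked_def)
qed

lemma linked_image:
  assumes "linked E u v" "\<And>a b. {a, b} \<in> E \<Longrightarrow> {f a, f b} \<in> F"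
  shows "linked F (f u) (f v)"
  using assms(1)
proof (induction rule: linked_induct)
  case (step y z)
  then show ?case using linked_trans[OF step.IH linked_edge[OF assms(2)[OF step.hyps(2)]]] by simp
qed simp

lemma linked_imp_simple_path:
  assumes "linked S u v"
  obtains vs where "vs \<noteq> []" "hd vs = u" "last vs = v" "distinct vs"
    "successively (\<lambda>a b. {a, b} \<in> S) vs"
proof -
  have "\<exists>vs. vs \<noteq> [] \<and> hd vs = u \<and> last vs = v \<and> distinct vs \<and>
      successively (\<lambda>a b. {a, b} \<in> S) vs"
    using assms unfolding linked_def
  proof (induction rule: converse_rtranclp_induct)
    case base
    then show ?case by (intro exI[of _ "[v]"]) auto
  next
    case (step u x)
    then obtain vs where vs: "vs \<noteq> []" "hd vs = x" "last vs = v" "distinct vs"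
      "successively (\<lambda>a b. {a, b} \<in> S) vs" by blast
    show ?case
    proof (cases "u \<in> set vs")
      case True
      \<comment> \<open>The path found so far already visits \<open>u\<close>; the part before that
        visit is cut off.\<close>
      then obtain xs ys where "vs = xs @ u # ys" by (meson split_list)
      with vs show ?thesis
        by (intro exI[of _ "u # ys"]) (auto simp: successively_append_iff)
    next
      case False
      with vs step.hyps show ?thesis
        by (intro exI[of _ "u # vs"]) (auto simp: successively_Cons)
    qed
  qed
  then show ?thesis using that by blast
qed

text \<open>A simple path from \<open>u\<close> to \<open>v\<close> that avoids the edge is closed
  by the edge itself; it has at least three vertices because the only path with two is the excluded
  edge. It serves twice: edges of a tree are bridges, and a connection by larger edges makes an edge
  least on a cycle.\<close>

lemma cycle_through:
  assumes uv: "{u, v} \<in> E" "u \<noteq> v" and S: "S \<subseteq> E - {{u, v}}" and "linked S u v"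
  shows "\<exists>C\<in>cycles E. {u, v} \<in> C \<and> C \<subseteq> insert {u, v} S"
proof -
  from linked_imp_simple_path[OF \<open>linked S u v\<close>] obtain vs where
    vs: "vs \<noteq> []" "hd vs = u" "last vs = v" "distinct vs"
      "successively (\<lambda>a b. {a, b} \<in> S) vs" .
  define C where "C = {{vs ! i, vs ! (Suc i mod length vs)} | i. i < length vs}"
  have len: "3 \<le> length vs"
  proof (rule ccontr)
    assume "\<not> 3 \<le> length vs"
    moreover have "length vs \<noteq> 0" using vs(1) by simp
    ultimately have "length vs = 1 \<or> length vs = 2" by linarith
    then show False
    proof
      assume "length vs = 1"
      then show False using vs uv by (auto simp: length_Suc_conv)
    next
      assume "length vs = 2"
      then obtain a b where "vs = [a, b]" by (auto simp: length_Suc_conv numeral_2_eq_2)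
      then show False using vs S by auto
    qed
  qed
  \<comment> \<open>At the last index the successor wraps around to the first vertex: this is the
    closing edge.\<close>
  have last: "{vs ! (length vs - 1), vs ! (Suc (length vs - 1) mod length vs)} = {u, v}"
    using vs len by (auto simp: hd_conv_nth last_conv_nth insert_commute)
  have inS: "{vs ! i, vs ! (Suc i mod length vs)} \<in> S" if "Suc i < length vs" for i
    using vs(5) that by (auto simp: successively_conv_nth)
  have sub: "C \<subseteq> insert {u, v} S"
  proof
    fix e assume "e \<in> C"
    then obtain i where i: "i < length vs" "e = {vs ! i, vs ! (Suc i mod length vs)}"
      by (auto simp: C_def)
    show "e \<in> insert {u, v} S"
    proof (cases "Suc i < length vs")
      case True
      then show ?thesis using inS i by auto
    next
      case False
      then have "i = length vs - 1" using i by auto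
      then show ?thesis using last i by auto
    qed
  qed
  moreover have "{u, v} \<in> C"
    unfolding C_def using last len by (intro CollectI exI[of _ "length vs - 1"]) auto
  moreover have "C \<in> cycles E"
  proof -
    have "C \<subseteq> E" using sub S uv(1) by auto
    then show ?thesis unfolding cycles_def using len vs(4) C_def by blast
  qed
  ultimately show ?thesis by blast
qed

lemma acyclic_bridge:
  assumes "cycles E = {}" "{u, v} \<in> E" "u \<noteq> v"
  shows "\<not> linked (E - {{u, v}}) u v"
  using cycle_through[OF assms(2,3) order_refl] assms(1) by auto

text \<open>Walks of a given length from a fixed vertex have finitely many ends. Countability lets
  measurability and almost sure statements pass through quantifiers over vertices.\<close>

lemma countable_vertices:
  fixes E :: "'v edges"
  assumes "\<And>u v. linked E u v" "\<And>v. finite (neighbours E v)"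
  shows "countable (UNIV :: 'v set)"
proof -
  fix r :: 'v
  have "finite {v. ((\<lambda>u v. {u, v} \<in> E) ^^ n) r v}" for n
  proof (induction n)
    case (Suc n)
    have "{v. ((\<lambda>u v. {u, v} \<in> E) ^^ Suc n) r v} =
        (\<Union>u\<in>{v. ((\<lambda>u v. {u, v} \<in> E) ^^ n) r v}. neighbours E u)"
      by (auto simp: neighbours_def)
    then show ?case using Suc assms(2) by simp
  qed simp
  then have "countable (\<Union>n. {v. ((\<lambda>u v. {u, v} \<in> E) ^^ n) r v})"
    by (intro countable_UN) (auto intro: countable_finite)
  moreover have "(\<Union>n. {v. ((\<lambda>u v. {u, v} \<in> E) ^^ n) r v}) = UNIV"
  proof -
    have "\<exists>n. ((\<lambda>u v. {u, v} \<in> E) ^^ n) r v" for v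
      using assms(1)[of r v] unfolding linked_def by (rule rtranclp_imp_relpowp[THEN exE]) blast
    then show ?thesis by blast
  qed
  ultimately show ?thesis by simp
qed

section \<open>Exchanging two sibling subtrees\<close>

definition below :: "('v \<Rightarrow> 'v) \<Rightarrow> 'v \<Rightarrow> 'v set" where
  "below p s = {v. \<exists>n. (p ^^ n) v = s}"

lemma below_self [simp]: "s \<in> below p s"
  unfolding below_def by (auto intro: exI[of _ 0])

lemma below_child:
  assumes "p v \<in> below p s"
  shows "v \<in> below p s"
proof -
  from assms obtain n where "(p ^^ n) (p v) = s" by (auto simp: below_def)
  then have "(p ^^ Suc n) v = s" by (simp add: funpow_swap1)
  then show ?thesis unfolding below_def by blast
qed

lemma below_parent:
  assumes "v \<in> below p s" "v \<noteq> s"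
  shows "p v \<in> below p s"
proof -
  from assms obtain n where n: "(p ^^ n) v = s" by (auto simp: below_def)
  with assms(2) obtain m where "n = Suc m" by (cases n) auto
  with n have "(p ^^ m) (p v) = s" by (simp add: funpow_swap1)
  then show ?thesis by (auto simp: below_def)
qed

text \<open>A vertex below \<open>s\<close> is addressed by the labels \<open>l\<close> met on its way up to \<open>s\<close>, and is moved to the
  vertex below \<open>t\<close> with the same address; \<open>c v i\<close> is the child of \<open>v\<close> labelled \<open>i\<close>.\<close>

primrec transplant :: "('v \<Rightarrow> 'v) \<Rightarrow> ('v \<Rightarrow> nat) \<Rightarrow> ('v \<Rightarrow> nat \<Rightarrow> 'v) \<Rightarrow> 'v \<Rightarrow> nat \<Rightarrow> 'v \<Rightarrow> 'v" where
  "transplant p l c t 0 v = t"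
| "transplant p l c t (Suc n) v = c (transplant p l c t n (p v)) (l v)"

text \<open>Every label met on the way up survives the move, so the moved vertex has the same
  address and moving it from \<open>t\<close> to \<open>s\<close> restores it.\<close>

lemma transplant_inverse:
  assumes c: "\<And>v i. v \<in> below p s \<union> below p t \<Longrightarrow> i < k \<Longrightarrow> p (c v i) = v \<and> l (c v i) = i"
    and l: "\<And>v. p v \<in> below p s \<union> below p t \<Longrightarrow> l v < k \<and> c (p v) (l v) = v"
    and v: "(p ^^ n) v = s"
  shows "(p ^^ n) (transplant p l c t n v) = t \<and>
    transplant p l c s n (transplant p l c t n v) = v"
  using v
proof (induction n arbitrary: v)
  case (Suc n)
  let ?F = "transplant p l c"
  have pv: "(p ^^ n) (p v) = s" using Suc.prems by (simp add: funpow_swap1)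
  note IH = Suc.IH[OF pv]
  have inD: "?F t n (p v) \<in> below p t" using IH by (auto simp: below_def)
  have pvD: "p v \<in> below p s" using pv by (auto simp: below_def)
  have lv: "l v < k" "c (p v) (l v) = v" using l[of v] pvD by auto
  have pF: "p (?F t (Suc n) v) = ?F t n (p v)" "l (?F t (Suc n) v) = l v"
    using c[of "?F t n (p v)" "l v"] inD lv by auto
  have 1: "(p ^^ Suc n) (?F t (Suc n) v) = t"
    using IH pF by (simp add: funpow_swap1 del: transplant.simps)
  have 2: "?F s (Suc n) (?F t (Suc n) v) = v"
    unfolding transplant.simps(2)[of p l c s n "?F t (Suc n) v"] pF using IH lv by simp
  show ?case using 1 2 by blast
qed simp

text \<open>All vertices below \<open>u\<close> and \<open>u'\<close> have equally many children, so
  the two subtrees are isomorphic and can be swapped. Only a parent map is assumed: the lemma is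
  applied to a tree with a root and to the oriented tree, where the chain of ancestors never
  ends.\<close>

lemma subtree_exchange:
  fixes p :: "'v \<Rightarrow> 'v"
  assumes sib: "p u = p u'" "u \<noteq> u'"
    and acyc: "\<And>n. (p ^^ Suc n) u \<noteq> u" "\<And>n. (p ^^ Suc n) u' \<noteq> u'"
    and k: "\<And>v. v \<in> below p u \<union> below p u' \<Longrightarrow> finite {x. p x = v} \<and> card {x. p x = v} = k"
  obtains \<phi> where "\<And>v. \<phi> (\<phi> v) = v" "\<And>v. p (\<phi> v) = \<phi> (p v)" "\<phi> u = u'" "\<phi> u' = u"
    "\<And>v. v \<notin> below p u \<union> below p u' \<Longrightarrow> \<phi> v = v"
    "\<And>v. v \<in> below p u \<Longrightarrow> \<phi> v \<in> below p u'"
proof -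
  have powS: "(p ^^ Suc n) u = (p ^^ Suc n) u'" for n
    using sib(1) by (simp add: funpow_swap1)
  have mixed: "(p ^^ n) u \<noteq> u'" "(p ^^ n) u' \<noteq> u" for n
  proof -
    have "n = 0 \<or> (\<exists>m. n = Suc m)" by presburger
    then show "(p ^^ n) u \<noteq> u'" "(p ^^ n) u' \<noteq> u"
      using powS acyc sib(2) by (metis funpow_0)+
  qed
  \<comment> \<open>By acyclicity the number of steps from a vertex up to \<open>u\<close> or
    \<open>u'\<close> is determined; hence the subtrees are disjoint and \<open>lev\<close> below is
    the generation.\<close>
  have uniq: "m = n" if "(p ^^ m) v = s" "(p ^^ n) v = s'" "s \<in> {u, u'}" "s' \<in> {u, u'}" for m n v s s'
  proof -
    have *: False if "(p ^^ m) v = s" "(p ^^ n) v = s'" "s \<in> {u, u'}" "s' \<in> {u, u'}" "m < n" for m n s s'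
    proof -
      obtain j where "n = Suc (m + j)" using less_imp_Suc_add[OF \<open>m < n\<close>] by blast
      then have j: "n = Suc j + m" by simp
      have "(p ^^ Suc j) s = s'" using that(2) unfolding j funpow_add o_apply that(1) .
      then show False using that(3,4) acyc[of j] mixed[of "Suc j"] by (auto simp del: funpow.simps)
    qed
    show ?thesis using *[OF that] *[OF that(2,1,4,3)] by (cases m n rule: linorder_cases) auto
  qed
  have disj: "below p u \<inter> below p u' = {}"
    using uniq sib(2) by (fastforce simp: below_def)
  have "\<forall>v\<in>below p u \<union> below p u'. \<exists>f. bij_betw f {x. p x = v} {..<k}"
    using k ex_bij_betw_finite_nat
    by (metis atLeast0LessThan)
  then obtain f where f: "\<And>v. v \<in> below p u \<union> below p u' \<Longrightarrow> bij_betw (f v) {x. p x = v} {..<k}"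
    by metis
  define l where "l = (\<lambda>x. f (p x) x)"
  define c where "c = (\<lambda>v i. inv_into {x. p x = v} (f v) i)"
  have c: "p (c v i) = v \<and> l (c v i) = i" if "v \<in> below p u \<union> below p u'" "i < k" for v i
  proof -
    have "i \<in> f v ` {x. p x = v}" using f[OF that(1)] that(2) by (auto simp: bij_betw_def)
    then have "c v i \<in> {x. p x = v}" "f v (c v i) = i"
      unfolding c_def by (rule inv_into_into, rule f_inv_into_f)
    then show ?thesis by (simp add: l_def)
  qed
  have l: "l v < k \<and> c (p v) (l v) = v" if "p v \<in> below p u \<union> below p u'" for v
    using f[OF that] unfolding l_def c_def
    by (auto simp: bij_betw_def intro!: inv_into_f_f)
  note T = transplant_inverse[where p = p and l = l and c = c and k = k]
  have Tuu': "(p ^^ n) (transplant p l c u' n v) = u' \<and>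
      transplant p l c u n (transplant p l c u' n v) = v" if "(p ^^ n) v = u" for n v
    by (rule T[OF c l that]) auto
  have Tu'u: "(p ^^ n) (transplant p l c u n v) = u \<and>
      transplant p l c u' n (transplant p l c u n v) = v" if "(p ^^ n) v = u'" for n v
    by (rule T[OF c l that]) auto
  define lev where "lev = (\<lambda>v. LEAST n. (p ^^ n) v \<in> {u, u'})"
  have lev: "lev v = n" if "(p ^^ n) v \<in> {u, u'}" for n v
    unfolding lev_def using uniq[of _ v _ n] that
    by (intro Least_equality) (auto intro: order.refl)
  define \<phi> where "\<phi> = (\<lambda>v. if v \<in> below p u then transplant p l c u' (lev v) v
     else if v \<in> below p u' then transplant p l c u (lev v) v else v)"
  have phi1: "\<phi> v = transplant p l c u' n v" if "(p ^^ n) v = u" for n v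
    using that lev[of n v] by (auto simp: \<phi>_def below_def)
  have phi2: "\<phi> v = transplant p l c u n v" if "(p ^^ n) v = u'" for n v
    using that lev[of n v] disj by (auto simp: \<phi>_def below_def)
  have phi3: "\<phi> v = v" if "v \<notin> below p u \<union> below p u'" for v
    using that by (auto simp: \<phi>_def)
  have phi1': "(p ^^ n) (\<phi> v) = u'" "\<phi> (\<phi> v) = v" if "(p ^^ n) v = u" for n v
    using phi1[OF that] Tuu'[OF that] phi2[of n "\<phi> v"] by auto
  have phi2': "(p ^^ n) (\<phi> v) = u" "\<phi> (\<phi> v) = v" if "(p ^^ n) v = u'" for n v
    using phi2[OF that] Tu'u[OF that] phi1[of n "\<phi> v"] by auto
  have u: "\<phi> u = u'" "\<phi> u' = u" using phi1[of 0 u] phi2[of 0 u'] by auto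
  have inv: "\<phi> (\<phi> v) = v" for v
  proof -
    consider n where "(p ^^ n) v = u" | n where "(p ^^ n) v = u'" | "v \<notin> below p u \<union> below p u'"
      by (auto simp: below_def)
    then show ?thesis by cases (use phi1'(2) phi2'(2) phi3 in auto)
  qed
  \<comment> \<open>The common parent lies outside both subtrees and is fixed, which settles
    generation 0 in the commutation with \<open>p\<close>.\<close>
  have pu: "p u \<notin> below p u \<union> below p u'" "p u' \<notin> below p u \<union> below p u'"
    using acyc sib(1) mixed[of "Suc _"] by (auto simp: below_def funpow_swap1)
  have com: "p (\<phi> v) = \<phi> (p v)" for v
  proof -
    consider n where "(p ^^ n) v = u" | n where "(p ^^ n) v = u'" | "v \<notin> below p u \<union> below p u'"
      by (auto simp: below_def)
    then show ?thesis
    proof cases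
      case 1
      show ?thesis
      proof (cases n)
        case 0
        then show ?thesis using 1 u pu phi3 sib by auto
      next
        case (Suc m)
        then have pv: "(p ^^ m) (p v) = u" using 1 by (simp add: funpow_swap1)
        have "transplant p l c u' m (p v) \<in> below p u'" using Tuu'[OF pv] by (auto simp: below_def)
        moreover have "l v < k" using l[of v] pv by (auto simp: below_def)
        ultimately show ?thesis using phi1[OF 1] phi1[OF pv] c Suc by auto
      qed
    next
      case 2
      show ?thesis
      proof (cases n)
        case 0
        then show ?thesis using 2 u pu phi3 sib by auto
      next
        case (Suc m)
        then have pv: "(p ^^ m) (p v) = u'" using 2 by (simp add: funpow_swap1)
        have "transplant p l c u m (p v) \<in> below p u" using Tu'u[OF pv] by (auto simp: below_def)
        moreover have "l v < k" using l[of v] pv by (auto simp: below_def)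
        ultimately show ?thesis using phi2[OF 2] phi2[OF pv] c Suc by auto
      qed
    next
      case 3
      then have "p v \<notin> below p u \<union> below p u'" using below_child by fastforce
      then show ?thesis using 3 phi3 by auto
    qed
  qed
  show ?thesis
    by (rule that[OF inv com u phi3]) (use phi1'(1) in \<open>auto simp: below_def\<close>)
qed

section \<open>Regular trees seen from a root\<close>

definition gdist :: "'v edges \<Rightarrow> 'v \<Rightarrow> 'v \<Rightarrow> nat" where
  "gdist E u v = (LEAST n. ((\<lambda>a b. {a, b} \<in> E) ^^ n) u v)"

text \<open>The root is its own parent, which makes the map total; hence the recurring side
  condition \<open>v \<noteq> r\<close>. That the chosen neighbour is the only candidate follows in
  \<open>unique_lower_neighbour\<close>.\<close>

definition tree_parent :: "'v edges \<Rightarrow> 'v \<Rightarrow> 'v \<Rightarrow> 'v" where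
  "tree_parent E r v = (if v = r then r else SOME u. {u, v} \<in> E \<and> gdist E r v = Suc (gdist E r u))"

lemma gdist_walk: "linked E u v \<Longrightarrow> ((\<lambda>a b. {a, b} \<in> E) ^^ gdist E u v) u v"
  unfolding gdist_def linked_def by (meson LeastI rtranclp_imp_relpowp)

lemma gdist_le: "((\<lambda>a b. {a, b} \<in> E) ^^ n) u v \<Longrightarrow> gdist E u v \<le> n"
  unfolding gdist_def by (rule Least_le)

lemma gdist_self [simp]: "gdist E v v = 0"
  using gdist_le[of 0 E v v] by simp

lemma gdist_edge: "linked E r u \<Longrightarrow> {u, v} \<in> E \<Longrightarrow> gdist E r v \<le> Suc (gdist E r u)"
  by (intro gdist_le) (auto dest: gdist_walk)

lemma gdist_pred:
  assumes "linked E r v" "v \<noteq> r"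
  shows "\<exists>u. {u, v} \<in> E \<and> gdist E r v = Suc (gdist E r u)"
proof -
  note w = gdist_walk[OF assms(1)]
  then have "gdist E r v \<noteq> 0" using assms(2) by (metis relpowp_0_E)
  then obtain n where n: "gdist E r v = Suc n" using not0_implies_Suc by blast
  then obtain u where u: "((\<lambda>a b. {a, b} \<in> E) ^^ n) r u" "{u, v} \<in> E"
    using w by (auto elim: relpowp_Suc_E)
  have "linked E r u" using u(1) unfolding linked_def by (rule relpowp_imp_rtranclp)
  then show ?thesis using gdist_edge[OF _ u(2)] gdist_le[OF u(1)] n u(2) by fastforce
qed

lemma gdist_triangle:
  assumes "linked E u v" "linked E v x"
  shows "gdist E u x \<le> gdist E u v + gdist E v x"
proof (rule gdist_le)
  show "((\<lambda>a b. {a, b} \<in> E) ^^ (gdist E u v + gdist E v x)) u x"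
    using gdist_walk[OF assms(1)] gdist_walk[OF assms(2)]
    by (auto simp: relpowp_add)
qed

locale rooted_tree =
  fixes T :: "'v edges" and d :: nat and r :: 'v
  assumes tree: "regular_tree d T"
begin

abbreviation "dep \<equiv> gdist T r"
abbreviation "par \<equiv> tree_parent T r"

lemma linked: "linked T u v"
  using tree by (auto simp: regular_tree_def)

lemma edge_neq: "{u, v} \<in> T \<Longrightarrow> u \<noteq> v"
  using tree by (auto simp: regular_tree_def simple_graph_def)

lemma dep_eq_0: "dep v = 0 \<longleftrightarrow> v = r"
  using gdist_walk[OF linked[of r v]] by (metis gdist_self relpowp_0_E)

lemma par_root [simp]: "par r = r"
  by (simp add: tree_parent_def)

lemma par_edge: "v \<noteq> r \<Longrightarrow> {par v, v} \<in> T"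
  and dep_par: "v \<noteq> r \<Longrightarrow> dep v = Suc (dep (par v))"
  using someI_ex[OF gdist_pred[OF linked[of r v]]] by (auto simp: tree_parent_def)

text \<open>Passing to the parent lowers the depth, so the descent to the root never meets another
  vertex at least as deep as its start.\<close>

lemma linked_root_avoiding:
  assumes "dep u \<le> dep v" "u \<noteq> v"
  shows "linked {e \<in> T. v \<notin> e} u r"
  using assms
proof (induction "dep u" arbitrary: u rule: less_induct)
  case less
  show ?case
  proof (cases "u = r")
    case False
    have "dep (par u) < dep u" using dep_par[OF False] by simp
    moreover from this have "linked {e \<in> T. v \<notin> e} (par u) r"
      using less.prems by (intro less.hyps) auto
    moreover have "{u, par u} \<in> {e \<in> T. v \<notin> e}"
      using par_edge[OF False] less.prems \<open>dep (par u) < dep u\<close> by (auto simp: insert_commute)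
    ultimately show ?thesis using linked_trans[OF linked_edge] by metis
  qed auto
qed

text \<open>Otherwise \<open>a\<close> and \<open>b\<close> are joined through the root without
  \<open>v\<close>, and the edge from \<open>b\<close> to \<open>v\<close> closes a cycle through
  \<open>{a, v}\<close>. As the inequalities are not strict, edges between vertices of equal depth
  are excluded as well.\<close>

lemma unique_lower_neighbour:
  assumes "{a, v} \<in> T" "{b, v} \<in> T" "dep a \<le> dep v" "dep b \<le> dep v"
  shows "a = b"
proof (rule ccontr)
  assume "a \<noteq> b"
  have nv: "a \<noteq> v" "b \<noteq> v" using assms edge_neq by auto
  let ?S = "{e \<in> T. v \<notin> e}"
  have "linked ?S a b"
    by (rule linked_trans[OF linked_root_avoiding[OF assms(3) nv(1)]
          linked_sym[OF linked_root_avoiding[OF assms(4) nv(2)]]])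
  then have "linked (T - {{a, v}}) a b" by (rule linked_mono) auto
  moreover have "{b, v} \<in> T - {{a, v}}" using assms(2) \<open>a \<noteq> b\<close> nv by (auto simp: doubleton_eq_iff)
  ultimately have "linked (T - {{a, v}}) a v" by (rule linked_trans[OF _ linked_edge])
  then show False using acyclic_bridge[OF _ assms(1) nv(1)] tree by (auto simp: regular_tree_def)
qed

lemma edge_cases:
  assumes "{u, v} \<in> T"
  shows "u \<noteq> r \<and> v = par u \<or> v \<noteq> r \<and> u = par v"
proof -
  have *: "b \<noteq> r \<and> a = par b" if "{a, b} \<in> T" "dep a \<le> dep b" for a b
  proof -
    have "b \<noteq> r" using that edge_neq dep_eq_0[of a] dep_eq_0[of b] by auto
    then show ?thesis
      using unique_lower_neighbour[OF that(1) par_edge[OF \<open>b \<noteq> r\<close>] that(2)] dep_par[of b] by simp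
  qed
  show ?thesis
    using *[of u v] *[of v u] assms linear[of "dep u" "dep v"] by (auto simp: insert_commute[of v u])
qed

lemma edges_eq: "{u, v} \<in> T \<longleftrightarrow> u \<noteq> r \<and> v = par u \<or> v \<noteq> r \<and> u = par v"
  using edge_cases par_edge by (auto simp: insert_commute)

lemma neighbours_nonroot:
  assumes "v \<noteq> r"
  shows "neighbours T v = insert (par v) {x. x \<noteq> r \<and> par x = v}"
  using assms by (auto simp: neighbours_def edges_eq)

lemma neighbours_root: "neighbours T r = {x. x \<noteq> r \<and> par x = r}"
  by (auto simp: neighbours_def edges_eq)

lemma finite_neighbours: "finite (neighbours T v)" and card_neighbours: "card (neighbours T v) = d"
  using tree by (auto simp: regular_tree_def regular_def)

lemma finite_children: "finite {x. x \<noteq> r \<and> par x = v}"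
  using finite_neighbours[of v] neighbours_nonroot[of v] neighbours_root by (cases "v = r") auto

lemma children_nonroot:
  assumes "v \<noteq> r"
  shows "finite {x. par x = v}" "card {x. par x = v} = d - 1"
proof -
  have eq: "{x. par x = v} = {x. x \<noteq> r \<and> par x = v}" using assms by auto
  then show "finite {x. par x = v}" using finite_children by simp
  have "par v \<notin> {x. par x = v}"
  proof
    assume "par v \<in> {x. par x = v}"
    then have *: "par (par v) = v" by simp
    then have "par v \<noteq> r" using assms par_root by auto
    then show False using dep_par[OF assms] dep_par[of "par v"] * by simp
  qed
  then show "card {x. par x = v} = d - 1"
    using neighbours_nonroot[OF assms] card_neighbours[of v] \<open>finite _\<close> eq by auto
qed

lemma card_children_root: "card {x. x \<noteq> r \<and> par x = r} = d"
  using card_neighbours[of r] neighbours_root by simp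

text \<open>The root has one child more than the other vertices; the uniform bound serves as the
  offspring number in the survival estimate.\<close>

lemma card_children: "d - 1 \<le> card {x. x \<noteq> r \<and> par x = v}"
proof (cases "v = r")
  case False
  then have "{x. x \<noteq> r \<and> par x = v} = {x. par x = v}" by auto
  then show ?thesis using children_nonroot[OF False] by simp
qed (simp add: card_children_root)

lemma dep_par_le: "dep v \<le> Suc (dep (par v))" "dep (par v) \<le> dep v"
  using dep_par[of v] by (cases "v = r"; simp)+

lemma exists_child:
  assumes "2 \<le> d"
  shows "\<exists>x. x \<noteq> r \<and> par x = v"
proof -
  have "card {x. x \<noteq> r \<and> par x = v} \<noteq> 0" using card_children[of v] assms by linarith
  then have "{x. x \<noteq> r \<and> par x = v} \<noteq> {}" by force
  then show ?thesis by auto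
qed

lemma exists_dep:
  assumes "2 \<le> d"
  shows "\<exists>v. dep v = n"
proof (induction n)
  case 0
  then show ?case using gdist_self[of T r] by blast
next
  case (Suc n)
  then obtain v where v: "dep v = n" by blast
  obtain x where "x \<noteq> r" "par x = v" using exists_child[OF assms, of v] by blast
  then have "dep x = Suc n" using dep_par[of x] v by simp
  then show ?case by blast
qed

lemma root_not_below: "u \<noteq> r \<Longrightarrow> r \<notin> below par u"
proof -
  have "(par ^^ n) r = r" for n by (induction n) auto
  then show "u \<noteq> r \<Longrightarrow> r \<notin> below par u" by (auto simp: below_def)
qed

lemma dep_funpow_le: "dep ((par ^^ n) v) \<le> dep v"
  by (induction n) (auto intro: order_trans[OF dep_par_le(2)])

lemma funpow_acyclic:
  assumes "u \<noteq> r"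
  shows "(par ^^ Suc n) u \<noteq> u"
proof
  assume "(par ^^ Suc n) u = u"
  then have "dep u \<le> dep (par u)" using dep_funpow_le[of n "par u"] by (simp add: funpow_swap1)
  then show False using dep_par[OF assms] by simp
qed

text \<open>The root is in neither subtree, so every vertex there has \<open>d - 1\<close> children,
  and the exchange fixes the root and preserves edges. For \<open>par u = r\<close> it is a
  reflection that fixes \<open>r\<close> and swaps two of its branches.\<close>

lemma root_reflection:
  assumes "u \<noteq> r" "u' \<noteq> r" "par u = par u'" "u \<noteq> u'"
  obtains \<phi> where "\<phi> \<in> Aut T" "\<And>v. \<phi> (\<phi> v) = v" "\<phi> (par u) = par u" "\<phi> u = u'"
    "\<And>v. v \<in> below par u \<Longrightarrow> \<phi> v \<in> below par u'"
proof -
  have r: "r \<notin> below par u \<union> below par u'" using root_not_below assms by auto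
  have "finite {x. par x = v} \<and> card {x. par x = v} = d - 1" if "v \<in> below par u \<union> below par u'" for v
    using children_nonroot[of v] r that by metis
  from subtree_exchange[OF assms(3,4) funpow_acyclic[OF assms(1)] funpow_acyclic[OF assms(2)] this]
  obtain \<phi> where phi: "\<And>v. \<phi> (\<phi> v) = v" "\<And>v. par (\<phi> v) = \<phi> (par v)" "\<phi> u = u'" "\<phi> u' = u"
    "\<And>v. v \<notin> below par u \<union> below par u' \<Longrightarrow> \<phi> v = v"
    "\<And>v. v \<in> below par u \<Longrightarrow> \<phi> v \<in> below par u'"
    by metis
  have pu: "\<phi> (par u) = par u" using phi(2,3) assms(3) by metis
  have pr: "\<phi> v = r \<longleftrightarrow> v = r" for v using phi(1,5) r by metis
  have inj: "\<phi> a = \<phi> b \<longleftrightarrow> a = b" for a b using phi(1) by metis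
  have "bij \<phi>" using phi(1) by (intro o_bij[of \<phi>]) (auto simp: fun_eq_iff)
  moreover have "{\<phi> a, \<phi> b} \<in> T \<longleftrightarrow> {a, b} \<in> T" for a b
    unfolding edges_eq by (simp add: pr phi(2) inj)
  ultimately have "\<phi> \<in> Aut T" by (auto simp: Aut_def)
  then show ?thesis using that phi pu by metis
qed

end

section \<open>The oriented tree and its grandparent graph\<close>

locale grandparent_tree =
  fixes A :: "'a \<Rightarrow> 'a \<Rightarrow> bool"
  assumes oriented: "oriented_tree 2 A"
begin

definition up :: "'a \<Rightarrow> 'a" where "up x = (THE y. A x y)"

lemma arc_iff: "A x y \<longleftrightarrow> y = up x"
proof -
  have "\<exists>!y. A x y" using oriented by (auto simp: oriented_tree_def)
  then show ?thesis unfolding up_def by (metis the_equality)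
qed

lemma underlying_iff: "{x, y} \<in> underlying A \<longleftrightarrow> y = up x \<or> x = up y"
  by (auto simp: underlying_def arc_iff doubleton_eq_iff)

lemma underlying_linked: "linked (underlying A) x y"
  and underlying_acyclic: "cycles (underlying A) = {}"
  and underlying_simple: "simple_graph (underlying A)"
  using oriented by (auto simp: oriented_tree_def regular_tree_def)

lemma children: "finite {y. up y = x}" "card {y. up y = x} = 2"
proof -
  have "{y. A y x} = {y. up y = x}" by (auto simp: arc_iff)
  then show "finite {y. up y = x}" "card {y. up y = x} = 2"
    using oriented unfolding oriented_tree_def by metis+
qed

lemma up_neq: "up x \<noteq> x"
proof -
  have "{x, up x} \<in> underlying A" by (simp add: underlying_iff)
  then have "card {x, up x} = 2" using underlying_simple unfolding simple_graph_def by blast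
  then show ?thesis by auto
qed

lemma up_up_neq: "up (up x) \<noteq> x"
proof -
  have "A x (up x) \<longrightarrow> \<not> A (up x) x" using oriented unfolding oriented_tree_def by blast
  then show ?thesis by (simp add: arc_iff eq_commute)
qed

text \<open>On a shortest closed directed walk, the part from \<open>up x\<close> back to
  \<open>x\<close> avoids the edge between \<open>x\<close> and \<open>up x\<close>, although edges
  of a tree are bridges.\<close>

lemma funpow_up_neq: "(up ^^ Suc n) x \<noteq> x"
proof (induction n rule: less_induct)
  case (less n)
  show ?case
  proof
    assume cyc: "(up ^^ Suc n) x = x"
    let ?S = "underlying A - {{x, up x}}"
    have "linked ?S (up x) ((up ^^ Suc m) x)" if "m \<le> n" for m
      using that
    proof (induction m)
      case (Suc m)
      let ?y = "(up ^^ Suc m) x"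
      have y: "?y \<noteq> x" using less.IH[of m] Suc.prems by simp
      \<comment> \<open>The walk could repeat its first edge only in the reverse direction, and
        opposite arcs do not exist.\<close>
      have "{?y, up ?y} \<noteq> {x, up x}"
      proof
        assume "{?y, up ?y} = {x, up x}"
        then have "?y = up x" "up ?y = x" using y by (auto simp: doubleton_eq_iff)
        then show False using up_up_neq by metis
      qed
      then have "{?y, (up ^^ Suc (Suc m)) x} \<in> ?S" by (simp add: underlying_iff)
      then show ?case by (rule linked_trans[OF Suc.IH[OF Suc_leD[OF Suc.prems]] linked_edge])
    qed simp
    from linked_sym[OF this[OF order_refl]] have "linked ?S x (up x)" using cyc by simp
    moreover have "{x, up x} \<in> underlying A" by (simp add: underlying_iff)
    ultimately show False using acyclic_bridge[OF underlying_acyclic _ up_neq[symmetric]] by blast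
  qed
qed

lemma funpow_up_inj: "(up ^^ m) x = (up ^^ n) x \<longleftrightarrow> m = n"
proof -
  have *: "(up ^^ m) x \<noteq> (up ^^ n) x" if "m < n" for m n
  proof -
    obtain k where "n = Suc (m + k)" using less_imp_Suc_add[OF \<open>m < n\<close>] by blast
    then have "n = Suc k + m" by simp
    then have "(up ^^ n) x = (up ^^ Suc k) ((up ^^ m) x)" by (simp only: funpow_add o_apply)
    then show ?thesis using funpow_up_neq[of k "(up ^^ m) x"] by simp
  qed
  show ?thesis using *[of m n] *[of n m] by (cases m n rule: linorder_cases) auto
qed

text \<open>An edge spans at most two generations, so a triangle can force a coincidence over at
  most six of them.\<close>

lemma up_distinct [simp]:
  "up x \<noteq> x" "up (up x) \<noteq> x" "up (up (up x)) \<noteq> x" "up (up (up (up x))) \<noteq> x"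
  "up (up (up (up (up x)))) \<noteq> x" "up (up (up (up (up (up x))))) \<noteq> x"
  using funpow_up_neq[of 0 x] funpow_up_neq[of "Suc 0" x] funpow_up_neq[of "Suc (Suc 0)" x]
    funpow_up_neq[of "Suc (Suc (Suc 0))" x] funpow_up_neq[of "Suc (Suc (Suc (Suc 0)))" x]
    funpow_up_neq[of "Suc (Suc (Suc (Suc (Suc 0))))" x]
  by simp_all

lemmas up_distinct' [simp] = up_distinct[symmetric]

lemma common_ancestor: "\<exists>m n. (up ^^ m) x = (up ^^ n) y"
  using underlying_linked[of x y]
proof (induction rule: linked_induct)
  case refl
  then show ?case by blast
next
  case (step y z)
  then obtain m n where mn: "(up ^^ m) x = (up ^^ n) y" by blast
  from step(2) consider "z = up y" | "y = up z" by (auto simp: underlying_iff)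
  then show ?case
  proof cases
    case 1
    then have "(up ^^ Suc m) x = (up ^^ n) z" using mn by (simp add: funpow_swap1)
    then show ?thesis by blast
  next
    case 2
    then have "(up ^^ m) x = (up ^^ Suc n) z" using mn by (simp add: funpow_swap1)
    then show ?thesis by blast
  qed
qed

text \<open>The Busemann function of the end to which the arcs point, zero at \<open>o'\<close>. Any
  common ancestor gives the same value, by \<open>height_eqI\<close>.\<close>

definition height :: "'a \<Rightarrow> 'a \<Rightarrow> int" where
  "height o' x = (SOME k. \<exists>m n. (up ^^ n) x = (up ^^ m) o' \<and> k = int m - int n)"

lemma height_eqI:
  assumes "(up ^^ n) x = (up ^^ m) o'"
  shows "height o' x = int m - int n"
proof -
  have "\<exists>m n. (up ^^ n) x = (up ^^ m) o' \<and> height o' x = int m - int n"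
    unfolding height_def by (rule someI_ex) (use assms in blast)
  then obtain m' n' where 1: "(up ^^ n') x = (up ^^ m') o'" "height o' x = int m' - int n'" by blast
  \<comment> \<open>Both pairs are compared in a common further ancestor; the iterates of
    \<open>up\<close> at \<open>o'\<close> are distinct, so the exponents agree.\<close>
  have "(up ^^ (n' + m)) o' = (up ^^ n') ((up ^^ n) x)" using assms by (simp add: funpow_add)
  also have "\<dots> = (up ^^ n) ((up ^^ n') x)" unfolding funpow_add[symmetric, THEN fun_cong, unfolded o_apply] by (simp add: add.commute)
  also have "\<dots> = (up ^^ (n + m')) o'" using 1 by (simp add: funpow_add)
  finally have "n' + m = n + m'" by (simp add: funpow_up_inj)
  then show ?thesis using 1 by simp
qed

lemma height_up [simp]: "height o' (up x) = height o' x + 1"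
proof -
  obtain m n where mn: "(up ^^ m) x = (up ^^ n) o'" using common_ancestor by blast
  then have "(up ^^ m) (up x) = (up ^^ Suc n) o'" by (simp add: funpow_swap1[symmetric])
  from height_eqI[OF this] height_eqI[OF mn] show ?thesis by simp
qed

lemma height_funpow [simp]: "height o' ((up ^^ n) x) = height o' x + int n"
  by (induction n) auto

lemma finite_descendants: "finite {y. (up ^^ n) y = z}"
proof (induction n arbitrary: z)
  case (Suc n)
  have "{y. (up ^^ Suc n) y = z} = (\<Union>x\<in>{x. up x = z}. {y. (up ^^ n) y = x})"
    by auto
  then show ?case using Suc children(1) by simp
qed simp

definition gp :: "'a edges" where "gp = grandparent_graph A"

lemma gp_iff: "{x, y} \<in> gp \<longleftrightarrow> y = up x \<or> x = up y \<or> y = up (up x) \<or> x = up (up y)"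
  unfolding gp_def grandparent_graph_def
  by (auto simp: underlying_iff arc_iff doubleton_eq_iff)

lemma gp_neighbours:
  "neighbours gp x = {up x, up (up x)} \<union> {y. up y = x} \<union> {y. up (up y) = x}"
  by (auto simp: neighbours_def gp_iff)

lemma grandchildren: "{y. up (up y) = x} = (\<Union>z\<in>{z. up z = x}. {y. up y = z})"
  by auto

lemma finite_gp_neighbours: "finite (neighbours gp x)"
  unfolding gp_neighbours grandchildren using children by auto

text \<open>Parent and grandparent, two children, four grandchildren: this is the 8 in the growth
  rate of walks.\<close>

lemma card_gp_neighbours: "card (neighbours gp x) \<le> 8"
proof -
  have "card {y. up (up y) = x} \<le> (\<Sum>z\<in>{z. up z = x}. card {y. up y = z})"
    unfolding grandchildren using children by (intro card_UN_le)
  also have "\<dots> = 4" by (simp add: children)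
  finally have 4: "card {y. up (up y) = x} \<le> 4" .
  have "card ({up x, up (up x)} \<union> {y. up y = x} \<union> {y. up (up y) = x}) \<le>
      card {up x, up (up x)} + card {y. up y = x} + card {y. up (up y) = x}"
    by (meson add_mono card_Un_le order_refl order_trans)
  also have "\<dots> \<le> 2 + 2 + 4" using 4 children(2) by (intro add_mono) (auto simp: card_insert_if)
  finally show ?thesis by (simp add: gp_neighbours)
qed

lemma gp_linked: "linked gp x y"
  by (rule linked_mono[OF underlying_linked]) (auto simp: gp_def grandparent_graph_def)

text \<open>An involution that commutes with \<open>up\<close> preserves parent edges and
  grandparent edges alike.\<close>

lemma sibling_reflection:
  assumes "up u = up u'" "u \<noteq> u'"
  obtains \<phi> where "\<phi> \<in> Aut gp" "\<phi> (up u) = up u" "\<phi> u = u'"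
proof -
  have "finite {x. up x = v} \<and> card {x. up x = v} = 2" for v using children by simp
  from subtree_exchange[OF assms funpow_up_neq funpow_up_neq this]
  obtain \<phi> where phi: "\<And>v. \<phi> (\<phi> v) = v" "\<And>v. up (\<phi> v) = \<phi> (up v)" "\<phi> u = u'" "\<phi> u' = u"
    by metis
  have "\<phi> (up u) = up u" using phi(2,3) assms by metis
  moreover have "bij \<phi>" using phi(1) by (intro o_bij[of \<phi>]) (auto simp: fun_eq_iff)
  moreover have "\<phi> a = \<phi> b \<longleftrightarrow> a = b" for a b using phi(1) by metis
  ultimately show ?thesis using that[of \<phi>] phi(3) by (simp add: Aut_def gp_iff phi(2))
qed

end

section \<open>Automorphisms and relative weights\<close>

lemma Aut_edge: "g \<in> Aut E \<Longrightarrow> {g u, g v} \<in> E \<longleftrightarrow> {u, v} \<in> E"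
  by (auto simp: Aut_def)

lemma Aut_surj: "g \<in> Aut E \<Longrightarrow> \<exists>u. v = g u"
  unfolding Aut_def bij_def by (auto dest: surjD)

lemma Aut_comp: "g \<in> Aut E \<Longrightarrow> h \<in> Aut E \<Longrightarrow> g \<circ> h \<in> Aut E"
  by (auto simp: Aut_def bij_comp)

lemma Aut_inv:
  assumes "g \<in> Aut E"
  shows "inv g \<in> Aut E" "inv g (g x) = x" "g (inv g x) = x"
proof -
  have b: "bij g" using assms by (auto simp: Aut_def)
  show 1: "inv g (g x) = x" for x using b by (simp add: bij_def inv_f_f)
  show 2: "g (inv g x) = x" for x using b by (simp add: bij_def surj_f_inv_f)
  have "{inv g u, inv g v} \<in> E \<longleftrightarrow> {u, v} \<in> E" for u v
    using Aut_edge[OF assms, of "inv g u" "inv g v"] by (simp add: 2)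
  then show "inv g \<in> Aut E" using b by (simp add: Aut_def bij_imp_bij_inv)
qed

lemma id_Aut: "id \<in> Aut E"
  by (auto simp: Aut_def)

lemma Aut_neighbours:
  assumes "g \<in> Aut E"
  shows "g ` neighbours E v = neighbours E (g v)"
proof -
  have "y \<in> g ` neighbours E v" if "{g v, y} \<in> E" for y
    using Aut_surj[OF assms, of y] Aut_edge[OF assms] that by (auto simp: neighbours_def)
  then show ?thesis using Aut_edge[OF assms] by (auto simp: neighbours_def)
qed

text \<open>For an edge, the size counts the triangles through it, an invariant of automorphisms
  that separates the kinds of edges.\<close>

definition common_nbrs :: "'v edges \<Rightarrow> 'v \<Rightarrow> 'v \<Rightarrow> 'v set" where
  "common_nbrs E u v = neighbours E u \<inter> neighbours E v"

lemma Aut_card_common_nbrs: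
  assumes "g \<in> Aut E"
  shows "card (common_nbrs E (g u) (g v)) = card (common_nbrs E u v)"
proof -
  have inj: "inj g" using assms by (auto simp: Aut_def bij_def)
  have "common_nbrs E (g u) (g v) = g ` common_nbrs E u v"
    unfolding common_nbrs_def Aut_neighbours[OF assms, symmetric] using image_Int[OF inj] by metis
  then show ?thesis using card_image[OF inj_on_subset[OF inj]] by simp
qed

definition orbit :: "('v \<Rightarrow> 'v) set \<Rightarrow> 'v \<Rightarrow> 'v \<Rightarrow> 'v set" where
  "orbit \<Gamma> x y = (\<lambda>g. g y) ` stabilizer \<Gamma> x"

lemma rel_weight_orbit: "rel_weight \<Gamma> y x = real (card (orbit \<Gamma> x y)) / real (card (orbit \<Gamma> y x))"
  by (simp add: rel_weight_def orbit_def)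

lemma orbitI: "g \<in> \<Gamma> \<Longrightarrow> g x = x \<Longrightarrow> g y = z \<Longrightarrow> z \<in> orbit \<Gamma> x y"
  by (auto simp: orbit_def stabilizer_def)

lemma orbitE:
  assumes "z \<in> orbit \<Gamma> x y"
  obtains g where "g \<in> \<Gamma>" "g x = x" "g y = z"
  using assms by (auto simp: orbit_def stabilizer_def)

lemma self_in_orbit: "y \<in> orbit (Aut E) x y"
  by (rule orbitI[OF id_Aut]) auto

text \<open>Along a path from \<open>x\<close>, each image is a neighbour of an image of the
  preceding vertex. Since \<open>card\<close> is 0 on infinite sets, finiteness is what gives
  \<open>rel_weight\<close> its meaning.\<close>

lemma finite_orbit:
  assumes "linked E x y" "\<And>v. finite (neighbours E v)"
  shows "finite (orbit (Aut E) x y)"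
  using assms(1)
proof (induction rule: linked_induct)
  case refl
  have "orbit (Aut E) x x \<subseteq> {x}" by (auto elim!: orbitE)
  then show ?case by (rule finite_subset) simp
next
  case (step y z)
  have "orbit (Aut E) x z \<subseteq> (\<Union>v\<in>orbit (Aut E) x y. neighbours E v)"
  proof
    fix v assume "v \<in> orbit (Aut E) x z"
    then obtain g where g: "g \<in> Aut E" "g x = x" "g z = v" by (rule orbitE)
    then have "v \<in> neighbours E (g y)" using step.hyps(2) Aut_edge[OF g(1), of y z]
      by (auto simp: neighbours_def)
    then show "v \<in> (\<Union>v\<in>orbit (Aut E) x y. neighbours E v)" using orbitI[OF g(1,2) refl] by blast
  qed
  then show ?case by (rule finite_subset) (use step.IH assms(2) in auto)
qed

definition pair_orbit :: "('v \<Rightarrow> 'v) set \<Rightarrow> 'v \<Rightarrow> 'v \<Rightarrow> 'v \<Rightarrow> ('v \<times> 'v) set" where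
  "pair_orbit \<Gamma> x y z = (\<lambda>g. (g y, g z)) ` stabilizer \<Gamma> x"

text \<open>Orbit-stabilizer counting: the pairs with first entry \<open>h y\<close> are obtained by
  applying \<open>h\<close> to the orbit of \<open>z\<close> under the automorphisms fixing
  \<open>x\<close> and \<open>y\<close>, so all first entries have equally many partners.\<close>

lemma card_pair_orbit:
  assumes fin: "\<And>x y. finite (orbit (Aut E) x y)"
  shows "card (pair_orbit (Aut E) x y z) =
    card (orbit (Aut E) x y) * card ((\<lambda>g. g z) ` stabilizer (stabilizer (Aut E) x) y)"
proof -
  let ?\<Gamma> = "Aut E"
  let ?F = "(\<lambda>g. g z) ` stabilizer (stabilizer ?\<Gamma> x) y"
  let ?P = "\<lambda>a. {b. (a, b) \<in> pair_orbit ?\<Gamma> x y z}"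
  have eq: "pair_orbit ?\<Gamma> x y z = (SIGMA a : orbit ?\<Gamma> x y. ?P a)"
    by (auto simp: pair_orbit_def orbit_def)
  have card: "card (?P a) = card ?F \<and> finite (?P a)" if a: "a \<in> orbit ?\<Gamma> x y" for a
  proof -
    from a obtain h where h: "h \<in> ?\<Gamma>" "h x = x" "h y = a" by (rule orbitE)
    have "?P a = h ` ?F"
    proof (intro equalityI subsetI)
      fix b assume "b \<in> ?P a"
      then obtain g where g: "g \<in> ?\<Gamma>" "g x = x" "g y = a" "g z = b"
        by (auto simp: pair_orbit_def stabilizer_def)
      have "inv h \<circ> g \<in> stabilizer (stabilizer ?\<Gamma> x) y"
        using Aut_comp[OF Aut_inv(1)[OF h(1)] g(1)] g h Aut_inv(2)[OF h(1), of x] Aut_inv(2)[OF h(1), of y]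
        by (auto simp: stabilizer_def)
      moreover have "b = h ((inv h \<circ> g) z)" using g Aut_inv(3)[OF h(1)] by simp
      ultimately show "b \<in> h ` ?F" by blast
    next
      fix b assume "b \<in> h ` ?F"
      then obtain g where g: "g \<in> ?\<Gamma>" "g x = x" "g y = y" "b = h (g z)"
        by (auto simp: stabilizer_def)
      have "h \<circ> g \<in> stabilizer ?\<Gamma> x" using Aut_comp[OF h(1) g(1)] g h by (auto simp: stabilizer_def)
      then have "((h \<circ> g) y, (h \<circ> g) z) \<in> pair_orbit ?\<Gamma> x y z" unfolding pair_orbit_def by (rule image_eqI[of _ _ "h \<circ> g", rotated]) simp
      then show "b \<in> ?P a" using g h by simp
    qed
    moreover have "inj_on h ?F" using h(1) by (auto simp: Aut_def bij_def intro: inj_on_subset)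
    moreover have "?F \<subseteq> orbit ?\<Gamma> x z" by (auto simp: orbit_def stabilizer_def)
    then have "finite ?F" using fin finite_subset by blast
    ultimately show ?thesis using card_image[of h ?F] by simp
  qed
  have "card (pair_orbit ?\<Gamma> x y z) = (\<Sum>a\<in>orbit ?\<Gamma> x y. card (?P a))"
    by (subst (1) eq, rule card_SigmaI) (use card fin in auto)
  then show ?thesis using card by simp
qed

lemma card_pair_orbit_swap: "card (pair_orbit \<Gamma> x y z) = card (pair_orbit \<Gamma> x z y)"
proof -
  have "pair_orbit \<Gamma> x y z = prod.swap ` pair_orbit \<Gamma> x z y"
    by (auto simp: pair_orbit_def image_image)
  then show ?thesis by (simp add: card_image)
qed

lemma stabilizer_commute: "stabilizer (stabilizer \<Gamma> x) y = stabilizer (stabilizer \<Gamma> y) x"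
  by (auto simp: stabilizer_def)

text \<open>Counting pairs in both orders gives one identity with base point at each of
  \<open>x\<close>, \<open>y\<close>, \<open>z\<close>. In the product of the three, the orbit sizes
  of the double stabilizers cancel.\<close>

lemma rel_weight_cocycle:
  assumes fin: "\<And>x y. finite (orbit (Aut E) x y)"
  shows "rel_weight (Aut E) z x = rel_weight (Aut E) z y * rel_weight (Aut E) y x"
proof -
  let ?c = "\<lambda>x y. real (card (orbit (Aut E) x y))"
  let ?s = "\<lambda>x y z. real (card ((\<lambda>g. g z) ` stabilizer (stabilizer (Aut E) x) y))"
  have pos: "?c x y > 0" for x y
    using fin[of x y] self_in_orbit[of y E x] card_gt_0_iff[of "orbit (Aut E) x y"] by auto
  have spos: "?s x y z > 0" for x y z
  proof -
    have "id \<in> stabilizer (stabilizer (Aut E) x) y" using id_Aut by (auto simp: stabilizer_def)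
    moreover have "(\<lambda>g. g z) ` stabilizer (stabilizer (Aut E) x) y \<subseteq> orbit (Aut E) x z"
      by (auto simp: orbit_def stabilizer_def)
    ultimately show ?thesis using finite_subset[OF _ fin] by (auto simp: card_gt_0_iff)
  qed
  have eq: "?c x y * ?s x y z = ?c x z * ?s x z y" for x y z
    using card_pair_orbit[OF fin, of x y z] card_pair_orbit[OF fin, of x z y]
      card_pair_orbit_swap[of "Aut E" x y z] by (metis of_nat_mult)
  have 1: "?c x y * ?s x y z = ?c x z * ?s x z y" by (rule eq)
  have 2: "?c y x * ?s x y z = ?c y z * ?s y z x" using eq[of y x z] by (simp add: stabilizer_commute)
  have 3: "?c z x * ?s x z y = ?c z y * ?s y z x" using eq[of z x y] by (simp add: stabilizer_commute)
  have "?c x z * ?c y x * ?c z y = ?c x y * ?c y z * ?c z x"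
  proof -
    have "?c x z * ?c y x * ?c z y * (?s x y z * ?s y z x * ?s x z y)
      = (?c y x * ?s x y z) * (?c z y * ?s y z x) * (?c x z * ?s x z y)" by (simp add: ac_simps)
    also have "\<dots> = (?c y z * ?s y z x) * (?c z x * ?s x z y) * (?c x y * ?s x y z)"
      by (simp only: 1[symmetric] 2 3)
    also have "\<dots> = ?c x y * ?c y z * ?c z x * (?s x y z * ?s y z x * ?s x z y)" by (simp add: ac_simps)
    finally show ?thesis
      using spos[where x = x and y = y and z = z] spos[where x = y and y = z and z = x]
        spos[where x = x and y = z and z = y] by simp
  qed
  then show ?thesis
    unfolding rel_weight_orbit using pos[of x z] pos[of z x] pos[of x y] pos[of y x] pos[of y z] pos[of z y]
    by (simp add: field_simps)
qed

section \<open>The product graph\<close>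

lemma (in rooted_tree) triangle_free: "{r, s} \<in> T \<Longrightarrow> {r, s'} \<in> T \<Longrightarrow> {s, s'} \<notin> T"
  using edge_neq[of s s'] edge_neq[of r s] edge_neq[of r s'] par_root by (auto simp: edges_eq)

locale gp_product = grandparent_tree A for A :: "'a \<Rightarrow> 'a \<Rightarrow> bool" +
  fixes T :: "'b edges" and d :: nat
  assumes tree: "regular_tree d T" and d2: "2 \<le> d"
begin

definition G :: "('a \<times> 'b) edges" where "G = cartesian_product gp T"

lemma rooted: "rooted_tree T d"
  by standard (rule tree)

lemma tree_linked: "linked T s t"
  by (rule rooted_tree.linked[OF rooted])

lemma tree_edge_neq: "{s, t} \<in> T \<Longrightarrow> s \<noteq> t"
  by (rule rooted_tree.edge_neq[OF rooted])

lemma no_loop [simp]: "{s} \<notin> T"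
  using tree_edge_neq[of s s] by auto

lemma triangle_free: "{t, s} \<in> T \<Longrightarrow> {t, s'} \<in> T \<Longrightarrow> {s, s'} \<notin> T"
  by (rule rooted_tree.triangle_free[OF rooted])

lemma gp_irrefl [simp]: "{x} \<notin> gp"
  using gp_iff[of x x] by simp

lemma G_iff: "{(x, t), (y, s)} \<in> G \<longleftrightarrow> t = s \<and> {x, y} \<in> gp \<or> x = y \<and> {t, s} \<in> T"
proof
  assume "{(x, t), (y, s)} \<in> G"
  then show "t = s \<and> {x, y} \<in> gp \<or> x = y \<and> {t, s} \<in> T"
    unfolding G_def cartesian_product_def
    by (auto simp: doubleton_eq_iff insert_commute[of y x] insert_commute[of s t])
next
  assume "t = s \<and> {x, y} \<in> gp \<or> x = y \<and> {t, s} \<in> T"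
  then show "{(x, t), (y, s)} \<in> G"
    unfolding G_def cartesian_product_def by blast
qed

lemma G_iff': "{u, v} \<in> G \<longleftrightarrow> snd u = snd v \<and> {fst u, fst v} \<in> gp \<or> fst u = fst v \<and> {snd u, snd v} \<in> T"
  using G_iff[of "fst u" "snd u" "fst v" "snd v"] by simp

lemma G_edgeE:
  assumes "e \<in> G"
  obtains u v where "e = {u, v}" "u \<noteq> v"
  using assms unfolding G_def cartesian_product_def
proof (elim UnE CollectE exE conjE)
  fix x x' y assume "e = {(x, y), (x', y)}" "{x, x'} \<in> gp"
  moreover from this have "x \<noteq> x'" by auto
  ultimately show thesis by (intro that) auto
next
  fix x y y' assume "e = {(x, y), (x, y')}" "{y, y'} \<in> T"
  moreover from this have "y \<noteq> y'" by auto
  ultimately show thesis by (intro that) auto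
qed

lemma neighbours_G: "neighbours G (x, t) = (\<lambda>y. (y, t)) ` neighbours gp x \<union> Pair x ` neighbours T t"
  by (auto simp: neighbours_def G_iff)

lemma finite_neighbours_T: "finite (neighbours T t)" and card_neighbours_T: "card (neighbours T t) = d"
  using tree by (auto simp: regular_tree_def regular_def)

lemma finite_neighbours_G: "finite (neighbours G v)"
  by (cases v) (simp add: neighbours_G finite_gp_neighbours finite_neighbours_T)

lemma fibre_linked: "linked G (x, t) (x, s)"
  by (rule linked_image[OF tree_linked]) (simp add: G_iff)

lemma G_linked: "linked G u v"
proof -
  have "linked G (x, t) (y, t)" for x y t
    by (rule linked_image[OF gp_linked]) (simp add: G_iff)
  then show ?thesis using linked_trans[OF _ fibre_linked] by (metis prod.exhaust)
qed

lemma countable_V: "countable (UNIV :: ('a \<times> 'b) set)"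
  by (rule countable_vertices[OF G_linked finite_neighbours_G])

lemma common_nbrs_tree:
  assumes "{t, s} \<in> T"
  shows "common_nbrs G (x, t) (x, s) = {}"
  using assms triangle_free[of _ t s] tree_edge_neq[OF assms]
  by (auto simp: common_nbrs_def neighbours_def G_iff insert_commute)

lemma common_nbrs_grandparent: "common_nbrs G (x, t) (up (up x), t) = {(up x, t)}"
  by (auto simp: common_nbrs_def neighbours_def G_iff gp_iff)

text \<open>The parent of \<open>up x\<close> and a child of \<open>x\<close> each complete a
  triangle.\<close>

lemma common_nbrs_parent: "2 \<le> card (common_nbrs G (x, t) (up x, t))"
proof -
  obtain c where c: "up c = x" using children(2)[of x] by (metis (mono_tags) card.empty empty_Collect_eq zero_neq_numeral)
  have "{(up (up x), t), (c, t)} \<subseteq> common_nbrs G (x, t) (up x, t)"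
    using c by (auto simp: common_nbrs_def neighbours_def G_iff gp_iff)
  moreover have "card {(up (up x), t), (c, t)} = 2" using c by auto
  moreover have "finite (common_nbrs G (x, t) (up x, t))"
    by (simp add: common_nbrs_def finite_neighbours_G)
  ultimately show ?thesis by (metis card_mono)
qed

lemma common_nbrs_commute: "common_nbrs E u v = common_nbrs E v u"
  by (auto simp: common_nbrs_def)

text \<open>Parent edges are those in at least two triangles, and the parent of a vertex is the endpoint
  of such an edge that is adjacent to all the others.  Hence the orientation is visible in the graph.\<close>

definition arc_edge :: "'a \<times> 'b \<Rightarrow> 'a \<times> 'b \<Rightarrow> bool" where
  "arc_edge u v \<longleftrightarrow> {u, v} \<in> G \<and> 2 \<le> card (common_nbrs G u v)"

lemma arc_edge_iff: "arc_edge (x, t) (y, s) \<longleftrightarrow> t = s \<and> (y = up x \<or> x = up y)"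
proof
  assume a: "arc_edge (x, t) (y, s)"
  show "t = s \<and> (y = up x \<or> x = up y)"
  proof (rule ccontr)
    assume "\<not> ?thesis"
    then consider "{t, s} \<in> T" "x = y" | "t = s" "y = up (up x)" | "t = s" "x = up (up y)"
      using a by (auto simp: arc_edge_def G_iff gp_iff)
    then show False
      by cases (use a common_nbrs_tree common_nbrs_grandparent[of x t] common_nbrs_grandparent[of y t] in
        \<open>auto simp: arc_edge_def common_nbrs_commute[of G "(up (up y), _)"]\<close>)
  qed
next
  assume "t = s \<and> (y = up x \<or> x = up y)"
  then show "arc_edge (x, t) (y, s)"
    using common_nbrs_parent[of x t] common_nbrs_parent[of y t]
    by (auto simp: arc_edge_def G_iff gp_iff common_nbrs_commute[of G "(up y, _)"])
qed

lemma arc_edge_Aut: "g \<in> Aut G \<Longrightarrow> arc_edge (g u) (g v) \<longleftrightarrow> arc_edge u v"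
  by (simp add: arc_edge_def Aut_edge Aut_card_common_nbrs)

definition parent_of :: "'a \<times> 'b \<Rightarrow> 'a \<times> 'b \<Rightarrow> bool" where
  "parent_of u v \<longleftrightarrow> arc_edge u v \<and> (\<forall>z. arc_edge u z \<longrightarrow> z = v \<or> {v, z} \<in> G)"

lemma parent_of_iff: "parent_of (x, t) v \<longleftrightarrow> v = (up x, t)"
proof
  assume p: "parent_of (x, t) v"
  obtain y s where v: "v = (y, s)" by (cases v)
  have s: "s = t" "y = up x \<or> x = up y" using p by (auto simp: parent_of_def v arc_edge_iff)
  show "v = (up x, t)"
  proof (rule ccontr)
    assume "v \<noteq> (up x, t)"
    then have y: "up y = x" using s v by auto
    \<comment> \<open>If \<open>v\<close> were a child of \<open>x\<close>, the other child would be
      joined to \<open>x\<close> by a parent edge without being adjacent to its sibling.\<close>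
    obtain c where c: "up c = x" "c \<noteq> y"
    proof -
      have "card ({c. up c = x} - {y}) = 1" using children[of x] y by simp
      then have "{c. up c = x} - {y} \<noteq> {}" by force
      then show ?thesis using that by auto
    qed
    then have "arc_edge (x, t) (c, t)" by (simp add: arc_edge_iff)
    then have "{(y, t), (c, t)} \<in> G" using p c s v by (auto simp: parent_of_def)
    then have "{y, c} \<in> gp" by (simp add: G_iff)
    then show False using c y by (auto simp: gp_iff)
  qed
next
  assume v: "v = (up x, t)"
  have "z = (up x, t) \<or> {(up x, t), z} \<in> G" if "arc_edge (x, t) z" for z
  proof (cases z)
    case (Pair y s)
    with that have "s = t" "y = up x \<or> x = up y" by (auto simp: arc_edge_iff)
    then show ?thesis using Pair by (auto simp: G_iff gp_iff)
  qed
  then show "parent_of (x, t) v" by (simp add: v parent_of_def arc_edge_iff)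
qed

lemma parent_of_Aut:
  assumes g: "g \<in> Aut G" and p: "parent_of u v"
  shows "parent_of (g u) (g v)"
  unfolding parent_of_def
proof (intro conjI allI impI)
  show "arc_edge (g u) (g v)" using p arc_edge_Aut[OF g] by (simp add: parent_of_def)
  fix z assume z: "arc_edge (g u) z"
  obtain z' where z': "z = g z'" using Aut_surj[OF g] by blast
  then have "arc_edge u z'" using z arc_edge_Aut[OF g] by simp
  then have "z' = v \<or> {v, z'} \<in> G" using p unfolding parent_of_def by blast
  then show "z = g v \<or> {g v, z} \<in> G" using z' Aut_edge[OF g] by auto
qed

lemma Aut_parent:
  assumes g: "g \<in> Aut G" and "g (x, t) = (y, s)"
  shows "g (up x, t) = (up y, s)"
  using parent_of_Aut[OF g, of "(x, t)" "(up x, t)"] assms(2) by (simp add: parent_of_iff)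

lemma Aut_map_fst: "\<phi> \<in> Aut gp \<Longrightarrow> map_prod \<phi> id \<in> Aut G"
  using bij_betw_map_prod[of \<phi> UNIV UNIV id UNIV UNIV]
  by (auto simp: Aut_def G_iff bij_def inj_def)

lemma Aut_map_snd: "\<phi> \<in> Aut T \<Longrightarrow> map_prod id \<phi> \<in> Aut G"
  using bij_betw_map_prod[of id UNIV UNIV \<phi> UNIV UNIV]
  by (auto simp: Aut_def G_iff bij_def inj_def)

section \<open>Stabilizer orbits and relative weights\<close>

lemma orbit_up: "orbit (Aut G) (x, t) (up x, t) = {(up x, t)}"
proof -
  have "orbit (Aut G) (x, t) (up x, t) \<subseteq> {(up x, t)}"
  proof
    fix v assume "v \<in> orbit (Aut G) (x, t) (up x, t)"
    then obtain g where g: "g \<in> Aut G" "g (x, t) = (x, t)" "g (up x, t) = v" by (rule orbitE)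
    then show "v \<in> {(up x, t)}" using Aut_parent[OF g(1,2)] by simp
  qed
  then show ?thesis using self_in_orbit[of "(up x, t)" G "(x, t)"] by auto
qed

text \<open>Preservation of parents gives one inclusion, the exchange of siblings the other. Two
  elements here against one in \<open>orbit_up\<close> make the weight double towards the
  parent.\<close>

lemma orbit_down: "orbit (Aut G) (up x, t) (x, t) = (\<lambda>y. (y, t)) ` {y. up y = up x}"
proof (intro equalityI subsetI)
  fix v assume "v \<in> orbit (Aut G) (up x, t) (x, t)"
  then obtain g where g: "g \<in> Aut G" "g (up x, t) = (up x, t)" "g (x, t) = v" by (rule orbitE)
  then show "v \<in> (\<lambda>y. (y, t)) ` {y. up y = up x}"
    using Aut_parent[OF g(1), of x t "fst v" "snd v"] by (cases v) auto
next
  fix v assume "v \<in> (\<lambda>y. (y, t)) ` {y. up y = up x}"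
  then obtain y where y: "v = (y, t)" "up x = up y" by auto
  show "v \<in> orbit (Aut G) (up x, t) (x, t)"
  proof (cases "x = y")
    case True
    then show ?thesis using y self_in_orbit[of "(x, t)" G "(up x, t)"] by simp
  next
    case False
    obtain \<phi> where \<phi>: "\<phi> \<in> Aut gp" "\<phi> (up x) = up x" "\<phi> x = y"
      using sibling_reflection[OF y(2) False] .
    show ?thesis by (rule orbitI[OF Aut_map_fst[OF \<phi>(1)]]) (simp_all add: y(1) \<phi>)
  qed
qed

text \<open>Tree edges are the edges in no triangle, so an automorphism fixing \<open>(x, t)\<close>
  permutes the tree neighbours; reflections of \<open>T\<close> at \<open>t\<close> act transitively
  on them. Both directions of a tree edge thus have orbits of size \<open>d\<close>, and weights are
  constant on fibres.\<close>

lemma orbit_tree: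
  assumes "{t, s} \<in> T"
  shows "orbit (Aut G) (x, t) (x, s) = Pair x ` neighbours T t"
proof (intro equalityI subsetI)
  fix v assume "v \<in> orbit (Aut G) (x, t) (x, s)"
  then obtain g where g: "g \<in> Aut G" "g (x, t) = (x, t)" "g (x, s) = v" by (rule orbitE)
  obtain y q where v: "v = (y, q)" by (cases v)
  have e: "{(x, t), (y, q)} \<in> G" using Aut_edge[OF g(1), of "(x, t)" "(x, s)"] g assms v
    by (simp add: G_iff)
  have c: "card (common_nbrs G (x, t) (y, q)) = 0"
    using Aut_card_common_nbrs[OF g(1), of "(x, t)" "(x, s)"] g v common_nbrs_tree[OF assms]
    by simp
  have "\<not> (t = q \<and> {x, y} \<in> gp)"
  proof
    assume a: "t = q \<and> {x, y} \<in> gp"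
    then consider "y = up x" | "x = up y" | "y = up (up x)" | "x = up (up y)"
      by (auto simp: gp_iff)
    then show False
    proof cases
      case 1 then show ?thesis using c common_nbrs_parent[of x t] a by auto
    next
      case 2 then show ?thesis
        using c common_nbrs_parent[of y t] a common_nbrs_commute[of G "(x, t)" "(y, t)"] by auto
    next
      case 3 then show ?thesis using c common_nbrs_grandparent[of x t] a by auto
    next
      case 4 then show ?thesis
        using c common_nbrs_grandparent[of y t] a common_nbrs_commute[of G "(x, t)" "(y, t)"] by auto
    qed
  qed
  then show "v \<in> Pair x ` neighbours T t" using e v by (auto simp: G_iff neighbours_def)
next
  fix v assume "v \<in> Pair x ` neighbours T t"
  then obtain q where q: "v = (x, q)" "{t, q} \<in> T" by (auto simp: neighbours_def)
  interpret rooted_tree T d t by (rule rooted)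
  have s: "s \<noteq> t" "q \<noteq> t" using assms q tree_edge_neq by auto
  then have par: "par s = t" "par q = t" using assms q by (auto simp: edges_eq)
  show "v \<in> orbit (Aut G) (x, t) (x, s)"
  proof (cases "s = q")
    case True
    then show ?thesis using q self_in_orbit[of "(x, s)" G "(x, t)"] by simp
  next
    case False
    obtain \<phi> where \<phi>: "\<phi> \<in> Aut T" "\<phi> t = t" "\<phi> s = q"
      using root_reflection[OF s] par False by metis
    show ?thesis by (rule orbitI[OF Aut_map_snd[OF \<phi>(1)]]) (simp_all add: q \<phi>)
  qed
qed

text \<open>The lower end counts, as in \<open>edge_weight\<close>, so that the weight of an edge is
  a constant times 2 to the power of its level.\<close>

definition elev :: "'a \<Rightarrow> ('a \<times> 'b) set \<Rightarrow> int" where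
  "elev x0 e = Min ((\<lambda>v. height x0 (fst v)) ` e)"

lemma finite_orbit_G: "finite (orbit (Aut G) u v)"
  by (rule finite_orbit[OF G_linked finite_neighbours_G])

lemma weight_up: "rel_weight (Aut G) z (up x, t) = 2 * rel_weight (Aut G) z (x, t)"
proof -
  have "rel_weight (Aut G) (up x, t) (x, t) = 1 / 2"
    unfolding rel_weight_orbit orbit_up orbit_down using children by (simp add: card_image inj_on_def)
  then show ?thesis using rel_weight_cocycle[OF finite_orbit_G, of z "(x, t)" "(up x, t)"] by simp
qed

lemma weight_fibre: "rel_weight (Aut G) z (x, t) = rel_weight (Aut G) z (x, s)"
  using tree_linked[of t s]
proof (induction rule: linked_induct)
  case (step p q)
  have "{q, p} \<in> T" using step by (simp add: insert_commute)
  then have "rel_weight (Aut G) (x, p) (x, q) = 1"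
    unfolding rel_weight_orbit using d2 orbit_tree step(2)
    by (simp add: card_image inj_on_def card_neighbours_T)
  then show ?case using rel_weight_cocycle[OF finite_orbit_G, of z "(x, q)" "(x, p)"] step by simp
qed simp

lemma weight_pos: "rel_weight (Aut G) z v > 0"
proof -
  have "0 < card (orbit (Aut G) u v)" for u v
    using finite_orbit_G[of u v] self_in_orbit[of v G u] by (auto simp: card_gt_0_iff)
  then show ?thesis by (simp add: rel_weight_orbit)
qed

lemma weight_height:
  "rel_weight (Aut G) z (x, t) = rel_weight (Aut G) z (x0, t0) * 2 powi height x0 x"
proof -
  let ?w = "rel_weight (Aut G) z"
  have *: "?w ((up ^^ n) y, t) = 2 ^ n * ?w (y, t)" for n y
    by (induction n) (auto simp: weight_up)
  obtain m n where mn: "(up ^^ m) x = (up ^^ n) x0" using common_ancestor by blast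
  have "2 ^ m * ?w (x, t) = 2 ^ n * ?w (x0, t)" using *[of m x] *[of n x0] mn by simp
  then have "?w (x, t) = ?w (x0, t0) * (2 ^ n / 2 ^ m)" using weight_fibre[of z x0 t t0]
    by (simp add: field_simps)
  moreover have "height x0 x = int n - int m" by (rule height_eqI[OF mn])
  ultimately show ?thesis by (simp add: power_int_diff)
qed

end

section \<open>Random subgraphs\<close>

text \<open>Countability is a hypothesis on the vertex type rather than a class constraint, so
  quantifiers are moved to \<open>nat\<close> by an enumeration.\<close>

lemma pred_ex_countable:
  fixes P :: "'w \<Rightarrow> 'v \<Rightarrow> bool"
  assumes "countable (UNIV :: 'v set)" "\<And>v. Measurable.pred M (\<lambda>\<omega>. P \<omega> v)"
  shows "Measurable.pred M (\<lambda>\<omega>. \<exists>v. P \<omega> v)"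
proof -
  have "(\<exists>v. P \<omega> v) \<longleftrightarrow> (\<exists>n. P \<omega> (from_nat_into UNIV n))" for \<omega>
    using from_nat_into_surj[OF assms(1)] by (metis UNIV_I)
  then show ?thesis using assms(2) by simp
qed

lemma pred_all_countable:
  fixes P :: "'w \<Rightarrow> 'v \<Rightarrow> bool"
  assumes "countable (UNIV :: 'v set)" "\<And>v. Measurable.pred M (\<lambda>\<omega>. P \<omega> v)"
  shows "Measurable.pred M (\<lambda>\<omega>. \<forall>v. P \<omega> v)"
proof -
  have "(\<forall>v. P \<omega> v) \<longleftrightarrow> (\<forall>n. P \<omega> (from_nat_into UNIV n))" for \<omega>
    using from_nat_into_surj[OF assms(1)] by (metis UNIV_I)
  then show ?thesis using assms(2) by simp
qed

lemma pred_linked: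
  fixes S :: "'w \<Rightarrow> 'v edges"
  assumes "countable (UNIV :: 'v set)" "\<And>e. Measurable.pred M (\<lambda>\<omega>. e \<in> S \<omega>)"
  shows "Measurable.pred M (\<lambda>\<omega>. linked (S \<omega>) a b)"
proof -
  have step: "Measurable.pred M (\<lambda>\<omega>. ((\<lambda>u v. {u, v} \<in> S \<omega>) ^^ n) a b)" for n b
  proof (induction n arbitrary: b)
    case (Suc n)
    have "((\<lambda>u v. {u, v} \<in> S \<omega>) ^^ Suc n) a b \<longleftrightarrow>
        (\<exists>c. ((\<lambda>u v. {u, v} \<in> S \<omega>) ^^ n) a c \<and> {c, b} \<in> S \<omega>)" for \<omega>
      by auto
    then show ?case
      using Suc assms(2) by (auto intro!: pred_ex_countable[OF assms(1)] pred_intros_logic)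
  qed simp
  show ?thesis unfolding linked_def rtranclp_power using step by simp
qed

lemma pred_infinite:
  fixes P :: "'w \<Rightarrow> 'v \<Rightarrow> bool"
  assumes "countable (UNIV :: 'v set)" "\<And>v. Measurable.pred M (\<lambda>\<omega>. P \<omega> v)"
  shows "Measurable.pred M (\<lambda>\<omega>. infinite {v. P \<omega> v})"
proof -
  have inj: "inj (to_nat_on (UNIV :: 'v set))" using assms(1) by (rule inj_on_to_nat_on)
  have "infinite {v. P \<omega> v} \<longleftrightarrow> (\<forall>n. \<exists>v. P \<omega> v \<and> n \<le> to_nat_on UNIV v)" for \<omega>
  proof -
    have "infinite {v. P \<omega> v} \<longleftrightarrow> infinite (to_nat_on UNIV ` {v. P \<omega> v})"
      using inj by (simp add: finite_image_iff inj_on_subset[of _ UNIV])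
    also have "\<dots> \<longleftrightarrow> (\<forall>n. \<exists>v. P \<omega> v \<and> n \<le> to_nat_on UNIV v)"
      unfolding infinite_nat_iff_unbounded_le by blast
    finally show ?thesis .
  qed
  moreover have "Measurable.pred M (\<lambda>\<omega>. \<forall>n. \<exists>v. P \<omega> v \<and> n \<le> to_nat_on UNIV v)"
    by (intro pred_intros_countable pred_ex_countable[OF assms(1)] pred_intros_logic assms(2)) auto
  ultimately show ?thesis by simp
qed

section \<open>Independence in i.i.d. products\<close>

definition depends_on :: "'i set \<Rightarrow> (('i \<Rightarrow> 'm) \<Rightarrow> 'r) \<Rightarrow> bool" where
  "depends_on J P \<longleftrightarrow> (\<forall>\<omega> \<omega>'. (\<forall>i\<in>J. \<omega> i = \<omega>' i) \<longrightarrow> P \<omega> = P \<omega>')"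

lemma depends_onI: "(\<And>\<omega> \<omega>'. (\<And>i. i \<in> J \<Longrightarrow> \<omega> i = \<omega>' i) \<Longrightarrow> P \<omega> = P \<omega>') \<Longrightarrow> depends_on J P"
  unfolding depends_on_def by blast

lemma depends_onD: "depends_on J P \<Longrightarrow> (\<And>i. i \<in> J \<Longrightarrow> \<omega> i = \<omega>' i) \<Longrightarrow> P \<omega> = P \<omega>'"
  unfolding depends_on_def by blast

lemma depends_on_not:
  assumes "depends_on J P"
  shows "depends_on J (\<lambda>\<omega>. \<not> P \<omega>)"
  by (rule depends_onI, rule arg_cong[where f = Not], rule depends_onD[OF assms])

locale iid_product =
  fixes I :: "'i set" and N :: "'m measure"
  assumes N: "prob_space N"
begin

abbreviation PM :: "('i \<Rightarrow> 'm) measure" where "PM \<equiv> PiM I (\<lambda>_. N)"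

sublocale N: prob_space N by (rule N)
sublocale product_prob_space "\<lambda>_. N" I by unfold_locales

abbreviation prb :: "(('i \<Rightarrow> 'm) \<Rightarrow> bool) \<Rightarrow> real" where
  "prb P \<equiv> measure PM {\<omega>\<in>space PM. P \<omega>}"

lemma indep_coordinates:
  assumes "I \<noteq> {}"
  shows "P.indep_vars (\<lambda>_. N) (\<lambda>i \<omega>. \<omega> i) I"
proof -
  have "distr PM PM (\<lambda>\<omega>. \<lambda>i\<in>I. \<omega> i) = distr PM PM (\<lambda>\<omega>. \<omega>)"
    by (intro distr_cong) (auto simp: space_PiM)
  also have "\<dots> = PM" by simp
  also have "\<dots> = (\<Pi>\<^sub>M i\<in>I. distr PM N (\<lambda>\<omega>. \<omega> i))"
    by (intro PiM_cong) (auto simp: PiM_component)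
  finally show ?thesis
    using assms by (subst P.indep_vars_iff_distr_eq_PiM') auto
qed

text \<open>Filling the coordinates outside \<open>J\<close> with a constant turns the event into a
  measurable function of the coordinates in \<open>J\<close>.\<close>

lemma pred_restrict:
  assumes "Measurable.pred PM P" "depends_on J P" "J \<subseteq> I"
  shows "\<exists>Q. Measurable.pred (PiM J (\<lambda>_. N)) Q \<and> (\<forall>\<omega>. P \<omega> = Q (restrict \<omega> J))"
proof -
  obtain c where c: "c \<in> space N" using N.not_empty by blast
  define Q where "Q = (\<lambda>\<eta>. P (\<lambda>i\<in>I. if i \<in> J then \<eta> i else c))"
  have "(\<lambda>\<eta>. \<lambda>i\<in>I. if i \<in> J then \<eta> i else c) \<in> PiM J (\<lambda>_. N) \<rightarrow>\<^sub>M PM"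
  proof (rule measurable_restrict)
    fix i assume "i \<in> I"
    show "(\<lambda>\<eta>. if i \<in> J then \<eta> i else c) \<in> PiM J (\<lambda>_. N) \<rightarrow>\<^sub>M N"
      using c by (cases "i \<in> J") auto
  qed
  then have "Measurable.pred (PiM J (\<lambda>_. N)) Q"
    unfolding Q_def by (rule measurable_compose[OF _ assms(1)])
  moreover have "P \<omega> = Q (restrict \<omega> J)" for \<omega>
    unfolding Q_def by (rule depends_onD[OF assms(2)]) (use assms(3) in auto)
  ultimately show ?thesis by blast
qed

lemma indep_pred:
  assumes P: "Measurable.pred PM P" "depends_on J P" "J \<subseteq> I"
    and Q: "Measurable.pred PM Q" "depends_on K Q" "K \<subseteq> I"
    and disj: "J \<inter> K = {}"
  shows "prb (\<lambda>\<omega>. P \<omega> \<and> Q \<omega>) = prb P * prb Q"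
\<comment> \<open>\<open>indep_coordinates\<close> concerns nonempty index sets. The empty product
  is a single point, where every probability is 0 or 1.\<close>
proof (cases "I = {}")
  case True
  have cst: "prb R = (if R (\<lambda>_. undefined) then 1 else 0)" for R :: "('i \<Rightarrow> 'm) \<Rightarrow> bool"
  proof -
    have "space PM = {\<lambda>_. undefined}" using True by (simp add: space_PiM)
    then have "{\<omega>\<in>space PM. R \<omega>} = (if R (\<lambda>_. undefined) then space PM else {})" by auto
    then show ?thesis by (simp add: P.prob_space)
  qed
  show ?thesis unfolding cst by simp
next
  case False
  obtain P' where P': "Measurable.pred (PiM J (\<lambda>_. N)) P'" "\<And>\<omega>. P \<omega> = P' (restrict \<omega> J)"
    using pred_restrict[OF P] by blast
  obtain Q' where Q': "Measurable.pred (PiM K (\<lambda>_. N)) Q'" "\<And>\<omega>. Q \<omega> = Q' (restrict \<omega> K)"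
    using pred_restrict[OF Q] by blast
  let ?A = "{\<omega>\<in>space (PiM J (\<lambda>_. N)). P' \<omega>}" and ?B = "{\<omega>\<in>space (PiM K (\<lambda>_. N)). Q' \<omega>}"
  have sets: "?A \<in> sets (PiM J (\<lambda>_. N))" "?B \<in> sets (PiM K (\<lambda>_. N))"
    using P'(1) Q'(1) by auto
  have rJ: "restrict \<omega> L \<in> space (PiM L (\<lambda>_. N))" if "\<omega> \<in> space PM" "L \<subseteq> I" for \<omega> L
    using that by (auto simp: space_PiM PiE_def Pi_def)
  note ind = P.indep_var_restrict[OF indep_coordinates[OF False] disj P(3) Q(3)]
  note D = P.indep_varD[OF ind sets]
  have "prb (\<lambda>\<omega>. P \<omega> \<and> Q \<omega>) =
      measure PM ((\<lambda>\<omega>. (restrict \<omega> J, restrict \<omega> K)) -` (?A \<times> ?B) \<inter> space PM)"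
    by (rule arg_cong[where f = "measure PM"]) (use rJ P(3) Q(3) P'(2) Q'(2) in auto)
  moreover have "prb P = measure PM ((\<lambda>\<omega>. restrict \<omega> J) -` ?A \<inter> space PM)"
    by (rule arg_cong[where f = "measure PM"]) (use rJ P(3) P'(2) in auto)
  moreover have "prb Q = measure PM ((\<lambda>\<omega>. restrict \<omega> K) -` ?B \<inter> space PM)"
    by (rule arg_cong[where f = "measure PM"]) (use rJ Q(3) Q'(2) in auto)
  ultimately show ?thesis using D by simp
qed

lemma prb_mono: "Measurable.pred PM Q \<Longrightarrow> (\<And>\<omega>. \<omega> \<in> space PM \<Longrightarrow> P \<omega> \<Longrightarrow> Q \<omega>) \<Longrightarrow> prb P \<le> prb Q"
  by (rule P.finite_measure_mono) auto

lemma prb_not: "Measurable.pred PM P \<Longrightarrow> prb (\<lambda>\<omega>. \<not> P \<omega>) = 1 - prb P"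
  by (rule P.prob_neg) auto

lemma prb_disj_le:
  assumes "Measurable.pred PM P" "Measurable.pred PM Q"
  shows "prb (\<lambda>\<omega>. P \<omega> \<or> Q \<omega>) \<le> prb P + prb Q"
proof -
  have "{\<omega>\<in>space PM. P \<omega> \<or> Q \<omega>} = {\<omega>\<in>space PM. P \<omega>} \<union> {\<omega>\<in>space PM. Q \<omega>}" by auto
  then show ?thesis
    using measure_Un_le[OF assms(1)[unfolded pred_def] assms(2)[unfolded pred_def]] by (simp only:)
qed

lemma AE_not_if_small:
  assumes P: "Measurable.pred PM P" and q: "0 \<le> q" "q < 1" and le: "\<And>n. prb P \<le> C * q ^ n"
  shows "AE \<omega> in PM. \<not> P \<omega>"
proof -
  have "(\<lambda>n. C * q ^ n) \<longlonglongrightarrow> C * 0" using q by (intro tendsto_intros LIMSEQ_realpow_zero)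
  then have "prb P \<le> 0" using LIMSEQ_le_const[of _ "C * 0" "prb P"] le by auto
  then have "prb P = 0" using measure_nonneg[of PM "{\<omega>\<in>space PM. P \<omega>}"] by linarith
  moreover have "{\<omega>\<in>space PM. P \<omega>} \<in> sets PM" using P by simp
  ultimately have "AE \<omega> in PM. \<omega> \<notin> {\<omega>\<in>space PM. P \<omega>}" using P.prob_eq_0 by blast
  with AE_space show ?thesis by eventually_elim auto
qed

lemma prb_coordinates:
  assumes "finite J" "J \<subseteq> I" "\<And>i. i \<in> J \<Longrightarrow> B i \<in> sets N"
  shows "prb (\<lambda>\<omega>. \<forall>i\<in>J. \<omega> i \<in> B i) = (\<Prod>i\<in>J. measure N (B i))"
proof -
  have "{x\<in>space PM. \<forall>i\<in>J. x i \<in> B i} = prod_emb I (\<lambda>_. N) J (Pi\<^sub>E J B)"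
    unfolding prod_emb_def using assms by (auto simp: space_PiM Pi_iff)
  then show ?thesis using measure_PiM_emb[OF assms(2,1), of B] assms(3) by simp
qed

lemma pred_coordinate: "i \<in> I \<Longrightarrow> B \<in> sets N \<Longrightarrow> Measurable.pred PM (\<lambda>\<omega>. \<omega> i \<in> B)"
  by (rule pred_sets2[where N = N]) auto

lemma prb_coordinate: "i \<in> I \<Longrightarrow> B \<in> sets N \<Longrightarrow> prb (\<lambda>\<omega>. \<omega> i \<in> B) = measure N B"
  using prb_coordinates[of "{i}" "\<lambda>_. B"] by simp

text \<open>Continuity from above carries a bound that is uniform over finite segments to the whole
  sequence.\<close>

lemma prb_sequence_ge:
  fixes e :: "nat \<Rightarrow> 'i"
  assumes e: "inj e" "\<And>n. e n \<in> I" and B: "\<And>n. B n \<in> sets N"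
    and ge: "\<And>m. p \<le> (\<Prod>n<m. measure N (B n))"
  shows "p \<le> prb (\<lambda>\<omega>. \<forall>n. \<omega> (e n) \<in> B n)"
proof -
  let ?A = "\<lambda>m. {\<omega>\<in>space PM. \<forall>n<m. \<omega> (e n) \<in> B n}"
  have meas: "Measurable.pred PM (\<lambda>\<omega>. \<omega> (e n) \<in> B n)" for n
    using e(2) B by (intro pred_coordinate)
  then have A: "?A m \<in> sets PM" for m by measurable
  have "prb (\<lambda>\<omega>. \<forall>n<m. \<omega> (e n) \<in> B n) = (\<Prod>n<m. measure N (B n))" for m
  proof -
    have eqv: "(\<forall>n<m. \<omega> (e n) \<in> B n) \<longleftrightarrow> (\<forall>i\<in>e ` {..<m}. \<omega> i \<in> B (inv e i))" for \<omega>
      using e(1) by auto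
    have "prb (\<lambda>\<omega>. \<forall>i\<in>e ` {..<m}. \<omega> i \<in> B (inv e i)) = (\<Prod>i\<in>e ` {..<m}. measure N (B (inv e i)))"
      using e B by (intro prb_coordinates) auto
    also have "\<dots> = (\<Prod>n<m. measure N (B n))"
      using e(1) by (subst prod.reindex) (auto intro: inj_on_subset)
    finally show ?thesis unfolding eqv .
  qed
  then have ge': "p \<le> measure PM (?A m)" for m using ge[of m] by simp
  have dec: "decseq ?A" unfolding decseq_def using order.strict_trans2 by blast
  have "range ?A \<subseteq> sets PM" using A by blast
  from P.finite_Lim_measure_decseq[OF this dec]
  have "p \<le> measure PM (\<Inter>m. ?A m)" by (rule LIMSEQ_le_const) (use ge' in blast)
  also have "(\<Inter>m. ?A m) = {\<omega>\<in>space PM. \<forall>n. \<omega> (e n) \<in> B n}" by auto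
  finally show ?thesis .
qed

text \<open>The first \<open>m\<close> terms may lie outside the index set, because a ray can start
  with deleted edges.\<close>

lemma AE_eventually_coordinate:
  fixes e :: "nat \<Rightarrow> 'i"
  assumes e: "\<And>n. m \<le> n \<Longrightarrow> e n \<in> I" and B: "\<And>n. B n \<in> sets N"
    and sum: "summable (\<lambda>n. 1 - measure N (B n))"
  shows "AE \<omega> in PM. \<exists>n0. \<forall>n\<ge>n0. \<omega> (e n) \<in> B n"
proof -
  let ?A = "\<lambda>n. {\<omega>\<in>space PM. \<not> \<omega> (e (n + m)) \<in> B (n + m)}"
  have meas: "Measurable.pred PM (\<lambda>\<omega>. \<omega> (e (n + m)) \<in> B (n + m))" for n
    using e B by (intro pred_coordinate) auto
  have "measure PM (?A n) = 1 - measure N (B (n + m))" for n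
    using prb_not[OF meas] prb_coordinate[of "e (n + m)" "B (n + m)"] e B by simp
  then have "summable (\<lambda>n. measure PM (?A n))"
    using summable_ignore_initial_segment[OF sum, of m] by simp
  moreover have "?A n \<in> sets PM" for n using meas[of n] by measurable
  ultimately have "AE \<omega> in PM. eventually (\<lambda>n. \<omega> \<in> space PM - ?A n) sequentially"
    by (intro borel_cantelli_AE1) (auto simp: P.emeasure_eq_measure)
  then show ?thesis
  proof (rule AE_mp, intro AE_I2 impI)
    fix \<omega> assume "\<omega> \<in> space PM" and "eventually (\<lambda>n. \<omega> \<in> space PM - ?A n) sequentially"
    then obtain n0 where n0: "\<And>n. n \<ge> n0 \<Longrightarrow> \<omega> (e (n + m)) \<in> B (n + m)"
      by (auto simp: eventually_sequentially)
    have "\<omega> (e n) \<in> B n" if "n0 + m \<le> n" for n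
      using n0[of "n - m"] that by simp
    then show "\<exists>n0. \<forall>n\<ge>n0. \<omega> (e n) \<in> B n" by blast
  qed
qed

end

section \<open>Uniqueness of the infinite cluster in upward-percolating configurations\<close>

text \<open>After \<open>m\<close> factors the deficits sum to at most 1/2, so Weierstrass'
  inequality bounds the rest of the product by 1/2; the first \<open>m\<close> factors are positive.
  The bound holds for all finite index sets, hence for rays starting at any height.\<close>

lemma prod_bounded_below:
  fixes f :: "nat \<Rightarrow> real"
  assumes f: "\<And>n. 0 < f n" "\<And>n. f n \<le> 1" and sum: "summable (\<lambda>n. 1 - f n)"
  obtains p where "0 < p" "\<And>F. finite F \<Longrightarrow> p \<le> prod f F"
proof -
  obtain m where m: "\<And>n. n \<ge> m \<Longrightarrow> norm (\<Sum>i. 1 - f (i + n)) < 1 / 2"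
    using suminf_exist_split[OF _ sum, of "1 / 2"] by auto
  define p where "p = (\<Prod>n<m. f n) * (1 / 2)"
  have pos: "0 < prod f F" for F using f(1) by (simp add: prod_pos)
  have "p \<le> prod f F" if "finite F" for F
  proof -
    have "(\<Prod>n<m. f n) \<le> prod f (F \<inter> {..<m})"
    proof -
      have "(\<Prod>n<m. f n) = prod f ({..<m} - F \<inter> {..<m}) * prod f (F \<inter> {..<m})"
        by (rule prod.subset_diff) auto
      also have "\<dots> \<le> 1 * prod f (F \<inter> {..<m})"
        using f by (intro mult_right_mono prod_le_1 prod_nonneg) (auto intro: less_imp_le)
      finally show ?thesis by simp
    qed
    moreover have "1 / 2 \<le> prod f (F - {..<m})"
    proof -
      have "(\<Sum>n\<in>F - {..<m}. 1 - f n) = (\<Sum>n\<in>(\<lambda>n. n - m) ` (F - {..<m}). 1 - f (n + m))"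
        by (subst sum.reindex) (auto simp: inj_on_def)
      also have "\<dots> \<le> (\<Sum>n. 1 - f (n + m))"
        using f that summable_ignore_initial_segment[OF sum, of m] by (intro sum_le_suminf) auto
      also have "\<dots> \<le> 1 / 2" using m[of m] by auto
      finally have "1 / 2 \<le> 1 - (\<Sum>n\<in>F - {..<m}. 1 - f n)" by simp
      also have "\<dots> \<le> (\<Prod>n\<in>F - {..<m}. 1 - (1 - f n))"
        using f less_imp_le by (intro Weierstrass_prod_ineq) auto
      finally show ?thesis by simp
    qed
    ultimately have "p \<le> prod f (F \<inter> {..<m}) * prod f (F - {..<m})"
      unfolding p_def using pos by (intro mult_mono) (auto intro: less_imp_le)
    also have "\<dots> = prod f F"
      using prod.union_disjoint[of "F \<inter> {..<m}" "F - {..<m}" f] that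
      by (simp add: Int_Diff_disjoint Int_Diff_Un)
    finally show ?thesis .
  qed
  moreover have "0 < p" unfolding p_def using f by (auto intro!: prod_pos mult_pos_pos)
  ultimately show ?thesis using that by blast
qed

text \<open>\<open>Q\<close> selects at most one vertex, so the events for different
  \<open>z\<close> are disjoint and a bound for each fixed \<open>z\<close> can be summed. The
  estimate thereby passes to a random vertex.\<close>

lemma (in iid_product) prb_selected_le:
  fixes Q R :: "('i \<Rightarrow> 'm) \<Rightarrow> 'v \<Rightarrow> bool"
  assumes cnt: "countable (UNIV :: 'v set)"
    and meas: "Measurable.pred PM P" "\<And>z. Measurable.pred PM (\<lambda>\<omega>. Q \<omega> z)" "\<And>z. Measurable.pred PM (\<lambda>\<omega>. R \<omega> z)"
    and uniq: "\<And>\<omega> z z'. Q \<omega> z \<Longrightarrow> Q \<omega> z' \<Longrightarrow> z = z'"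
    and c: "0 \<le> c"
    and le: "\<And>z. prb (\<lambda>\<omega>. (P \<omega> \<and> Q \<omega> z) \<and> R \<omega> z) \<le> c * prb (\<lambda>\<omega>. P \<omega> \<and> Q \<omega> z)"
  shows "prb (\<lambda>\<omega>. P \<omega> \<and> (\<exists>z. Q \<omega> z \<and> R \<omega> z)) \<le> c * prb P"
proof -
  let ?X = "\<lambda>z. {\<omega>\<in>space PM. (P \<omega> \<and> Q \<omega> z) \<and> R \<omega> z}"
  let ?Y = "\<lambda>z. {\<omega>\<in>space PM. P \<omega> \<and> Q \<omega> z}"
  note [measurable] = meas
  have X: "?X z \<in> sets PM" and Y: "?Y z \<in> sets PM" for z by measurable
  have disj: "disjoint_family_on ?X UNIV" "disjoint_family_on ?Y UNIV"
    using uniq by (auto simp: disjoint_family_on_def)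
  have "emeasure PM (\<Union>z. ?X z) = (\<integral>\<^sup>+z. emeasure PM (?X z) \<partial>count_space UNIV)"
    using X cnt disj(1) by (intro emeasure_UN_countable) auto
  also have "\<dots> \<le> (\<integral>\<^sup>+z. ennreal c * emeasure PM (?Y z) \<partial>count_space UNIV)"
    using le c by (intro nn_integral_mono) (simp add: P.emeasure_eq_measure ennreal_mult'[symmetric] ennreal_leI)
  also have "\<dots> = ennreal c * (\<integral>\<^sup>+z. emeasure PM (?Y z) \<partial>count_space UNIV)"
    by (intro nn_integral_cmult) simp
  also have "(\<integral>\<^sup>+z. emeasure PM (?Y z) \<partial>count_space UNIV) = emeasure PM (\<Union>z. ?Y z)"
    using Y cnt disj(2) by (intro emeasure_UN_countable[symmetric]) auto
  also have "\<dots> \<le> emeasure PM {\<omega>\<in>space PM. P \<omega>}"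
    using meas(1) by (intro emeasure_mono) auto
  finally have "emeasure PM (\<Union>z. ?X z) \<le> ennreal c * emeasure PM {\<omega>\<in>space PM. P \<omega>}"
    by (simp add: mult_left_mono)
  moreover have "(\<Union>z. ?X z) = {\<omega>\<in>space PM. P \<omega> \<and> (\<exists>z. Q \<omega> z \<and> R \<omega> z)}" by auto
  ultimately show ?thesis
    using c by (simp add: P.emeasure_eq_measure ennreal_mult'[symmetric] ennreal_le_iff)
qed

text \<open>\<open>B k\<close> is the set of labels that open an edge of level \<open>k\<close>.
  Both orders lead to this setting, with \<open>E\<close> the graph without the edge
  \<open>e\<close> under consideration: levels below \<open>k0\<close> are closed, and above it the
  probabilities of being closed are summable.\<close>

locale layered_percolation = gp_product A T d + iid_product E N
  for A :: "'a \<Rightarrow> 'a \<Rightarrow> bool" and T :: "'b edges" and d :: nat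
    and E :: "('a \<times> 'b) edges" and N :: "'m measure" +
  fixes x0 :: 'a and B :: "int \<Rightarrow> 'm set" and k0 :: int
  assumes E: "E \<subseteq> G" "finite (G - E)"
    and B_sets: "\<And>k. B k \<in> sets N"
    and B_low: "\<And>k. k < k0 \<Longrightarrow> B k = {}"
    and B_pos: "\<And>k. k0 \<le> k \<Longrightarrow> 0 < measure N (B k)"
    and B_sum: "summable (\<lambda>n. 1 - measure N (B (k0 + int n)))"
begin

abbreviation hgt :: "'a \<times> 'b \<Rightarrow> int" where "hgt v \<equiv> height x0 (fst v)"

abbreviation level :: "('a \<times> 'b) set \<Rightarrow> int" where "level \<equiv> elev x0"

definition opn :: "(('a \<times> 'b) set \<Rightarrow> 'm) \<Rightarrow> ('a \<times> 'b) edges" where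
  "opn \<omega> = {e \<in> E. \<omega> e \<in> B (level e)}"

definition ray :: "'a \<Rightarrow> 'b \<Rightarrow> nat \<Rightarrow> ('a \<times> 'b) set" where
  "ray x t n = {((up ^^ n) x, t), ((up ^^ Suc n) x, t)}"

lemma level_edge: "level {u, v} = min (hgt u) (hgt v)"
  by (simp add: elev_def)

lemma level_ray: "level (ray x t n) = height x0 x + int n"
  by (simp add: ray_def level_edge)

lemma ray_in_G: "ray x t n \<in> G"
  by (simp add: ray_def G_iff gp_iff)

lemma open_level: "e \<in> opn \<omega> \<Longrightarrow> k0 \<le> level e"
  using B_low by (force simp: opn_def)

lemma open_edge: "{u, v} \<in> opn \<omega> \<Longrightarrow> k0 \<le> hgt u \<and> k0 \<le> hgt v \<and> {u, v} \<in> G"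
  using open_level[of "{u, v}" \<omega>] E by (auto simp: level_edge opn_def)

lemma pred_open: "Measurable.pred PM (\<lambda>\<omega>. e \<in> opn \<omega>)"
  using pred_coordinate[of e "B (level e)"] B_sets by (cases "e \<in> E") (auto simp: opn_def)

lemma summable_from: "summable (\<lambda>n. 1 - measure N (B (k + int n)))"
proof (cases "k0 \<le> k")
  case True
  have "summable (\<lambda>n. 1 - measure N (B (k0 + int (n + nat (k - k0)))))"
    using summable_ignore_initial_segment[OF B_sum] .
  then show ?thesis using True by (simp add: algebra_simps)
next
  case False
  have "summable (\<lambda>n. 1 - measure N (B (k + int (n + nat (k0 - k)))))"
    using B_sum False by (simp add: algebra_simps)
  then show ?thesis by (rule summable_iff_shift[THEN iffD1])
qed

lemma eventually_in_E:
  fixes e :: "nat \<Rightarrow> ('a \<times> 'b) set"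
  assumes "inj e" "\<And>n. e n \<in> G"
  shows "\<exists>m. \<forall>n\<ge>m. e n \<in> E"
proof -
  have "finite (e -` (G - E))" using E(2) assms(1) by (rule finite_vimageI)
  then obtain m where "\<And>n. n \<in> e -` (G - E) \<Longrightarrow> n < m" using finite_nat_set_iff_bounded by metis
  then have "\<forall>n\<ge>m. e n \<in> E" using assms(2) by (force simp: not_less[symmetric])
  then show ?thesis by blast
qed

lemma AE_eventually_open:
  assumes "inj e" "\<And>n. e n \<in> G" and lev: "\<And>n. level (e n) = k + int n"
  shows "AE \<omega> in PM. \<exists>n0. \<forall>n\<ge>n0. e n \<in> opn \<omega>"
proof -
  obtain m where m: "\<And>n. m \<le> n \<Longrightarrow> e n \<in> E" using eventually_in_E[OF assms(1,2)] by blast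
  have "AE \<omega> in PM. \<exists>n0. \<forall>n\<ge>n0. \<omega> (e n) \<in> B (k + int n)"
    by (rule AE_eventually_coordinate[OF _ B_sets summable_from]) (rule m)
  then show ?thesis
  proof (rule AE_mp, intro AE_I2 impI)
    fix \<omega> assume "\<exists>n0. \<forall>n\<ge>n0. \<omega> (e n) \<in> B (k + int n)"
    then obtain n0 where "\<And>n. n \<ge> n0 \<Longrightarrow> \<omega> (e n) \<in> B (k + int n)" by blast
    then have "\<forall>n\<ge>max n0 m. e n \<in> opn \<omega>" using m lev by (auto simp: opn_def)
    then show "\<exists>n0. \<forall>n\<ge>n0. e n \<in> opn \<omega>" by blast
  qed
qed

lemma inj_if_level: "(\<And>n. level (e n) = k + int n) \<Longrightarrow> inj e"
  by (rule injI) (metis add_left_cancel of_nat_eq_iff)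

lemma countable_fst: "countable (UNIV :: 'a set)" and countable_snd: "countable (UNIV :: 'b set)"
  using countable_image[OF countable_V, of fst] countable_image[OF countable_V, of snd] by auto

definition rays_open :: "(('a \<times> 'b) set \<Rightarrow> 'm) \<Rightarrow> bool" where
  "rays_open \<omega> \<longleftrightarrow> (\<forall>x t. \<exists>n0. \<forall>n\<ge>n0. ray x t n \<in> opn \<omega>)"

text \<open>Ancestors of the single vertex \<open>x0\<close> suffice, because every upward ray
  merges with the one from \<open>x0\<close>.\<close>

definition levels_open :: "(('a \<times> 'b) set \<Rightarrow> 'm) \<Rightarrow> bool" where
  "levels_open \<omega> \<longleftrightarrow> (\<forall>t s. {t, s} \<in> T \<longrightarrow>
     (\<exists>n0. \<forall>n\<ge>n0. {((up ^^ n) x0, t), ((up ^^ n) x0, s)} \<in> opn \<omega>))"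

lemma AE_rays_open: "AE \<omega> in PM. rays_open \<omega>"
proof -
  have "AE \<omega> in PM. \<exists>n0. \<forall>n\<ge>n0. ray x t n \<in> opn \<omega>" for x t
    by (rule AE_eventually_open[OF inj_if_level ray_in_G]) (rule level_ray)+
  then have "AE \<omega> in PM. \<forall>x\<in>UNIV. \<forall>t\<in>UNIV. \<exists>n0. \<forall>n\<ge>n0. ray x t n \<in> opn \<omega>"
    by (simp only: AE_ball_countable[OF countable_fst] AE_ball_countable[OF countable_snd]) blast
  then show ?thesis by (simp add: rays_open_def)
qed

lemma AE_levels_open: "AE \<omega> in PM. levels_open \<omega>"
proof -
  have "AE \<omega> in PM. {t, s} \<in> T \<longrightarrow>
      (\<exists>n0. \<forall>n\<ge>n0. {((up ^^ n) x0, t), ((up ^^ n) x0, s)} \<in> opn \<omega>)" for t s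
  proof (cases "{t, s} \<in> T")
    case True
    have lev: "level {((up ^^ n) x0, t), ((up ^^ n) x0, s)} = height x0 x0 + int n" for n
      by (simp add: level_edge)
    have "AE \<omega> in PM. \<exists>n0. \<forall>n\<ge>n0. {((up ^^ n) x0, t), ((up ^^ n) x0, s)} \<in> opn \<omega>"
      by (rule AE_eventually_open[OF inj_if_level _ lev], rule lev) (simp add: G_iff True)
    then show ?thesis using True by simp
  qed simp
  then have "AE \<omega> in PM. \<forall>t\<in>UNIV. \<forall>s\<in>UNIV. {t, s} \<in> T \<longrightarrow>
      (\<exists>n0. \<forall>n\<ge>n0. {((up ^^ n) x0, t), ((up ^^ n) x0, s)} \<in> opn \<omega>)"
    by (simp only: AE_ball_countable[OF countable_snd]) blast
  then show ?thesis by (simp add: levels_open_def)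
qed

text \<open>The choice of the base point is immaterial: high up, all rays are joined by open edges.\<close>

definition base :: 'b where "base = (SOME t. True)"

definition sky :: "(('a \<times> 'b) set \<Rightarrow> 'm) \<Rightarrow> 'a \<times> 'b \<Rightarrow> bool" where
  "sky \<omega> v \<longleftrightarrow> (\<exists>n0. \<forall>n\<ge>n0. linked (opn \<omega>) v ((up ^^ n) x0, base))"

lemma sky_linked: "sky \<omega> u \<Longrightarrow> sky \<omega> v \<Longrightarrow> linked (opn \<omega>) u v"
proof -
  assume "sky \<omega> u" "sky \<omega> v"
  then obtain m n where
    "\<And>i. i \<ge> m \<Longrightarrow> linked (opn \<omega>) u ((up ^^ i) x0, base)"
    "\<And>i. i \<ge> n \<Longrightarrow> linked (opn \<omega>) v ((up ^^ i) x0, base)"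
    unfolding sky_def by blast
  from this(1)[OF max.cobounded1] linked_sym[OF this(2)[OF max.cobounded2]]
  show ?thesis by (rule linked_trans)
qed

lemma levels_linked:
  assumes "levels_open \<omega>"
  shows "\<exists>n0. \<forall>n\<ge>n0. linked (opn \<omega>) ((up ^^ n) x0, t) ((up ^^ n) x0, s)"
  using tree_linked[of t s]
proof (induction rule: linked_induct)
  case (step y z)
  then obtain m where m: "\<And>n. n \<ge> m \<Longrightarrow> linked (opn \<omega>) ((up ^^ n) x0, t) ((up ^^ n) x0, y)" by blast
  obtain m' where m': "\<And>n. n \<ge> m' \<Longrightarrow> {((up ^^ n) x0, y), ((up ^^ n) x0, z)} \<in> opn \<omega>"
    using assms step(2) unfolding levels_open_def by blast
  then have "\<forall>n\<ge>max m m'. linked (opn \<omega>) ((up ^^ n) x0, t) ((up ^^ n) x0, z)"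
    using linked_trans[OF m linked_edge[OF m']] by simp
  then show ?case by blast
qed simp

text \<open>Climb in the fibre coordinate \<open>t\<close> until the ray has merged with the
  ancestors of \<open>x0\<close>, then cross over to \<open>base\<close> at a height where all tree
  edges on the way are open.\<close>

lemma sky_if_ray:
  assumes "levels_open \<omega>" and v: "linked (opn \<omega>) v ((up ^^ m) x, t)"
    and ray: "\<And>n. n \<ge> m \<Longrightarrow> ray x t n \<in> opn \<omega>"
  shows "sky \<omega> v"
proof -
  have up: "linked (opn \<omega>) v ((up ^^ (m + n)) x, t)" for n
  proof (induction n)
    case (Suc n)
    then show ?case using linked_trans[OF Suc linked_edge[of _ "((up ^^ Suc (m + n)) x, t)"]] ray[of "m + n"]
      by (simp add: ray_def)
  qed (simp add: v)
  obtain i j where ij: "(up ^^ i) x = (up ^^ j) x0" using common_ancestor by blast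
  obtain n1 where n1: "\<And>n. n \<ge> n1 \<Longrightarrow> linked (opn \<omega>) ((up ^^ n) x0, t) ((up ^^ n) x0, base)"
    using levels_linked[OF assms(1)] by blast
  have "linked (opn \<omega>) v ((up ^^ n) x0, base)" if n: "n \<ge> max (j + m) n1" for n
  proof -
    \<comment> \<open>\<open>j\<close> steps lead from \<open>x0\<close> to the point of merging,
      \<open>m\<close> more leave the part of the ray that may be closed.\<close>
    obtain r where r: "n = (m + r) + j" using n by (metis add.commute add.left_commute le_Suc_ex max.boundedE)
    have "(up ^^ n) x0 = (up ^^ (m + r)) ((up ^^ i) x)" unfolding r funpow_add[of "m + r" j] o_apply ij ..
    also have "\<dots> = (up ^^ (m + (r + i))) x" by (simp add: funpow_add flip: add.assoc)
    finally have "linked (opn \<omega>) v ((up ^^ n) x0, t)" using up[of "r + i"] by simp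
    then show ?thesis using linked_trans[OF _ n1[of n]] n by simp
  qed
  then show ?thesis unfolding sky_def by blast
qed

text \<open>Open edges never go below \<open>k0\<close>; the minimum accounts for an
  \<open>a\<close> below \<open>k0\<close>, which is isolated.\<close>

lemma cluster_height: "linked (opn \<omega>) a u \<Longrightarrow> min k0 (hgt a) \<le> hgt u"
  by (induction rule: linked_induct) (use open_edge in fastforce)+

lemma finite_below_above: "finite {y. y \<in> below up q \<and> k \<le> height x0 y}"
proof (rule finite_subset)
  show "finite (\<Union>i\<le>nat (height x0 q - k). {y. (up ^^ i) y = q})"
    using finite_descendants by blast
  show "{y. y \<in> below up q \<and> k \<le> height x0 y} \<subseteq> (\<Union>i\<le>nat (height x0 q - k). {y. (up ^^ i) y = q})"
  proof
    fix y assume "y \<in> {y. y \<in> below up q \<and> k \<le> height x0 y}"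
    then obtain i where i: "(up ^^ i) y = q" "k \<le> height x0 y" by (auto simp: below_def)
    then have "height x0 q = height x0 y + int i" by auto
    then have "i \<le> nat (height x0 q - k)" using i by linarith
    then show "y \<in> (\<Union>i\<le>nat (height x0 q - k). {y. (up ^^ i) y = q})" using i by auto
  qed
qed

text \<open>A cluster that stops meeting ancestors of its start is trapped in one subtree, at
  heights bounded below and over finitely many tree vertices, hence finite.\<close>

lemma cluster_meets_ancestor:
  assumes inf: "infinite {u. linked (opn \<omega>) a u}" and fin: "finite (snd ` {u. linked (opn \<omega>) a u})"
  shows "\<exists>m>n. \<exists>s. linked (opn \<omega>) a ((up ^^ m) (fst a), s)"
proof (rule ccontr)
  assume no: "\<not> ?thesis"
  let ?q = "(up ^^ n) (fst a)"
  \<comment> \<open>A grandparent edge can jump over \<open>up ?q\<close>, so both ways out of the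
    subtree have to be excluded.\<close>
  have no': "fst u \<noteq> up ?q \<and> fst u \<noteq> up (up ?q)" if "linked (opn \<omega>) a u" for u
  proof -
    have "\<not> linked (opn \<omega>) a ((up ^^ Suc n) (fst a), snd u)"
      "\<not> linked (opn \<omega>) a ((up ^^ Suc (Suc n)) (fst a), snd u)"
      using no less_Suc_eq by blast+
    then show ?thesis using that by (cases u) auto
  qed
  have "fst u \<in> below up ?q" if "linked (opn \<omega>) a u" for u
    using that
  proof (induction rule: linked_induct)
    case refl
    show ?case unfolding below_def by blast
  next
    case (step y z)
    have "linked (opn \<omega>) a z" using linked_trans[OF step(1) linked_edge[OF step(2)]] .
    note nz = no'[OF this]
    have "{y, z} \<in> G" using open_edge step(2) by blast
    then consider "fst y = fst z" | "fst z = up (fst y)" | "fst y = up (fst z)"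
      | "fst z = up (up (fst y))" | "fst y = up (up (fst z))"
      by (auto simp: G_iff' gp_iff)
    then show ?case
    proof cases
      case 2
      then show ?thesis using nz below_parent[OF step.IH] by metis
    next
      case 4
      then show ?thesis using nz below_parent[OF step.IH] below_parent[where v = "up (fst y)" and s = ?q] by metis
    qed (use step.IH below_child in metis)+
  qed
  then have sub: "{u. linked (opn \<omega>) a u} \<subseteq>
      {y. y \<in> below up ?q \<and> min k0 (hgt a) \<le> height x0 y} \<times> snd ` {u. linked (opn \<omega>) a u}"
    using cluster_height by (intro subsetI) (simp add: mem_Times_iff)
  show False
    using inf finite_subset[OF sub finite_cartesian_product[OF finite_below_above fin]] by blast
qed

text \<open>With finitely many tree coordinates, one height works for all rays above
  \<open>fst a\<close>; the cluster meets an ancestor above that height.\<close>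

lemma sky_if_finitely_many_fibres:
  assumes "rays_open \<omega>" "levels_open \<omega>"
    and inf: "infinite {u. linked (opn \<omega>) a u}" and fin: "finite (snd ` {u. linked (opn \<omega>) a u})"
  shows "sky \<omega> a"
proof -
  let ?F = "snd ` {u. linked (opn \<omega>) a u}"
  have "\<forall>t\<in>?F. eventually (\<lambda>n. ray (fst a) t n \<in> opn \<omega>) sequentially"
    using assms(1) unfolding rays_open_def eventually_sequentially by blast
  then have "eventually (\<lambda>n. \<forall>t\<in>?F. ray (fst a) t n \<in> opn \<omega>) sequentially"
    by (rule eventually_ball_finite[OF fin])
  then obtain n0 where n0: "\<forall>n\<ge>n0. \<forall>t\<in>?F. ray (fst a) t n \<in> opn \<omega>"
    unfolding eventually_sequentially by blast
  obtain m s where ms: "n0 < m" "linked (opn \<omega>) a ((up ^^ m) (fst a), s)"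
    using cluster_meets_ancestor[OF inf fin] by blast
  have "s \<in> ?F" by (rule image_eqI[of _ snd "((up ^^ m) (fst a), s)"]) (simp_all add: ms(2))
  then have "ray (fst a) s n \<in> opn \<omega>" if "m \<le> n" for n
    using n0 that ms(1) by (meson less_imp_le order_trans)
  then show ?thesis by (rule sky_if_ray[OF assms(2) ms(2)])
qed

end

context layered_percolation
begin

text \<open>When the cluster of \<open>a\<close> first enters a fibre at tree distance \<open>n\<close>, no edge inside that fibre has
  been explored, so the ray above the entry point is open with probability bounded below, independently
  of the past.  A cluster that meets infinitely many fibres thus reaches the sky almost surely.\<close>

definition D :: "'a \<times> 'b \<Rightarrow> 'a \<times> 'b \<Rightarrow> nat" where "D a v = gdist T (snd a) (snd v)"

definition inner :: "(('a \<times> 'b) set \<Rightarrow> 'm) \<Rightarrow> 'a \<times> 'b \<Rightarrow> nat \<Rightarrow> ('a \<times> 'b) edges" where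
  "inner \<omega> a n = {e \<in> opn \<omega>. \<forall>v\<in>e. D a v < n}"

definition entry :: "'a \<times> 'b \<Rightarrow> nat \<Rightarrow> (('a \<times> 'b) set \<Rightarrow> 'm) \<Rightarrow> 'a \<times> 'b \<Rightarrow> bool" where
  "entry a n \<omega> z \<longleftrightarrow> D a z = n \<and> (\<exists>u. D a u < n \<and> linked (inner \<omega> a n) a u \<and> {u, z} \<in> opn \<omega>)"

text \<open>The least entry in a fixed enumeration: a measurable choice that makes the events for
  different \<open>z\<close> disjoint and depends on the past only.\<close>

definition first_entry :: "'a \<times> 'b \<Rightarrow> nat \<Rightarrow> (('a \<times> 'b) set \<Rightarrow> 'm) \<Rightarrow> 'a \<times> 'b \<Rightarrow> bool" where
  "first_entry a n \<omega> z \<longleftrightarrow> entry a n \<omega> z \<and>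
     (\<forall>z'. entry a n \<omega> z' \<longrightarrow> to_nat_on UNIV z \<le> to_nat_on UNIV z')"

definition ray_open :: "(('a \<times> 'b) set \<Rightarrow> 'm) \<Rightarrow> 'a \<times> 'b \<Rightarrow> bool" where
  "ray_open \<omega> z \<longleftrightarrow> (\<forall>m. ray (fst z) (snd z) m \<in> opn \<omega>)"

text \<open>False when there is no entry at all. For clusters meeting infinitely many fibres there
  is one at every distance, so failure at all distances is the event to exclude.\<close>

definition fail :: "'a \<times> 'b \<Rightarrow> nat \<Rightarrow> (('a \<times> 'b) set \<Rightarrow> 'm) \<Rightarrow> bool" where
  "fail a n \<omega> \<longleftrightarrow> (\<exists>z. first_entry a n \<omega> z \<and> \<not> ray_open \<omega> z)"

text \<open>Edges up to distance \<open>n\<close>, except those with all ends at distance exactly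
  \<open>n\<close>. The latter form the \<open>shell\<close>, which contains the rays from the
  entries.\<close>

definition past :: "'a \<times> 'b \<Rightarrow> nat \<Rightarrow> ('a \<times> 'b) edges" where
  "past a n = {e \<in> E. (\<forall>v\<in>e. D a v \<le> n) \<and> (\<exists>v\<in>e. D a v < n)}"

definition shell :: "'a \<times> 'b \<Rightarrow> nat \<Rightarrow> ('a \<times> 'b) edges" where
  "shell a n = {e \<in> E. \<forall>v\<in>e. D a v = n}"

lemma edge_nonempty: "e \<in> E \<Longrightarrow> e \<noteq> {}"
  using E(1) by (auto elim: G_edgeE)

lemma past_shell_disjoint: "past a n \<inter> shell a n = {}"
  by (auto simp: past_def shell_def)

lemma past_shell_mono: "m < n \<Longrightarrow> past a m \<union> shell a m \<subseteq> past a n"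
  using edge_nonempty by (fastforce simp: past_def shell_def)

lemma open_cong: "(e \<in> E \<Longrightarrow> \<omega> e = \<omega>' e) \<Longrightarrow> e \<in> opn \<omega> \<longleftrightarrow> e \<in> opn \<omega>'"
  by (auto simp: opn_def)

lemma entry_depends: "depends_on (past a n) (\<lambda>\<omega>. entry a n \<omega>)"
proof (rule depends_onI)
  fix \<omega> \<omega>' :: "('a \<times> 'b) set \<Rightarrow> 'm"
  assume eq: "\<And>e. e \<in> past a n \<Longrightarrow> \<omega> e = \<omega>' e"
  have "e \<in> inner \<omega> a n \<longleftrightarrow> e \<in> inner \<omega>' a n" for e
  proof (cases "\<forall>v\<in>e. D a v < n")
    case True
    have "e \<in> past a n" if "e \<in> E"
      using edge_nonempty[OF that] True that by (auto simp: past_def intro: less_imp_le)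
    then have "e \<in> opn \<omega> \<longleftrightarrow> e \<in> opn \<omega>'" using eq by (intro open_cong) blast
    then show ?thesis by (simp add: inner_def)
  qed (auto simp: inner_def)
  then have inner: "inner \<omega> a n = inner \<omega>' a n" by blast
  have "{u, z} \<in> opn \<omega> \<longleftrightarrow> {u, z} \<in> opn \<omega>'" if "D a u < n" "D a z = n" for u z
    using eq that by (intro open_cong) (auto simp: past_def)
  then show "entry a n \<omega> = entry a n \<omega>'"
    unfolding entry_def inner by (intro ext) blast
qed

lemma first_entry_depends: "depends_on (past a n) (\<lambda>\<omega>. first_entry a n \<omega>)"
proof (rule depends_onI)
  fix \<omega> \<omega>' :: "('a \<times> 'b) set \<Rightarrow> 'm"
  assume eq: "\<And>e. e \<in> past a n \<Longrightarrow> \<omega> e = \<omega>' e"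
  have "entry a n \<omega> = entry a n \<omega>'" by (rule depends_onD[OF entry_depends]) (erule eq)
  then show "first_entry a n \<omega> = first_entry a n \<omega>'" by (simp add: first_entry_def fun_eq_iff)
qed

lemma ray_open_depends:
  assumes "D a z = n"
  shows "depends_on (shell a n) (\<lambda>\<omega>. ray_open \<omega> z)"
proof (rule depends_onI)
  fix \<omega> \<omega>' :: "('a \<times> 'b) set \<Rightarrow> 'm"
  assume eq: "\<And>e. e \<in> shell a n \<Longrightarrow> \<omega> e = \<omega>' e"
  have "ray (fst z) (snd z) m \<in> opn \<omega> \<longleftrightarrow> ray (fst z) (snd z) m \<in> opn \<omega>'" for m
    using eq assms by (intro open_cong) (auto simp: shell_def ray_def D_def)
  then show "ray_open \<omega> z = ray_open \<omega>' z" by (simp add: ray_open_def)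
qed

lemma fail_depends: "depends_on (past a n \<union> shell a n) (fail a n)"
proof (rule depends_onI)
  fix \<omega> \<omega>' :: "('a \<times> 'b) set \<Rightarrow> 'm"
  assume eq: "\<And>e. e \<in> past a n \<union> shell a n \<Longrightarrow> \<omega> e = \<omega>' e"
  have fe: "first_entry a n \<omega> = first_entry a n \<omega>'"
    by (rule depends_onD[OF first_entry_depends[of a n]]) (rule eq, erule UnI1)
  have "first_entry a n \<omega>' z \<and> \<not> ray_open \<omega> z \<longleftrightarrow> first_entry a n \<omega>' z \<and> \<not> ray_open \<omega>' z" for z
  proof (cases "D a z = n")
    case True
    have "ray_open \<omega> z = ray_open \<omega>' z"
      by (rule depends_onD[OF ray_open_depends[OF True]]) (rule eq, erule UnI2)
    then show ?thesis by simp
  qed (simp add: first_entry_def entry_def)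
  then show "fail a n \<omega> = fail a n \<omega>'" unfolding fail_def fe by simp
qed

lemma pred_entry: "Measurable.pred PM (\<lambda>\<omega>. entry a n \<omega> z)"
proof -
  have "Measurable.pred PM (\<lambda>\<omega>. e \<in> inner \<omega> a n)" for e
    using pred_open[of e] by (simp add: inner_def)
  from pred_linked[OF countable_V this]
  show ?thesis unfolding entry_def
    by (intro pred_intros_logic pred_ex_countable[OF countable_V] pred_open) auto
qed

lemma pred_first_entry: "Measurable.pred PM (\<lambda>\<omega>. first_entry a n \<omega> z)"
  unfolding first_entry_def
  by (intro pred_intros_logic pred_all_countable[OF countable_V] pred_entry) auto

lemma pred_ray_open: "Measurable.pred PM (\<lambda>\<omega>. ray_open \<omega> z)"
  unfolding ray_open_def by (intro pred_intros_countable pred_open)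

lemma pred_fail: "Measurable.pred PM (fail a n)"
proof -
  have "Measurable.pred PM (\<lambda>\<omega>. \<exists>z. first_entry a n \<omega> z \<and> \<not> ray_open \<omega> z)"
    by (intro pred_ex_countable[OF countable_V] pred_intros_logic pred_first_entry pred_ray_open)
  then show ?thesis by (simp add: fail_def[abs_def])
qed

lemma first_entry_unique: "first_entry a n \<omega> z \<Longrightarrow> first_entry a n \<omega> z' \<Longrightarrow> z = z'"
  using inj_on_to_nat_on[OF countable_V] unfolding first_entry_def
  by (metis UNIV_I inj_on_eq_iff order_antisym)

lemma first_entry_exists:
  assumes "entry a n \<omega> z"
  shows "\<exists>z. first_entry a n \<omega> z"
  using ex_has_least_nat[of "entry a n \<omega>" z "to_nat_on UNIV"] assms unfolding first_entry_def by blast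

text \<open>The labels along a ray from height \<open>hgt z\<close> give a shifted piece of one
  infinite product, so the bound is the same for all \<open>z\<close>.\<close>

lemma ray_probability:
  obtains p where "0 < p" "p \<le> 1"
    "\<And>z. k0 \<le> hgt z \<Longrightarrow> (\<And>m. ray (fst z) (snd z) m \<in> E) \<Longrightarrow> p \<le> prb (\<lambda>\<omega>. ray_open \<omega> z)"
proof -
  let ?f = "\<lambda>n. measure N (B (k0 + int n))"
  obtain p where p: "0 < p" "\<And>F. finite F \<Longrightarrow> p \<le> prod ?f F"
    using prod_bounded_below[of ?f] B_pos B_sum by auto
  have "p \<le> 1" using p(2)[of "{}"] by simp
  moreover have "p \<le> prb (\<lambda>\<omega>. ray_open \<omega> z)"
    if z: "k0 \<le> hgt z" and E': "\<And>m. ray (fst z) (snd z) m \<in> E" for z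
  proof -
    have lev: "level (ray (fst z) (snd z) m) = hgt z + int m" for m by (rule level_ray)
    define j where "j = nat (hgt z - k0)"
    have j: "hgt z + int n = k0 + int (j + n)" for n using z by (simp add: j_def)
    have "p \<le> (\<Prod>n<m. measure N (B (hgt z + int n)))" for m
    proof -
      have "(\<Prod>n<m. measure N (B (hgt z + int n))) = prod ?f ((+) j ` {..<m})"
        by (subst prod.reindex) (simp_all add: j)
      then show ?thesis using p(2)[of "(+) j ` {..<m}"] by simp
    qed
    from prb_sequence_ge[OF inj_if_level[OF lev] E' B_sets this]
    have "p \<le> prb (\<lambda>\<omega>. \<forall>n. \<omega> (ray (fst z) (snd z) n) \<in> B (hgt z + int n))" .
    then show ?thesis using E' by (simp add: ray_open_def opn_def lev)
  qed
  ultimately show ?thesis using that p(1) by blast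
qed

text \<open>Given the first entry \<open>z\<close>, only the past has been explored while the ray
  above \<open>z\<close> lies in the shell, so it is open with conditional probability at least
  \<open>p\<close>. The bound on \<open>n\<close> keeps deleted edges off this ray.\<close>

lemma fail_step:
  assumes p: "\<And>z. k0 \<le> hgt z \<Longrightarrow> (\<And>m. ray (fst z) (snd z) m \<in> E) \<Longrightarrow> p \<le> prb (\<lambda>\<omega>. ray_open \<omega> z)"
    and p1: "p \<le> 1"
    and n: "\<And>e v. e \<in> G - E \<Longrightarrow> v \<in> e \<Longrightarrow> D a v < n"
    and P: "Measurable.pred PM P" "depends_on (past a n) P"
  shows "prb (\<lambda>\<omega>. P \<omega> \<and> fail a n \<omega>) \<le> (1 - p) * prb P"
proof -
  have "prb (\<lambda>\<omega>. (P \<omega> \<and> first_entry a n \<omega> z) \<and> \<not> ray_open \<omega> z)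
      \<le> (1 - p) * prb (\<lambda>\<omega>. P \<omega> \<and> first_entry a n \<omega> z)" for z
  proof (cases "D a z = n \<and> k0 \<le> hgt z")
    case True
    then have z: "D a z = n" "k0 \<le> hgt z" by auto
    have "ray (fst z) (snd z) m \<in> E" for m
    proof (rule ccontr)
      assume "ray (fst z) (snd z) m \<notin> E"
      then have "D a ((up ^^ m) (fst z), snd z) < n"
        using ray_in_G by (intro n[of "ray (fst z) (snd z) m"]) (auto simp: ray_def)
      then show False using z(1) by (simp add: D_def)
    qed
    from p[OF z(2) this] have pz: "p \<le> prb (\<lambda>\<omega>. ray_open \<omega> z)" .
    have dep: "depends_on (past a n) (\<lambda>\<omega>. P \<omega> \<and> first_entry a n \<omega> z)"
    proof (rule depends_onI)
      fix \<omega> \<omega>' :: "('a \<times> 'b) set \<Rightarrow> 'm"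
      assume eq: "\<And>e. e \<in> past a n \<Longrightarrow> \<omega> e = \<omega>' e"
      have "P \<omega> = P \<omega>'" "first_entry a n \<omega> = first_entry a n \<omega>'"
        by (rule depends_onD[OF P(2)], erule eq) (rule depends_onD[OF first_entry_depends[of a n]], erule eq)
      then show "(P \<omega> \<and> first_entry a n \<omega> z) = (P \<omega>' \<and> first_entry a n \<omega>' z)" by simp
    qed
    have dep': "depends_on (shell a n) (\<lambda>\<omega>. \<not> ray_open \<omega> z)"
      using ray_open_depends[OF z(1)] unfolding depends_on_def by simp
    have "prb (\<lambda>\<omega>. (P \<omega> \<and> first_entry a n \<omega> z) \<and> \<not> ray_open \<omega> z)
      = prb (\<lambda>\<omega>. P \<omega> \<and> first_entry a n \<omega> z) * prb (\<lambda>\<omega>. \<not> ray_open \<omega> z)"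
      by (rule indep_pred[OF _ dep _ _ dep' _ past_shell_disjoint])
        (use P(1) pred_first_entry pred_ray_open in \<open>auto simp: past_def shell_def\<close>)
    also have "\<dots> \<le> prb (\<lambda>\<omega>. P \<omega> \<and> first_entry a n \<omega> z) * (1 - p)"
      using pz prb_not[OF pred_ray_open[of z]] by (intro mult_left_mono) auto
    finally show ?thesis by (simp add: mult.commute)
  next
    case False
    \<comment> \<open>An entry is the end of an open edge and hence never lies below
      \<open>k0\<close>.\<close>
    have "\<not> first_entry a n \<omega> z" for \<omega>
      using False open_edge unfolding first_entry_def entry_def by blast
    then show ?thesis by simp
  qed
  from prb_selected_le[OF countable_V P(1) pred_first_entry _ first_entry_unique _ this]
  show ?thesis unfolding fail_def using p1 pred_ray_open by simp
qed

lemma AE_not_always_fail: "AE \<omega> in PM. \<forall>a. \<exists>n\<ge>1. \<not> fail a n \<omega>"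
proof -
  obtain p where p: "0 < p" "p \<le> 1"
    "\<And>z. k0 \<le> hgt z \<Longrightarrow> (\<And>m. ray (fst z) (snd z) m \<in> E) \<Longrightarrow> p \<le> prb (\<lambda>\<omega>. ray_open \<omega> z)"
    using ray_probability by blast
  have "AE \<omega> in PM. \<not> (\<forall>n\<ge>1. fail a n \<omega>)" for a
  proof -
    have "finite (\<Union>(G - E))" using E(2) by (auto elim!: G_edgeE)
    then have "finite (D a ` \<Union>(G - E))" by simp
    \<comment> \<open>From distance \<open>n0\<close> on no edge is missing from \<open>E\<close>.
      Starting at \<open>Suc n0\<close> also ensures \<open>1 \<le> n\<close>, without which
      \<open>a\<close> itself would not lie inside the ball.\<close>
    then obtain n0 where n0: "\<And>v. v \<in> \<Union>(G - E) \<Longrightarrow> D a v < n0"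
      using finite_nat_set_iff_bounded by (metis imageI)
    let ?P = "\<lambda>k \<omega>. \<forall>n\<in>{Suc n0..<Suc n0 + k}. fail a n \<omega>"
    have meas: "Measurable.pred PM (?P k)" for k
      using pred_fail by (intro pred_intros_finite) auto
    have bound: "prb (?P k) \<le> (1 - p) ^ k" for k
    proof (induction k)
      case (Suc k)
      have dep: "depends_on (past a (Suc n0 + k)) (?P k)"
      proof (rule depends_onI)
        fix \<omega> \<omega>' :: "('a \<times> 'b) set \<Rightarrow> 'm"
        assume eq: "\<And>e. e \<in> past a (Suc n0 + k) \<Longrightarrow> \<omega> e = \<omega>' e"
        have "fail a n \<omega> = fail a n \<omega>'" if "n \<in> {Suc n0..<Suc n0 + k}" for n
          by (rule depends_onD[OF fail_depends], rule eq)
            (use past_shell_mono[of n "Suc n0 + k" a] that in auto)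
        then show "?P k \<omega> = ?P k \<omega>'" by blast
      qed
      have "prb (?P (Suc k)) = prb (\<lambda>\<omega>. ?P k \<omega> \<and> fail a (Suc n0 + k) \<omega>)"
        by (rule arg_cong[where f = "measure PM"]) (auto simp: less_Suc_eq)
      also have "\<dots> \<le> (1 - p) * prb (?P k)"
      proof (rule fail_step[OF p(3,2) _ meas dep])
        fix e v assume "e \<in> G - E" "v \<in> e"
        then have "D a v < n0" using n0 by blast
        then show "D a v < Suc n0 + k" by simp
      qed
      also have "\<dots> \<le> (1 - p) * (1 - p) ^ k" using Suc p(2) by (intro mult_left_mono) auto
      finally show ?case by simp
    qed simp
    have measA: "Measurable.pred PM (\<lambda>\<omega>. \<forall>n\<ge>1. fail a n \<omega>)"
      using pred_fail by (intro pred_intros_countable pred_intros_logic) auto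
    show ?thesis
    proof (rule AE_not_if_small[OF measA, where q = "1 - p" and C = 1])
      fix k
      have "prb (\<lambda>\<omega>. \<forall>n\<ge>1. fail a n \<omega>) \<le> prb (?P k)"
        by (rule prb_mono[OF meas]) auto
      then show "prb (\<lambda>\<omega>. \<forall>n\<ge>1. fail a n \<omega>) \<le> 1 * (1 - p) ^ k" using bound[of k] by simp
    qed (use p in auto)
  qed
  then have "AE \<omega> in PM. \<forall>a\<in>UNIV. \<not> (\<forall>n\<ge>1. fail a n \<omega>)"
    by (simp only: AE_ball_countable[OF countable_V]) blast
  then show ?thesis by simp
qed

lemma D_edge: "{u, v} \<in> G \<Longrightarrow> D a v \<le> Suc (D a u)"
  using gdist_edge[OF tree_linked, of "snd u" "snd v" "snd a"] by (auto simp: D_def G_iff')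

text \<open>An edge changes the distance by at most one, so the first exit from the ball of radius
  \<open>n\<close> lands at distance exactly \<open>n\<close>.\<close>

lemma inner_or_entry:
  assumes "linked (opn \<omega>) a u" "1 \<le> n"
  shows "linked (inner \<omega> a n) a u \<and> D a u < n \<or> (\<exists>z. entry a n \<omega> z)"
  using assms(1)
proof (induction rule: linked_induct)
  case refl
  then show ?case using assms(2) by (simp add: D_def)
next
  case (step y z)
  show ?case
  proof (cases "\<exists>z. entry a n \<omega> z")
    case False
    then have y: "linked (inner \<omega> a n) a y" "D a y < n" using step.IH by auto
    have "D a z \<le> n" using D_edge[of y z a] open_edge[OF step(2)] y(2) by linarith
    moreover have "D a z \<noteq> n" using False y step(2) unfolding entry_def by blast
    ultimately have z: "D a z < n" by simp
    then have "{y, z} \<in> inner \<omega> a n" using y(2) step(2) by (simp add: inner_def)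
    then show ?thesis using linked_trans[OF y(1) linked_edge] z by blast
  qed simp
qed

text \<open>Balls in \<open>T\<close> are finite, so there is an entry at every distance; where
  \<open>fail\<close> is false, the ray above the first entry is open.\<close>

lemma sky_if_infinitely_many_fibres:
  assumes "levels_open \<omega>" and nf: "\<exists>n\<ge>1. \<not> fail a n \<omega>"
    and inf: "infinite (snd ` {u. linked (opn \<omega>) a u})"
  shows "sky \<omega> a"
proof -
  obtain n where n: "1 \<le> n" "\<not> fail a n \<omega>" using nf by blast
  have "\<exists>z. entry a n \<omega> z"
  proof (rule ccontr)
    assume "\<not> ?thesis"
    then have "D a u < n" if "linked (opn \<omega>) a u" for u
      using inner_or_entry[OF that n(1)] by blast
    then have "snd ` {u. linked (opn \<omega>) a u} \<subseteq> {t. gdist T (snd a) t < n}"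
      unfolding D_def by blast
    moreover have "finite {t. gdist T (snd a) t < n}"
    proof -
      have "finite {t. gdist T (snd a) t \<le> k}" for k
      proof (induction k)
        case 0
        have "{t. gdist T (snd a) t \<le> 0} \<subseteq> {snd a}"
          using rooted_tree.dep_eq_0[OF rooted] by auto
        then show ?case by (rule finite_subset) simp
      next
        case (Suc k)
        have "{t. gdist T (snd a) t \<le> Suc k} \<subseteq>
            insert (snd a) (\<Union>s\<in>{t. gdist T (snd a) t \<le> k}. neighbours T s)"
        proof
          fix t assume t: "t \<in> {t. gdist T (snd a) t \<le> Suc k}"
          show "t \<in> insert (snd a) (\<Union>s\<in>{t. gdist T (snd a) t \<le> k}. neighbours T s)"
          proof (cases "t = snd a")
            case False
            then obtain u where "{u, t} \<in> T" "gdist T (snd a) t = Suc (gdist T (snd a) u)"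
              using gdist_pred[OF tree_linked] by blast
            then show ?thesis using t by (auto simp: neighbours_def)
          qed simp
        qed
        then show ?case
          by (rule finite_subset) (use Suc finite_neighbours_T in auto)
      qed
      then have "finite {t. gdist T (snd a) t \<le> n}" .
      then show ?thesis by (rule finite_subset[rotated]) auto
    qed
    ultimately show False using inf finite_subset by blast
  qed
  then obtain z where z: "first_entry a n \<omega> z" using first_entry_exists by blast
  then have ray: "ray_open \<omega> z" using n(2) unfolding fail_def by blast
  from z obtain u where u: "linked (inner \<omega> a n) a u" "{u, z} \<in> opn \<omega>"
    by (auto simp: first_entry_def entry_def)
  have "linked (opn \<omega>) a u" by (rule linked_mono[OF u(1)]) (auto simp: inner_def)
  then have "linked (opn \<omega>) a z" by (rule linked_trans[OF _ linked_edge[OF u(2)]])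
  then show ?thesis
    using ray by (intro sky_if_ray[OF assms(1), of a 0 "fst z" "snd z"]) (auto simp: ray_open_def)
qed

lemma AE_at_most_one_infinite_cluster:
  "AE \<omega> in PM. \<forall>a b. infinite {u. linked (opn \<omega>) a u} \<and> infinite {u. linked (opn \<omega>) b u} \<longrightarrow>
     linked (opn \<omega>) a b"
  using AE_rays_open AE_levels_open AE_not_always_fail
proof eventually_elim
  case (elim \<omega>)
  then have "sky \<omega> a" if "infinite {u. linked (opn \<omega>) a u}" for a
    using sky_if_finitely_many_fibres[OF elim(1,2) that] sky_if_infinitely_many_fibres[OF elim(2)]
    by blast
  then show ?case using sky_linked by blast
qed

end

section \<open>Free and wired forests coincide\<close>

lemma infinite_cluster_along_ray:
  fixes f :: "nat \<Rightarrow> 'v"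
  assumes "inj f" "\<And>n. {f n, f (Suc n)} \<in> S"
  shows "infinite {x. linked S (f 0) x}"
proof -
  have "linked S (f 0) (f n)" for n
    by (induction n) (simp, rule linked_trans[OF _ linked_edge[OF assms(2)]])
  then have "range f \<subseteq> {x. linked S (f 0) x}" by auto
  then show ?thesis using assms(1) finite_subset range_inj_infinite by metis
qed

lemma free_eq_wired:
  assumes simple: "simple_graph E"
    and uniq: "\<And>e a b. e \<in> E \<Longrightarrow> infinite {x. linked {e' \<in> E - {e}. R e e'} a x} \<Longrightarrow>
      infinite {x. linked {e' \<in> E - {e}. R e e'} b x} \<Longrightarrow> linked {e' \<in> E - {e}. R e e'} a b"
  shows "free_forest R E = wired_forest R E"
proof -
  have "e \<notin> free_forest R E" if P: "P \<in> biinfinite_paths E" and least: "least_edge R P e" for P e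
  proof -
    obtain \<gamma> :: "int \<Rightarrow> _" where \<gamma>: "inj \<gamma>" "P \<subseteq> E" "P = {{\<gamma> i, \<gamma> (i + 1)} | i. True}"
      using P by (auto simp: biinfinite_paths_def)
    have e: "e \<in> P" "\<And>e'. e' \<in> P \<Longrightarrow> e' \<noteq> e \<Longrightarrow> R e e'"
      using least by (auto simp: least_edge_def)
    obtain j where j: "e = {\<gamma> j, \<gamma> (j + 1)}" using e(1) \<gamma>(3) by auto
    let ?S = "{e' \<in> E - {e}. R e e'}"
    have S: "{\<gamma> i, \<gamma> (i + 1)} \<in> ?S" if "i \<noteq> j" for i
    proof -
      have P: "{\<gamma> i, \<gamma> (i + 1)} \<in> P" using \<gamma>(3) by auto
      moreover have "{\<gamma> i, \<gamma> (i + 1)} \<noteq> e"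
        using that \<gamma>(1) by (auto simp: j doubleton_eq_iff inj_eq)
      ultimately show ?thesis using e(2) \<gamma>(2) by auto
    qed
    have inj: "inj (\<lambda>n. \<gamma> (j + 1 + int n))" "inj (\<lambda>n. \<gamma> (j - int n))"
      by (auto intro!: injI dest!: injD[OF \<gamma>(1)])
    have "{\<gamma> (j + 1 + int n), \<gamma> (j + 1 + int (Suc n))} \<in> ?S" for n
      using S[of "j + 1 + int n"] by (simp add: ac_simps)
    from infinite_cluster_along_ray[OF inj(1) this]
    have inf1: "infinite {x. linked ?S (\<gamma> (j + 1)) x}" by simp
    have "{\<gamma> (j - int n), \<gamma> (j - int (Suc n))} \<in> ?S" for n
      using S[of "j - int (Suc n)"] by (simp add: insert_commute)
    from infinite_cluster_along_ray[OF inj(2) this]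
    have inf2: "infinite {x. linked ?S (\<gamma> j) x}" by simp
    have eE: "e \<in> E" using e(1) \<gamma>(2) by auto
    have "linked ?S (\<gamma> j) (\<gamma> (j + 1))" by (rule uniq[OF eE inf2 inf1])
    moreover have "\<gamma> j \<noteq> \<gamma> (j + 1)" using \<gamma>(1) by (simp add: inj_eq)
    ultimately obtain C where C: "C \<in> cycles E" "e \<in> C" "C \<subseteq> insert e ?S"
      using cycle_through[of "\<gamma> j" "\<gamma> (j + 1)" E ?S] eE by (auto simp: j)
    then have "least_edge R C e" by (auto simp: least_edge_def)
    then show ?thesis using C(1) by (auto simp: free_forest_def)
  qed
  then show ?thesis by (auto simp: wired_forest_def)
qed

section \<open>Uniform labels and the edges above a given edge\<close>

abbreviation unif :: "real measure" where "unif \<equiv> uniform_measure lborel {0..1}"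

lemma prob_space_unif: "prob_space unif"
  by (rule prob_space_uniform_measure) auto

lemma measure_unif_interval:
  assumes "0 \<le> \<theta>" "\<theta> \<le> 1"
  shows "measure unif {0<..<\<theta>} = \<theta>"
proof -
  have "{0..1} \<inter> {0<..<\<theta>} = {0<..<\<theta>}" using assms by auto
  then show ?thesis using assms by (simp add: measure_uniform_measure)
qed

lemma measurable_unif: "f \<in> M \<rightarrow>\<^sub>M unif \<longleftrightarrow> f \<in> borel_measurable M"
  using measurable_cong_sets[of M M unif borel] by simp

lemma AE_unif: "AE u in unif. 0 < u \<and> u < 1"
proof -
  interpret prob_space unif by (rule prob_space_unif)
  have "AE u in unif. u \<in> {0<..<1}"
    by (rule AE_prob_1[OF measure_unif_interval]) simp_all
  then show ?thesis by simp
qed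

lemma pred_unique_infinite_cluster:
  fixes S :: "'w \<Rightarrow> 'v edges"
  assumes "countable (UNIV :: 'v set)" "\<And>e. Measurable.pred M (\<lambda>\<omega>. e \<in> S \<omega>)"
  shows "Measurable.pred M (\<lambda>\<omega>. \<forall>a b. infinite {u. linked (S \<omega>) a u} \<and>
    infinite {u. linked (S \<omega>) b u} \<longrightarrow> linked (S \<omega>) a b)"
  by (intro pred_all_countable[OF assms(1)] pred_intros_logic pred_infinite[OF assms(1)]
      pred_linked[OF assms])

lemma pred_section:
  assumes "Measurable.pred (borel \<Otimes>\<^sub>M borel) (\<lambda>(c :: real, u :: real). u \<in> C c)"
    and "f \<in> borel_measurable M" "g \<in> borel_measurable M"
  shows "Measurable.pred M (\<lambda>\<omega>. f \<omega> \<in> C (g \<omega>))"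
  using measurable_compose[OF measurable_Pair[OF assms(3,2)] assms(1)] by simp

context gp_product
begin

lemma simple_G: "simple_graph G"
  unfolding simple_graph_def
proof
  fix e assume "e \<in> G"
  then obtain u v where "e = {u, v}" "u \<noteq> v" by (rule G_edgeE)
  then show "card e = 2" by simp
qed

lemma countable_G: "countable G"
proof -
  have "G \<subseteq> (\<lambda>(u, v). {u, v}) ` (UNIV \<times> UNIV)" by (auto elim!: G_edgeE)
  moreover have "countable ((UNIV :: ('a \<times> 'b) set) \<times> (UNIV :: ('a \<times> 'b) set))"
    using countable_V by (intro countable_SIGMA) auto
  ultimately show ?thesis using countable_subset countable_image by metis
qed

definition unique_cluster :: "('a \<times> 'b) edges \<Rightarrow> bool" where
  "unique_cluster S \<longleftrightarrow> (\<forall>a b. infinite {u. linked S a u} \<and> infinite {u. linked S b u} \<longrightarrow> linked S a b)"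

text \<open>The label of \<open>e\<close> is split off by Fubini's theorem: given this label, the edges
  above \<open>e\<close> in the order form an independent percolation whose parameter depends on the level only.\<close>

lemma AE_unique_above:
  fixes B :: "real \<Rightarrow> int \<Rightarrow> real set"
  assumes e: "e \<in> G"
    and meas: "\<And>k. Measurable.pred (borel \<Otimes>\<^sub>M borel) (\<lambda>(c, u). u \<in> B c k)"
    and B: "\<And>c. 0 < c \<Longrightarrow> c < 1 \<Longrightarrow> \<exists>k0. (\<forall>k<k0. B c k = {}) \<and> (\<forall>k\<ge>k0. 0 < measure unif (B c k)) \<and>
      summable (\<lambda>n. 1 - measure unif (B c (k0 + int n)))"
  shows "AE U in PiM G (\<lambda>_. unif). unique_cluster {e' \<in> G - {e}. U e' \<in> B (U e) (elev x0 e')}"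
proof -
  let ?I = "G - {e}"
  let ?S = "\<lambda>c U. {e' \<in> ?I. U e' \<in> B c (elev x0 e')}"
  interpret unif: prob_space unif by (rule prob_space_unif)
  interpret R: prob_space "PiM ?I (\<lambda>_. unif)" by (rule prob_space_PiM) (rule prob_space_unif)
  interpret pair_sigma_finite unif "PiM ?I (\<lambda>_. unif)" by unfold_locales
  have Bsets: "B c k \<in> sets borel" for c k
  proof -
    have "Measurable.pred borel (\<lambda>u. u \<in> B c k)"
      using measurable_compose[OF measurable_Pair1' meas[of k], of c] by simp
    then show ?thesis by (simp add: pred_def)
  qed
  have sec: "AE U in PiM ?I (\<lambda>_. unif). unique_cluster (?S c U)" if c: "0 < c" "c < 1" for c
  proof -
    obtain k0 where k0: "\<forall>k<k0. B c k = {}" "\<forall>k\<ge>k0. 0 < measure unif (B c k)"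
      "summable (\<lambda>n. 1 - measure unif (B c (k0 + int n)))" using B[OF c] by blast
    \<comment> \<open>The missing edge \<open>e\<close> is why the locale admits a finite set of
      deleted edges.\<close>
    interpret L: layered_percolation A T d ?I unif x0 "B c" k0
      by unfold_locales (use k0 Bsets in \<open>auto simp: Diff_Diff_Int\<close>)
    have "L.opn U = ?S c U" for U by (auto simp: L.opn_def)
    then show ?thesis
      using L.AE_at_most_one_infinite_cluster by (simp add: unique_cluster_def)
  qed
  have pairm: "Measurable.pred (unif \<Otimes>\<^sub>M PiM ?I (\<lambda>_. unif)) (\<lambda>\<omega>. unique_cluster (?S (fst \<omega>) (snd \<omega>)))"
    unfolding unique_cluster_def
  proof (rule pred_unique_infinite_cluster[OF countable_V])
    fix e'
    show "Measurable.pred (unif \<Otimes>\<^sub>M PiM ?I (\<lambda>_. unif)) (\<lambda>\<omega>. e' \<in> ?S (fst \<omega>) (snd \<omega>))"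
    proof (cases "e' \<in> ?I")
      case True
      have "(\<lambda>\<omega>. snd \<omega> e') \<in> borel_measurable (unif \<Otimes>\<^sub>M PiM ?I (\<lambda>_. unif))"
        using measurable_compose[OF measurable_snd measurable_component_singleton[OF True, of "\<lambda>_. unif"]]
        unfolding measurable_unif by blast
      moreover have "fst \<in> borel_measurable (unif \<Otimes>\<^sub>M PiM ?I (\<lambda>_. unif))"
        using measurable_fst[of unif "PiM ?I (\<lambda>_. unif)"] unfolding measurable_unif .
      ultimately have "Measurable.pred (unif \<Otimes>\<^sub>M PiM ?I (\<lambda>_. unif)) (\<lambda>\<omega>. snd \<omega> e' \<in> B (fst \<omega>) (elev x0 e'))"
        by (rule pred_section[OF meas])
      then show ?thesis using True by simp
    next
      case False
      then have "(\<lambda>\<omega>. e' \<in> ?S (fst \<omega>) (snd \<omega>)) = (\<lambda>\<omega>. False)" by auto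
      then show ?thesis by simp
    qed
  qed
  have "AE c in unif. AE U in PiM ?I (\<lambda>_. unif). unique_cluster (?S (fst (c, U)) (snd (c, U)))"
    using AE_unif by eventually_elim (unfold fst_conv snd_conv, rule sec, auto)
  then have AEp: "AE \<omega> in unif \<Otimes>\<^sub>M PiM ?I (\<lambda>_. unif). unique_cluster (?S (fst \<omega>) (snd \<omega>))"
    by (rule AE_pair_measure[OF pairm[unfolded pred_def]])
  \<comment> \<open>Reinserting the label of \<open>e\<close> recovers the full product measure;
    \<open>?S\<close> never asks for the label at \<open>e\<close> itself, so it is unchanged by the
    update.\<close>
  let ?f = "\<lambda>(x, X). X(e := x)"
  have ins: "insert e ?I = G" using e by auto
  have distr: "distr (unif \<Otimes>\<^sub>M PiM ?I (\<lambda>_. unif)) (PiM G (\<lambda>_. unif)) ?f = PiM G (\<lambda>_. unif)"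
    using distr_pair_PiM_eq_PiM[of ?I "\<lambda>_. unif" e] prob_space_unif unfolding ins by simp
  have fm: "?f \<in> unif \<Otimes>\<^sub>M PiM ?I (\<lambda>_. unif) \<rightarrow>\<^sub>M PiM G (\<lambda>_. unif)"
    unfolding case_prod_beta' by (rule measurable_fun_upd[where J = ?I]) (use e in auto)
  have Sf: "?S (?f \<omega> e) (?f \<omega>) = ?S (fst \<omega>) (snd \<omega>)" for \<omega>
    by (auto simp: case_prod_beta)
  have "Measurable.pred (PiM G (\<lambda>_. unif)) (\<lambda>U. unique_cluster (?S (U e) U))"
    unfolding unique_cluster_def
  proof (rule pred_unique_infinite_cluster[OF countable_V])
    fix e'
    show "Measurable.pred (PiM G (\<lambda>_. unif)) (\<lambda>U. e' \<in> ?S (U e) U)"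
    proof (cases "e' \<in> ?I")
      case True
      then have "(\<lambda>U. U e') \<in> borel_measurable (PiM G (\<lambda>_. unif))"
        "(\<lambda>U. U e) \<in> borel_measurable (PiM G (\<lambda>_. unif))"
        using measurable_component_singleton[of e' G "\<lambda>_. unif"]
          measurable_component_singleton[OF e, of "\<lambda>_. unif"] unfolding measurable_unif by auto
      then have "Measurable.pred (PiM G (\<lambda>_. unif)) (\<lambda>U. U e' \<in> B (U e) (elev x0 e'))"
        by (rule pred_section[OF meas])
      then show ?thesis using True by simp
    next
      case False
      then have "(\<lambda>U. e' \<in> ?S (U e) U) = (\<lambda>U. False)" by auto
      then show ?thesis by simp
    qed
  qed
  then have "(AE U in distr (unif \<Otimes>\<^sub>M PiM ?I (\<lambda>_. unif)) (PiM G (\<lambda>_. unif)) ?f. unique_cluster (?S (U e) U)) \<longleftrightarrow>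
      (AE \<omega> in unif \<Otimes>\<^sub>M PiM ?I (\<lambda>_. unif). unique_cluster (?S (?f \<omega> e) (?f \<omega>)))"
    by (intro AE_distr_iff fm) simp
  then show ?thesis unfolding distr Sf using AEp by simp
qed

text \<open>\<open>B l c k\<close> is the set of labels with which an edge of level \<open>k\<close>
  beats an edge of level \<open>l\<close> and label \<open>c\<close>. The orders enter only through
  this set.\<close>

lemma AE_free_eq_wired:
  fixes R :: "(('a \<times> 'b) set \<Rightarrow> real) \<Rightarrow> ('a \<times> 'b) set \<Rightarrow> ('a \<times> 'b) set \<Rightarrow> bool"
    and B :: "int \<Rightarrow> real \<Rightarrow> int \<Rightarrow> real set"
  assumes R: "\<And>U e e'. e \<in> G \<Longrightarrow> e' \<in> G \<Longrightarrow> 0 < U e' \<Longrightarrow> U e' < 1 \<Longrightarrow>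
      R U e e' \<longleftrightarrow> U e' \<in> B (elev x0 e) (U e) (elev x0 e')"
    and meas: "\<And>l k. Measurable.pred (borel \<Otimes>\<^sub>M borel) (\<lambda>(c, u). u \<in> B l c k)"
    and B: "\<And>l c. 0 < c \<Longrightarrow> c < 1 \<Longrightarrow> \<exists>k0. (\<forall>k<k0. B l c k = {}) \<and>
      (\<forall>k\<ge>k0. 0 < measure unif (B l c k)) \<and> summable (\<lambda>n. 1 - measure unif (B l c (k0 + int n)))"
  shows "AE U in uniform_labels G. free_forest (R U) G = wired_forest (R U) G"
proof -
  have "AE U in PiM G (\<lambda>_. unif). \<forall>e\<in>G. unique_cluster {e' \<in> G - {e}. U e' \<in> B (elev x0 e) (U e) (elev x0 e')}"
    by (subst AE_ball_countable[OF countable_G]) (intro ballI AE_unique_above meas B)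
  moreover have "AE U in PiM G (\<lambda>_. unif). \<forall>e\<in>G. 0 < U e \<and> U e < 1"
    by (subst AE_ball_countable[OF countable_G])
      (intro ballI AE_PiM_component[where M = "\<lambda>_. unif"] prob_space_unif AE_unif)
  ultimately have "AE U in PiM G (\<lambda>_. unif). free_forest (R U) G = wired_forest (R U) G"
  proof eventually_elim
    case (elim U)
    have eq: "{e' \<in> G - {e}. R U e e'} = {e' \<in> G - {e}. U e' \<in> B (elev x0 e) (U e) (elev x0 e')}"
      if "e \<in> G" for e
      using R[OF that] elim(2) by blast
    show ?case
    proof (rule free_eq_wired[OF simple_G])
      fix e a b assume "e \<in> G" "infinite {x. linked {e' \<in> G - {e}. R U e e'} a x}"
        "infinite {x. linked {e' \<in> G - {e}. R U e e'} b x}"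
      then show "linked {e' \<in> G - {e}. R U e e'} a b"
        using elim(1) unfolding unique_cluster_def eq[OF \<open>e \<in> G\<close>] by blast
    qed
  qed
  then show ?thesis unfolding uniform_labels_def .
qed

lemma edge_weight_level:
  assumes "e \<in> G"
  shows "edge_weight (rel_weight (Aut G) z) e = rel_weight (Aut G) z (x0, t0) * 2 powi elev x0 e"
proof -
  let ?w = "rel_weight (Aut G) z"
  obtain u v where e: "e = {u, v}" using assms by (rule G_edgeE)
  have w: "?w v = ?w (x0, t0) * 2 powi height x0 (fst v)" for v
    using weight_height[of z "fst v" "snd v" x0 t0] by simp
  have "min (?w u) (?w v) = ?w (x0, t0) * 2 powi min (height x0 (fst u)) (height x0 (fst v))"
  proof -
    have mono: "?w (x0, t0) * 2 powi k \<le> ?w (x0, t0) * 2 powi l" if "k \<le> l" for k l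
      using that weight_pos[of z "(x0, t0)"] by (intro mult_left_mono power_int_increasing) auto
    show ?thesis
      unfolding w[of u] w[of v]
      using mono linear[of "height x0 (fst u)" "height x0 (fst v)"] by (auto simp: min_absorb1 min_absorb2)
  qed
  then show ?thesis by (simp add: e edge_weight_def elev_def)
qed

end

lemma measure_unif_mono: "B \<in> sets borel \<Longrightarrow> C \<in> sets borel \<Longrightarrow> B \<subseteq> C \<Longrightarrow> measure unif B \<le> measure unif C"
proof -
  interpret prob_space unif by (rule prob_space_unif)
  show "B \<in> sets borel \<Longrightarrow> C \<in> sets borel \<Longrightarrow> B \<subseteq> C \<Longrightarrow> measure unif B \<le> measure unif C"
    by (rule finite_measure_mono) auto
qed

lemma measure_unif_le_1: "measure unif B \<le> 1"
proof -
  interpret prob_space unif by (rule prob_space_unif)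
  show ?thesis by (rule prob_le_1)
qed

section \<open>The two orders as layered percolations\<close>

context gp_product
begin

text \<open>Up to ties, an edge of level \<open>k\<close> beats \<open>e\<close> iff its label is
  below the threshold \<open>\<theta> k\<close>. From \<open>k0\<close> on it fails to do so with
  probability at most \<open>1 - \<theta> k\<close>, which decays geometrically at rate
  \<open>2 powr (- \<beta>)\<close>; this is where \<open>\<beta> > 0\<close> enters.\<close>

lemma AE_F_eq_W_beta:
  assumes "0 < \<beta>"
  shows "AE U in uniform_labels G. F_beta G (rel_weight (Aut G) z) \<beta> U = W_beta G (rel_weight (Aut G) z) \<beta> U"
proof -
  let ?w = "rel_weight (Aut G) z"
  fix x0 :: 'a and t0 :: 'b
  define W where "W = (\<lambda>k :: int. (?w (x0, t0) * 2 powi k) powr \<beta>)"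
  define B where "B = (\<lambda>(l :: int) (c :: real) (k :: int). {u. 0 < u \<and> u < 1 \<and>
    (W l * (1 - c) < W k * (1 - u) \<or> W l * (1 - c) = W k * (1 - u) \<and> 1 - c < 1 - u)})"
  have Wpos: "0 < W k" for k unfolding W_def using weight_pos[of z "(x0, t0)"] by simp
  have ratio: "W l / W k = 2 powr (\<beta> * (real_of_int l - real_of_int k))" for l k
  proof -
    have "W l / W k = ((2 powi l :: real) / 2 powi k) powr \<beta>"
      unfolding W_def using weight_pos[of z "(x0, t0)"] by (simp add: powr_mult powr_divide)
    also have "(2 powi l :: real) / 2 powi k = 2 powr (real_of_int l - real_of_int k)"
      by (simp add: powr_real_of_int' powr_diff)
    finally show ?thesis by (simp add: powr_powr mult.commute)
  qed
  have meas: "Measurable.pred (borel \<Otimes>\<^sub>M borel) (\<lambda>(c, u). u \<in> B l c k)" for l k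
    unfolding B_def mem_Collect_eq by measurable
  show ?thesis
    unfolding F_beta_def W_beta_def
  proof (rule AE_free_eq_wired[where B = B and ?x0.0 = x0])
    fix U :: "('a \<times> 'b) set \<Rightarrow> real" and e e'
    assume "e \<in> G" "e' \<in> G" "0 < U e'" "U e' < 1"
    then show "less_beta ?w \<beta> U e e' \<longleftrightarrow> U e' \<in> B (elev x0 e) (U e) (elev x0 e')"
      by (simp add: less_beta_def X_def edge_weight_level[where z = z and ?x0.0 = x0 and ?t0.0 = t0] B_def W_def)
  next
    show "Measurable.pred (borel \<Otimes>\<^sub>M borel) (\<lambda>(c, u). u \<in> B l c k)" for l k by (rule meas)
  next
    fix l :: int and c :: real assume c: "0 < c" "c < 1"
    \<comment> \<open>The level at which \<open>\<theta>\<close> vanishes; \<open>k0\<close> is the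
      least integer strictly above it, since positive probabilities are required.\<close>
    define y where "y = real_of_int l + log 2 (1 - c) / \<beta>"
    define k0 where "k0 = \<lfloor>y\<rfloor> + 1"
    define \<theta> where "\<theta> = (\<lambda>k. 1 - (1 - c) * 2 powr (\<beta> * (real_of_int l - real_of_int k)))"
    have theta: "0 < \<theta> k \<longleftrightarrow> k0 \<le> k" for k
    proof -
      have "0 < \<theta> k \<longleftrightarrow> 1 - c < 2 powr (\<beta> * (real_of_int k - real_of_int l))"
        unfolding \<theta>_def using c
        by (simp add: right_diff_distrib powr_diff field_simps)
      also have "\<dots> \<longleftrightarrow> log 2 (1 - c) < \<beta> * (real_of_int k - real_of_int l)"
        using c by (simp add: log_less_iff)
      also have "\<dots> \<longleftrightarrow> y < real_of_int k"
        unfolding y_def using assms by (simp add: field_simps)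
      also have "\<dots> \<longleftrightarrow> k0 \<le> k" unfolding k0_def by linarith
      finally show ?thesis .
    qed
    have theta1: "\<theta> k \<le> 1" for k unfolding \<theta>_def using c by simp
    have Bset: "B l c k \<in> sets borel" for k unfolding B_def by measurable
    have Wl: "W l * (1 - c) = W k * ((1 - c) * 2 powr (\<beta> * (real_of_int l - real_of_int k)))" for k
      using ratio[of l k] Wpos[of k] by (simp add: divide_eq_eq)
    have cmp: "W l * (1 - c) < W k * (1 - u) \<longleftrightarrow> u < \<theta> k" for k u
      unfolding Wl[of k] \<theta>_def mult_less_cancel_left_pos[OF Wpos[of k]] by auto
    have cmp_eq: "W l * (1 - c) = W k * (1 - u) \<longleftrightarrow> u = \<theta> k" for k u
      unfolding Wl[of k] \<theta>_def using Wpos[of k] by (auto simp del: mult_eq_0_iff)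
    \<comment> \<open>A tie would need the label \<open>\<theta> k\<close>, which is not positive
      here.\<close>
    have low: "B l c k = {}" if "k < k0" for k
      using theta[of k] that unfolding B_def cmp cmp_eq by auto
    have ge: "\<theta> k \<le> measure unif (B l c k)" if "k0 \<le> k" for k
    proof -
      have "\<theta> k = measure unif {0<..<\<theta> k}"
        using theta[of k] theta1[of k] that by (subst measure_unif_interval) auto
      also have "\<dots> \<le> measure unif (B l c k)"
        using theta1[of k] Bset by (intro measure_unif_mono) (auto simp: B_def cmp)
      finally show ?thesis .
    qed
    have "summable (\<lambda>n. 1 - measure unif (B l c (k0 + int n)))"
    proof (rule summable_comparison_test')
      show "summable (\<lambda>n. (1 - c) * 2 powr (\<beta> * (real_of_int l - real_of_int k0)) * (2 powr (- \<beta>)) ^ n)"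
        using assms by (intro summable_mult summable_geometric) (simp add: powr_less_one)
      fix n :: nat
      have "1 - measure unif (B l c (k0 + int n)) \<le> 1 - \<theta> (k0 + int n)" using ge[of "k0 + int n"] by simp
      also have "\<dots> = (1 - c) * 2 powr (\<beta> * (real_of_int l - real_of_int k0)) * (2 powr (- \<beta>)) ^ n"
        unfolding \<theta>_def by (simp add: powr_realpow[symmetric] powr_powr powr_add[symmetric] algebra_simps)
      finally show "norm (1 - measure unif (B l c (k0 + int n)))
          \<le> (1 - c) * 2 powr (\<beta> * (real_of_int l - real_of_int k0)) * (2 powr (- \<beta>)) ^ n"
        using measure_unif_le_1 by simp
    qed
    moreover have "0 < measure unif (B l c k)" if "k0 \<le> k" for k
      using ge[OF that] theta[of k] that by linarith
    ultimately show "\<exists>k0. (\<forall>k<k0. B l c k = {}) \<and> (\<forall>k\<ge>k0. 0 < measure unif (B l c k)) \<and>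
        summable (\<lambda>n. 1 - measure unif (B l c (k0 + int n)))"
      using low by blast
  qed
qed

text \<open>The limiting case of infinite \<beta>: higher levels beat \<open>e\<close>, lower ones
  lose, and on the level of \<open>e\<close> smaller labels win. So \<open>k0\<close> is that level
  and only the term 0 of the series can be nonzero.\<close>

lemma AE_FMaxSF_eq_WMaxSF:
  "AE U in uniform_labels G. FMaxSF G (rel_weight (Aut G) z) U = WMaxSF G (rel_weight (Aut G) z) U"
proof -
  let ?w = "rel_weight (Aut G) z"
  fix x0 :: 'a and t0 :: 'b
  define B where "B = (\<lambda>(l :: int) (c :: real) (k :: int). {u :: real. 0 < u \<and> u < 1 \<and>
    (l < k \<or> l = k \<and> 1 - c < 1 - u)})"
  have mono: "?w (x0, t0) * 2 powi l < ?w (x0, t0) * 2 powi k \<longleftrightarrow> l < k"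
    "?w (x0, t0) * 2 powi l = ?w (x0, t0) * 2 powi k \<longleftrightarrow> l = k" for l k :: int
  proof -
    have "(2 :: real) powi l = 2 powr real_of_int l" "(2 :: real) powi k = 2 powr real_of_int k"
      by (simp_all add: powr_real_of_int')
    then show "?w (x0, t0) * 2 powi l < ?w (x0, t0) * 2 powi k \<longleftrightarrow> l < k"
      "?w (x0, t0) * 2 powi l = ?w (x0, t0) * 2 powi k \<longleftrightarrow> l = k"
      using weight_pos[of z "(x0, t0)"] by (simp_all add: powr_inj)
  qed
  show ?thesis
    unfolding FMaxSF_def WMaxSF_def
  proof (rule AE_free_eq_wired[where B = B and ?x0.0 = x0])
    fix U :: "('a \<times> 'b) set \<Rightarrow> real" and e e'
    assume "e \<in> G" "e' \<in> G" "0 < U e'" "U e' < 1"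
    then show "less_weight ?w U e e' \<longleftrightarrow> U e' \<in> B (elev x0 e) (U e) (elev x0 e')"
      by (simp only: less_weight_def edge_weight_level[where z = z and ?x0.0 = x0 and ?t0.0 = t0] mono)
        (simp add: B_def)
  next
    show "Measurable.pred (borel \<Otimes>\<^sub>M borel) (\<lambda>(c, u). u \<in> B l c k)" for l k
      unfolding B_def mem_Collect_eq by measurable
  next
    fix l :: int and c :: real assume c: "0 < c" "c < 1"
    have low: "B l c k = {}" if "k < l" for k using that by (auto simp: B_def)
    have eq: "B l c l = {0<..<c}" using c by (auto simp: B_def)
    have high: "B l c k = {0<..<1}" if "l < k" for k using that by (auto simp: B_def)
    have "0 < measure unif (B l c k)" if "l \<le> k" for k
    proof (cases "k = l")
      case True
      then show ?thesis using eq c measure_unif_interval[of c] by simp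
    next
      case False
      then have "measure unif (B l c k) = 1"
        using high that measure_unif_interval[of 1] by (metis le_neq_trans order_refl zero_le_one)
      then show ?thesis by simp
    qed
    moreover have "summable (\<lambda>n. 1 - measure unif (B l c (l + int n)))"
    proof (rule summable_finite[of "{0}"])
      fix n :: nat assume "n \<notin> {0}"
      then have "B l c (l + int n) = {0<..<1}" by (intro high) simp
      then show "1 - measure unif (B l c (l + int n)) = 0"
        by (metis diff_self measure_unif_interval order_refl zero_le_one)
    qed simp
    ultimately show "\<exists>k0. (\<forall>k<k0. B l c k = {}) \<and> (\<forall>k\<ge>k0. 0 < measure unif (B l c k)) \<and>
        summable (\<lambda>n. 1 - measure unif (B l c (k0 + int n)))"
      using low by blast
  qed
qed

end

section \<open>Percolation in a fibre\<close>

context rooted_tree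
begin

lemma dep_funpow: "(par ^^ m) v \<noteq> r \<Longrightarrow> dep v = dep ((par ^^ m) v) + m"
proof (induction m)
  case (Suc m)
  then have ne: "(par ^^ m) v \<noteq> r" by auto
  then show ?case using Suc dep_par[OF ne] by simp
qed simp

lemma siblings_disjoint:
  assumes "u \<noteq> r" "u' \<noteq> r" "par u = par u'" "u \<noteq> u'"
  shows "below par u \<inter> below par u' = {}"
proof (rule ccontr)
  assume "\<not> ?thesis"
  then obtain v m n where mn: "(par ^^ m) v = u" "(par ^^ n) v = u'" by (auto simp: below_def)
  have "dep u = dep u'" using dep_par[OF assms(1)] dep_par[OF assms(2)] assms(3) by simp
  then have "m = n" using dep_funpow[of m v] dep_funpow[of n v] mn assms by simp
  then show False using mn assms(4) by simp
qed

lemma below_child_subset: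
  assumes "w \<noteq> r" "par w = u"
  shows "below par w \<subseteq> below par u - {u}"
proof
  fix v assume "v \<in> below par w"
  then obtain n where n: "(par ^^ n) v = w" by (auto simp: below_def)
  then have "(par ^^ Suc n) v = u" using assms by simp
  then have "v \<in> below par u" unfolding below_def by blast
  moreover have "v \<noteq> u"
  proof
    assume "v = u"
    then have "(par ^^ Suc n) w = w" using n assms(2) by (simp add: funpow_swap1)
    then show False using funpow_acyclic[OF assms(1)] by blast
  qed
  ultimately show "v \<in> below par u - {u}" by simp
qed

lemma parent_edge_inj:
  assumes "u \<noteq> r" "v \<noteq> r" "{par u, u} = {par v, v}"
  shows "u = v"
  using assms dep_par[of u] dep_par[of v] by (auto simp: doubleton_eq_iff)

end

text \<open>Multiply by \<open>(1 + y) ^ b\<close>, which is at least \<open>1 + real b * y\<close>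
  by Bernoulli's inequality. This linearises the extinction recursion.\<close>

lemma one_minus_power_le:
  fixes y :: real
  assumes "0 \<le> y" "y \<le> 1"
  shows "(1 - y) ^ b \<le> 1 / (1 + real b * y)"
proof -
  have "(1 - y) ^ b * (1 + real b * y) \<le> (1 - y) ^ b * (1 + y) ^ b"
    using assms Bernoulli_inequality[of y b] by (intro mult_left_mono) auto
  also have "\<dots> = (1 - y\<^sup>2) ^ b"
    by (simp add: power_mult_distrib[symmetric] power2_eq_square algebra_simps)
  also have "\<dots> \<le> 1" using assms by (intro power_le_one) (auto simp: power2_eq_square mult_le_one)
  finally show ?thesis using assms by (simp add: pos_le_divide_eq add_pos_nonneg)
qed

lemma one_minus_inverse_bounds:
  fixes m :: real
  assumes "1 < m"
  shows "0 \<le> 1 - 1 / m" "1 - 1 / m \<le> 1" "0 \<le> 1 - (1 - 1 / m)" "1 - (1 - 1 / m) < 1"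
  using assms by (auto simp: field_simps)

locale bernoulli_gp = gp_product A T d
  for A :: "'a \<Rightarrow> 'a \<Rightarrow> bool" and T :: "'b edges" and d :: nat +
  fixes p :: real
  assumes p: "0 \<le> p" "p \<le> 1"
begin

sublocale iid_product G "measure_pmf (bernoulli_pmf p)"
  by unfold_locales

lemma PM_eq: "bernoulli_percolation G p = PM"
  by (simp add: bernoulli_percolation_def)

lemma pred_label: "Measurable.pred PM (\<lambda>\<omega>. e \<in> open_edges G \<omega>)"
  using pred_coordinate[of e "{True}"] by (cases "e \<in> G") (auto simp: open_edges_def)

lemma pred_label': "e \<in> G \<Longrightarrow> Measurable.pred PM (\<lambda>\<omega>. \<omega> e)"
  using pred_label[of e] by (simp add: open_edges_def)

lemma prb_label: "e \<in> G \<Longrightarrow> prb (\<lambda>\<omega>. \<omega> e) = p"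
  using prb_coordinate[of e "{True}"] p by (simp add: measure_pmf_single)

lemma pred_cluster: "Measurable.pred PM (\<lambda>\<omega>. linked (open_edges G \<omega>) a b)"
  by (rule pred_linked[OF countable_V pred_label])

end

locale fibre_percolation = bernoulli_gp A T d p + R: rooted_tree T d r
  for A :: "'a \<Rightarrow> 'a \<Rightarrow> bool" and T :: "'b edges" and d :: nat and p :: real and r :: 'b
begin

definition vedge :: "'a \<Rightarrow> 'b \<Rightarrow> ('a \<times> 'b) set" where
  "vedge x u = {(x, R.par u), (x, u)}"

text \<open>Survival up to generation \<open>n\<close> of the branching process of open edges
  leading away from the root in the fibre over \<open>x\<close>.\<close>

primrec reach :: "'a \<Rightarrow> nat \<Rightarrow> 'b \<Rightarrow> (('a \<times> 'b) set \<Rightarrow> bool) \<Rightarrow> bool" where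
  "reach x 0 v \<omega> = True"
| "reach x (Suc n) v \<omega> = (\<exists>u\<in>{u. u \<noteq> r \<and> R.par u = v}. \<omega> (vedge x u) \<and> reach x n u \<omega>)"

lemma vedge_in_G: "u \<noteq> r \<Longrightarrow> vedge x u \<in> G"
  using R.par_edge[of u] by (simp add: vedge_def G_iff)

lemma vedge_inj: "u \<noteq> r \<Longrightarrow> v \<noteq> r \<Longrightarrow> vedge x u = vedge x v \<Longrightarrow> u = v"
  by (rule R.parent_edge_inj) (auto simp: vedge_def doubleton_eq_iff)

lemma pred_reach: "Measurable.pred PM (\<lambda>\<omega>. reach x n v \<omega>)"
proof (induction n arbitrary: v)
  case 0
  have "reach x 0 v = (\<lambda>\<omega>. True)" by (rule ext) simp
  then show ?case by simp
next
  case (Suc n)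
  have "Measurable.pred PM (\<lambda>\<omega>. \<exists>u\<in>{u. u \<noteq> r \<and> R.par u = v}. \<omega> (vedge x u) \<and> reach x n u \<omega>)"
    by (intro pred_intros_finite R.finite_children pred_intros_logic pred_label' Suc vedge_in_G) auto
  moreover have "reach x (Suc n) v =
      (\<lambda>\<omega>. \<exists>u\<in>{u. u \<noteq> r \<and> R.par u = v}. \<omega> (vedge x u) \<and> reach x n u \<omega>)"
    by (rule ext) simp
  ultimately show ?case by (simp only:)
qed

text \<open>The edge from \<open>v\<close> to its parent is not consulted, and \<open>r\<close> has
  no parent edge. Omitting \<open>v\<close> gives independence of that edge from the survival below
  it.\<close>

lemma reach_depends: "depends_on (vedge x ` (below R.par v - {v, r})) (\<lambda>\<omega>. reach x n v \<omega>)"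
proof (induction n arbitrary: v)
  case 0
  show ?case by (rule depends_onI) simp
next
  case (Suc n)
  show ?case
  proof (rule depends_onI)
    fix \<omega> \<omega>' :: "('a \<times> 'b) set \<Rightarrow> bool"
    assume eq: "\<And>e. e \<in> vedge x ` (below R.par v - {v, r}) \<Longrightarrow> \<omega> e = \<omega>' e"
    have *: "\<omega> (vedge x u) = \<omega>' (vedge x u) \<and> reach x n u \<omega> = reach x n u \<omega>'"
      if u: "u \<noteq> r" "R.par u = v" for u
    proof
      have sub: "below R.par u \<subseteq> below R.par v - {v}" by (rule R.below_child_subset[OF u])
      then have "u \<in> below R.par v - {v, r}" using u(1) below_self[of u R.par] by blast
      then show "\<omega> (vedge x u) = \<omega>' (vedge x u)" by (intro eq imageI)
      show "reach x n u \<omega> = reach x n u \<omega>'"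
        by (rule depends_onD[OF Suc.IH[of u]], rule eq) (use sub in blast)
    qed
    show "reach x (Suc n) v \<omega> = reach x (Suc n) v \<omega>'"
      unfolding reach.simps by (rule bex_cong[OF refl]) (use * in blast)
  qed
qed

lemma pred_reach_via: "u \<noteq> r \<Longrightarrow> Measurable.pred PM (\<lambda>\<omega>. \<omega> (vedge x u) \<and> reach x n u \<omega>)"
  by (intro pred_intros_logic pred_label' pred_reach vedge_in_G)

lemma reach_via_depends:
  assumes "u \<noteq> r"
  shows "depends_on (vedge x ` below R.par u) (\<lambda>\<omega>. \<omega> (vedge x u) \<and> reach x n u \<omega>)"
proof (rule depends_onI)
  fix \<omega> \<omega>' :: "('a \<times> 'b) set \<Rightarrow> bool"
  assume eq: "\<And>e. e \<in> vedge x ` below R.par u \<Longrightarrow> \<omega> e = \<omega>' e"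
  have "\<omega> (vedge x u) = \<omega>' (vedge x u)" by (intro eq imageI below_self)
  moreover have "reach x n u \<omega> = reach x n u \<omega>'"
    by (rule depends_onD[OF reach_depends[of x u n]], rule eq) blast
  ultimately show "(\<omega> (vedge x u) \<and> reach x n u \<omega>) = (\<omega>' (vedge x u) \<and> reach x n u \<omega>')" by simp
qed

lemma vedges_in_G: "u \<noteq> r \<Longrightarrow> vedge x ` below R.par u \<subseteq> G"
  using R.root_not_below[of u] by (intro image_subsetI vedge_in_G) auto

lemma prb_reach_via:
  assumes "u \<noteq> r"
  shows "prb (\<lambda>\<omega>. \<omega> (vedge x u) \<and> reach x n u \<omega>) = p * prb (\<lambda>\<omega>. reach x n u \<omega>)"
proof -
  have "prb (\<lambda>\<omega>. \<omega> (vedge x u) \<and> reach x n u \<omega>) = prb (\<lambda>\<omega>. \<omega> (vedge x u)) * prb (\<lambda>\<omega>. reach x n u \<omega>)"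
  proof (rule indep_pred[OF pred_label' _ _ pred_reach reach_depends])
    show "depends_on {vedge x u} (\<lambda>\<omega>. \<omega> (vedge x u))" by (rule depends_onI) blast
    show "vedge x ` (below R.par u - {u, r}) \<subseteq> G" by (intro image_subsetI vedge_in_G) simp
    show "{vedge x u} \<inter> vedge x ` (below R.par u - {u, r}) = {}"
      using vedge_inj[OF assms] by auto
  qed (use vedge_in_G[OF assms] in auto)
  then show ?thesis using prb_label vedge_in_G[OF assms] by simp
qed

text \<open>Subtrees of different children have disjoint edges, so the attempts through the children
  are independent.\<close>

lemma prb_no_child:
  assumes "finite F" "F \<subseteq> {u. u \<noteq> r \<and> R.par u = v}" "0 \<le> c" "c \<le> 1"
    and c: "\<And>u. u \<noteq> r \<Longrightarrow> c \<le> prb (\<lambda>\<omega>. reach x n u \<omega>)"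
  shows "prb (\<lambda>\<omega>. \<forall>u\<in>F. \<not> (\<omega> (vedge x u) \<and> reach x n u \<omega>)) \<le> (1 - p * c) ^ card F"
  using assms(1,2)
proof (induction F rule: finite_induct)
  case empty
  show ?case by simp
next
  case (insert u F)
  let ?via = "\<lambda>u \<omega>. \<omega> (vedge x u) \<and> reach x n u \<omega>"
  have u: "u \<noteq> r" "R.par u = v" and F: "\<And>y. y \<in> F \<Longrightarrow> y \<noteq> r \<and> R.par y = v \<and> y \<noteq> u"
    using insert.prems insert.hyps by auto
  have "prb (\<lambda>\<omega>. \<not> ?via u \<omega> \<and> (\<forall>y\<in>F. \<not> ?via y \<omega>)) =
      prb (\<lambda>\<omega>. \<not> ?via u \<omega>) * prb (\<lambda>\<omega>. \<forall>y\<in>F. \<not> ?via y \<omega>)"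
  proof (rule indep_pred)
    show "Measurable.pred PM (\<lambda>\<omega>. \<not> ?via u \<omega>)"
      using pred_reach_via[OF u(1)] by (rule pred_intros_logic)
    show "Measurable.pred PM (\<lambda>\<omega>. \<forall>y\<in>F. \<not> ?via y \<omega>)"
      using F by (intro pred_intros_finite insert.hyps pred_intros_logic(2) pred_reach_via) auto
    show "depends_on (vedge x ` below R.par u) (\<lambda>\<omega>. \<not> ?via u \<omega>)"
      by (rule depends_on_not, rule reach_via_depends[OF u(1)])
    show "depends_on (\<Union>y\<in>F. vedge x ` below R.par y) (\<lambda>\<omega>. \<forall>y\<in>F. \<not> ?via y \<omega>)"
    proof (rule depends_onI)
      fix \<omega> \<omega>' :: "('a \<times> 'b) set \<Rightarrow> bool"
      assume eq: "\<And>e. e \<in> (\<Union>y\<in>F. vedge x ` below R.par y) \<Longrightarrow> \<omega> e = \<omega>' e"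
      have "?via y \<omega> = ?via y \<omega>'" if "y \<in> F" for y
      proof (rule depends_onD[OF reach_via_depends[where x = x and n = n and u = y]])
        show "y \<noteq> r" using F[OF that] by blast
        show "\<omega> e = \<omega>' e" if "e \<in> vedge x ` below R.par y" for e
          by (rule eq, rule UN_I[where a = y]) (use \<open>y \<in> F\<close> that in simp_all)
      qed
      then show "(\<forall>y\<in>F. \<not> ?via y \<omega>) = (\<forall>y\<in>F. \<not> ?via y \<omega>')" by blast
    qed
    show "vedge x ` below R.par u \<subseteq> G" by (rule vedges_in_G[OF u(1)])
    show "(\<Union>y\<in>F. vedge x ` below R.par y) \<subseteq> G" by (intro UN_least vedges_in_G) (use F in blast)
    show "vedge x ` below R.par u \<inter> (\<Union>y\<in>F. vedge x ` below R.par y) = {}"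
    proof (rule ccontr)
      assume "\<not> ?thesis"
      then obtain y a b where y: "y \<in> F" "a \<in> below R.par u" "b \<in> below R.par y" "vedge x a = vedge x b"
        by blast
      have yr: "y \<noteq> r" "R.par y = v" "y \<noteq> u" using F[OF y(1)] by auto
      have "a \<noteq> r" "b \<noteq> r" using R.root_not_below[OF u(1)] R.root_not_below[OF yr(1)] y(2,3) by auto
      from vedge_inj[OF this y(4)] have "a = b" .
      then show False using R.siblings_disjoint[OF u(1) yr(1) _ yr(3)[symmetric]] u(2) yr(2) y(2,3) by auto
    qed
  qed
  also have "prb (\<lambda>\<omega>. \<not> ?via u \<omega>) = 1 - p * prb (\<lambda>\<omega>. reach x n u \<omega>)"
    using prb_not[OF pred_reach_via[OF u(1)]] prb_reach_via[OF u(1)] by simp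
  also have "(1 - p * prb (\<lambda>\<omega>. reach x n u \<omega>)) * prb (\<lambda>\<omega>. \<forall>y\<in>F. \<not> ?via y \<omega>)
      \<le> (1 - p * c) * (1 - p * c) ^ card F"
    using insert.IH insert.prems c[OF u(1)] p assms(3,4)
    by (intro mult_mono) (auto intro: mult_left_mono simp: mult_le_one)
  finally show ?case using insert.hyps by simp
qed

text \<open>With M = d - 1, the constant c = 1 - 1 / (M p) satisfies 1 + M p c = M p. So
  \<open>one_minus_power_le\<close> bounds the extinction probability by 1 / (M p) = 1 - c, and the
  induction reproduces c.\<close>

lemma reach_bound:
  assumes "1 < real (d - 1) * p"
  shows "1 - 1 / (real (d - 1) * p) \<le> prb (\<lambda>\<omega>. reach x n v \<omega>)"
proof (induction n arbitrary: v)
  case 0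
  have one: "prb (\<lambda>\<omega>. reach x 0 v \<omega>) = 1" by (simp add: P.prob_space)
  show ?case unfolding one by (rule one_minus_inverse_bounds[OF assms])
next
  case (Suc n)
  let ?c = "1 - 1 / (real (d - 1) * p)"
  let ?F = "{u. u \<noteq> r \<and> R.par u = v}"
  have c: "0 \<le> ?c" "?c \<le> 1" by (rule one_minus_inverse_bounds[OF assms])+
  have pc: "0 \<le> p * ?c" "p * ?c \<le> 1" using p c by (auto intro: mult_le_one)
  have "prb (\<lambda>\<omega>. \<not> reach x (Suc n) v \<omega>) = prb (\<lambda>\<omega>. \<forall>u\<in>?F. \<not> (\<omega> (vedge x u) \<and> reach x n u \<omega>))"
    by (rule arg_cong[where f = "measure PM"]) auto
  also have "\<dots> \<le> (1 - p * ?c) ^ card ?F"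
    by (rule prb_no_child[OF R.finite_children order_refl c Suc.IH])
  also have "\<dots> \<le> (1 - p * ?c) ^ (d - 1)"
    using R.card_children[of v] pc by (intro power_decreasing) auto
  also have "\<dots> \<le> 1 / (1 + real (d - 1) * (p * ?c))"
    by (rule one_minus_power_le[OF pc])
  also have "1 + real (d - 1) * (p * ?c) = real (d - 1) * p"
  proof -
    have "1 + M * (p * (1 - 1 / (M * p))) = M * p" if "1 < M * p" for M :: real
    proof -
      have "M \<noteq> 0" "p \<noteq> 0" using that by auto
      then show ?thesis by (simp add: field_simps)
    qed
    then show ?thesis using assms by blast
  qed
  finally show ?case using prb_not[OF pred_reach[of x "Suc n" v]] by simp
qed

lemma reach_decreasing: "reach x (Suc n) v \<omega> \<Longrightarrow> reach x n v \<omega>"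
proof (induction n arbitrary: v)
  case (Suc n)
  from Suc.prems obtain u where "u \<noteq> r" "R.par u = v" "\<omega> (vedge x u)" "reach x (Suc n) u \<omega>"
    unfolding reach.simps(2)[of x "Suc n"] by blast
  then show ?case using Suc.IH[of u] by auto
qed simp

definition survives :: "'a \<Rightarrow> (('a \<times> 'b) set \<Rightarrow> bool) \<Rightarrow> bool" where
  "survives x \<omega> \<longleftrightarrow> (\<forall>n. reach x n r \<omega>)"

lemma pred_survives: "Measurable.pred PM (\<lambda>\<omega>. survives x \<omega>)"
  unfolding survives_def by (intro pred_intros_countable pred_reach)

lemma survives_bound:
  assumes "1 < real (d - 1) * p"
  shows "1 - 1 / (real (d - 1) * p) \<le> prb (\<lambda>\<omega>. survives x \<omega>)"
proof -
  let ?A = "\<lambda>n. {\<omega>\<in>space PM. reach x n r \<omega>}"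
  have "decseq ?A" unfolding decseq_Suc_iff using reach_decreasing by blast
  moreover have "range ?A \<subseteq> sets PM" using pred_reach by (auto simp: pred_def)
  ultimately have "(\<lambda>n. measure PM (?A n)) \<longlonglongrightarrow> measure PM (\<Inter>n. ?A n)"
    by (intro P.finite_Lim_measure_decseq)
  then have "1 - 1 / (real (d - 1) * p) \<le> measure PM (\<Inter>n. ?A n)"
    by (rule LIMSEQ_le_const) (use reach_bound[OF assms] in blast)
  also have "(\<Inter>n. ?A n) = {\<omega>\<in>space PM. survives x \<omega>}" by (auto simp: survives_def)
  finally show ?thesis .
qed

definition fibre_edges :: "'a \<Rightarrow> ('a \<times> 'b) edges" where
  "fibre_edges x = vedge x ` (- {r})"

lemma fibre_edges_in_G: "fibre_edges x \<subseteq> G"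
  unfolding fibre_edges_def using vedge_in_G by auto

lemma survives_depends: "depends_on (fibre_edges x) (\<lambda>\<omega>. survives x \<omega>)"
proof (rule depends_onI)
  fix \<omega> \<omega>' :: "('a \<times> 'b) set \<Rightarrow> bool"
  assume eq: "\<And>e. e \<in> fibre_edges x \<Longrightarrow> \<omega> e = \<omega>' e"
  have "reach x n r \<omega> = reach x n r \<omega>'" for n
    by (rule depends_onD[OF reach_depends[of x r n]], rule eq) (auto simp: fibre_edges_def)
  then show "survives x \<omega> = survives x \<omega>'" by (simp add: survives_def)
qed

lemma fibre_edges_disjoint: "x \<noteq> y \<Longrightarrow> fibre_edges x \<inter> fibre_edges y = {}"
  by (auto simp: fibre_edges_def vedge_def doubleton_eq_iff)

text \<open>Fibres over the ancestors of \<open>x0\<close> have disjoint edges: infinitely many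
  independent trials, which spares a zero-one law.\<close>

lemma AE_some_fibre_survives:
  assumes big: "1 < real (d - 1) * p"
  shows "AE \<omega> in PM. \<exists>x. survives x \<omega>"
proof -
  fix x0 :: 'a
  define f where "f = (\<lambda>i. (up ^^ i) x0)"
  have f: "f i = f j \<longleftrightarrow> i = j" for i j by (simp add: f_def funpow_up_inj)
  let ?c = "1 - 1 / (real (d - 1) * p)"
  let ?P = "\<lambda>k \<omega>. \<forall>i\<in>{..<k}. \<not> survives (f i) \<omega>"
  have c: "0 \<le> 1 - ?c" "1 - ?c < 1" by (rule one_minus_inverse_bounds[OF big])+
  have meas: "Measurable.pred PM (\<lambda>\<omega>. ?P k \<omega>)" for k
    by (intro pred_intros_finite pred_intros_logic(2) pred_survives) auto
  have bound: "prb (?P k) \<le> (1 - ?c) ^ k" for k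
  proof (induction k)
    case 0
    show ?case by simp
  next
    case (Suc k)
    have "prb (?P (Suc k)) = prb (\<lambda>\<omega>. \<not> survives (f k) \<omega> \<and> ?P k \<omega>)"
      by (rule arg_cong[where f = "measure PM"]) (auto simp: less_Suc_eq)
    also have "\<dots> = prb (\<lambda>\<omega>. \<not> survives (f k) \<omega>) * prb (?P k)"
    proof (rule indep_pred[OF _ _ fibre_edges_in_G meas])
      show "Measurable.pred PM (\<lambda>\<omega>. \<not> survives (f k) \<omega>)"
        using pred_survives by (rule pred_intros_logic)
      show "depends_on (fibre_edges (f k)) (\<lambda>\<omega>. \<not> survives (f k) \<omega>)"
        by (rule depends_on_not, rule survives_depends)
      show "depends_on (\<Union>i<k. fibre_edges (f i)) (\<lambda>\<omega>. ?P k \<omega>)"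
      proof (rule depends_onI)
        fix \<omega> \<omega>' :: "('a \<times> 'b) set \<Rightarrow> bool"
        assume eq: "\<And>e. e \<in> (\<Union>i<k. fibre_edges (f i)) \<Longrightarrow> \<omega> e = \<omega>' e"
        have "survives (f i) \<omega> = survives (f i) \<omega>'" if "i < k" for i
          by (rule depends_onD[OF survives_depends], rule eq, rule UN_I[where a = i]) (use that in simp_all)
        then show "?P k \<omega> = ?P k \<omega>'" by blast
      qed
      show "(\<Union>i<k. fibre_edges (f i)) \<subseteq> G" using fibre_edges_in_G by blast
      show "fibre_edges (f k) \<inter> (\<Union>i<k. fibre_edges (f i)) = {}"
        using fibre_edges_disjoint[of "f k" "f _"] f by (auto simp: disjoint_iff)
    qed
    also have "\<dots> \<le> (1 - ?c) * (1 - ?c) ^ k"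
      using Suc prb_not[OF pred_survives[of "f k"]] survives_bound[OF big, of "f k"] c(1)
      by (intro mult_mono) auto
    finally show ?case by simp
  qed
  have "AE \<omega> in PM. \<not> (\<forall>i. \<not> survives (f i) \<omega>)"
  proof (rule AE_not_if_small[OF _ c, where C = 1])
    show "Measurable.pred PM (\<lambda>\<omega>. \<forall>i. \<not> survives (f i) \<omega>)"
      by (intro pred_intros_countable pred_intros_logic(2) pred_survives)
    fix k
    have "prb (\<lambda>\<omega>. \<forall>i. \<not> survives (f i) \<omega>) \<le> prb (?P k)"
      by (rule prb_mono[OF meas]) auto
    then show "prb (\<lambda>\<omega>. \<forall>i. \<not> survives (f i) \<omega>) \<le> 1 * (1 - ?c) ^ k" using bound[of k] by simp
  qed
  then show ?thesis by eventually_elim blast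
qed

lemma reach_descendant:
  "reach x n v \<omega> \<Longrightarrow> \<exists>u. R.dep u = R.dep v + n \<and> linked (open_edges G \<omega>) (x, v) (x, u)"
proof (induction n arbitrary: v)
  case 0
  show ?case by (intro exI[of _ v]) simp
next
  case (Suc n)
  then obtain c where c: "c \<noteq> r" "R.par c = v" "\<omega> (vedge x c)" "reach x n c \<omega>" by auto
  obtain u where u: "R.dep u = R.dep c + n" "linked (open_edges G \<omega>) (x, c) (x, u)"
    using Suc.IH[OF c(4)] by blast
  have "{(x, v), (x, c)} \<in> open_edges G \<omega>"
    using c vedge_in_G[OF c(1), of x] by (simp add: open_edges_def vedge_def)
  then have "linked (open_edges G \<omega>) (x, v) (x, u)" by (rule linked_trans[OF linked_edge u(2)])
  moreover have "R.dep u = R.dep v + Suc n" using u(1) R.dep_par[OF c(1)] c(2) by simp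
  ultimately show ?case by blast
qed

text \<open>The cluster has infinitely many vertices in one fibre, all of the same positive
  weight.\<close>

lemma survives_heavy:
  assumes "survives x \<omega>"
  shows "\<exists>C\<in>clusters (open_edges G \<omega>). heavy (rel_weight (Aut G) z) C"
proof -
  let ?w = "rel_weight (Aut G) z"
  let ?C = "{u. linked (open_edges G \<omega>) (x, r) u}"
  let ?X = "?C \<inter> {x} \<times> UNIV"
  have inf: "infinite ?X"
  proof
    assume "finite ?X"
    then have "finite ((\<lambda>u. R.dep (snd u)) ` ?X)" by simp
    moreover have "n \<in> (\<lambda>u. R.dep (snd u)) ` ?X" for n
    proof -
      obtain u where "R.dep u = n" "linked (open_edges G \<omega>) (x, r) (x, u)"
        using reach_descendant[of x n r \<omega>] assms by (auto simp: survives_def)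
      then show ?thesis by (intro image_eqI[of _ _ "(x, u)"]) auto
    qed
    then have "(\<lambda>u. R.dep (snd u)) ` ?X = UNIV" by blast
    ultimately show False by simp
  qed
  have "(\<Sum>\<^sub>\<infinity>v\<in>?X. ennreal (?w v)) = \<infinity>"
  proof (rule infsum_superconst_infinite_ennreal[OF _ _ inf])
    show "ennreal (?w (x, r)) \<le> ennreal (?w v)" if "v \<in> ?X" for v
    proof -
      have "v = (x, snd v)" using that by auto
      then show ?thesis using weight_fibre[of z x r "snd v"] by (metis order_refl)
    qed
    show "0 < ennreal (?w (x, r))" using weight_pos by simp
  qed
  moreover have "(\<Sum>\<^sub>\<infinity>v\<in>?X. ennreal (?w v)) \<le> (\<Sum>\<^sub>\<infinity>v\<in>?C. ennreal (?w v))"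
    by (rule infsum_mono_neutral) (auto intro: nonneg_summable_on_complete)
  ultimately have "heavy ?w ?C" by (simp add: heavy_def top_unique)
  moreover have "?C \<in> clusters (open_edges G \<omega>)" by (auto simp: clusters_def)
  ultimately show ?thesis by blast
qed

lemma p_h_le:
  assumes "1 < real (d - 1) * p"
  shows "p_h G (rel_weight (Aut G) z) \<le> p"
  unfolding p_h_def
proof (rule cInf_lower)
  have "AE \<omega> in bernoulli_percolation G p. \<exists>C\<in>clusters (open_edges G \<omega>). heavy (rel_weight (Aut G) z) C"
    unfolding PM_eq using AE_some_fibre_survives[OF assms] by eventually_elim (use survives_heavy in blast)
  then show "p \<in> {p \<in> {0..1}. AE \<omega> in bernoulli_percolation G p.
      \<exists>C\<in>clusters (open_edges G \<omega>). heavy (rel_weight (Aut G) z) C}"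
    using p by simp
  show "bdd_below {p \<in> {0..1}. AE \<omega> in bernoulli_percolation G p.
      \<exists>C\<in>clusters (open_edges G \<omega>). heavy (rel_weight (Aut G) z) C}"
    by (rule bdd_belowI[of _ 0]) auto
qed

end

section \<open>Counting walks\<close>

lemma gdist_commute:
  assumes "linked E u v"
  shows "gdist E u v = gdist E v u"
proof -
  have rev: "((\<lambda>a b. {a, b} \<in> E) ^^ n) v u" if "((\<lambda>a b. {a, b} \<in> E) ^^ n) u v" for n u v
    using that
  proof (induction n arbitrary: v)
    case (Suc n)
    then obtain y where "((\<lambda>a b. {a, b} \<in> E) ^^ n) u y" "{y, v} \<in> E" by (auto elim: relpowp_Suc_E)
    then show ?case using Suc.IH by (intro relpowp_Suc_I2[of _ v y]) (auto simp: insert_commute)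
  qed auto
  show ?thesis
    using gdist_le[OF rev[OF gdist_walk[OF assms]]] gdist_le[OF rev[OF gdist_walk[OF linked_sym[OF assms]]]]
    by simp
qed

fun path_edges :: "'v list \<Rightarrow> 'v edges" where
  "path_edges (u # v # vs) = insert {u, v} (path_edges (v # vs))"
| "path_edges vs = {}"

lemma path_edges_vertices: "e \<in> path_edges vs \<Longrightarrow> e \<subseteq> set vs"
  by (induction vs rule: path_edges.induct) auto

lemma finite_path_edges: "finite (path_edges vs)"
  by (induction vs rule: path_edges.induct) auto

lemma card_path_edges: "distinct vs \<Longrightarrow> card (path_edges vs) = length vs - 1"
proof (induction vs rule: path_edges.induct)
  case (1 u v vs)
  then have "{u, v} \<notin> path_edges (v # vs)" using path_edges_vertices by fastforce
  then show ?case using 1 by (simp add: finite_path_edges)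
qed auto

lemma successively_path_edges: "successively (\<lambda>a b. {a, b} \<in> S) vs \<longleftrightarrow> path_edges vs \<subseteq> S"
  by (induction vs rule: path_edges.induct) auto

context gp_product
begin

text \<open>Built from the starting point, so that induction on the length sums over the first step,
  as \<open>tree_supersolution\<close> does.\<close>

primrec walks :: "'b \<Rightarrow> nat \<Rightarrow> 'a \<times> 'b \<Rightarrow> ('a \<times> 'b) list set" where
  "walks r 0 a = (if snd a = r then {[a]} else {})"
| "walks r (Suc n) a = (\<Union>b\<in>neighbours G a. (#) a ` walks r n b)"

lemma finite_walks: "finite (walks r n a)"
  by (induction n arbitrary: a) (auto simp: finite_neighbours_G)

lemma walks_path_edges: "vs \<in> walks r n a \<Longrightarrow> path_edges vs \<subseteq> G \<and> length vs = Suc n \<and> vs \<noteq> [] \<and> hd vs = a"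
proof (induction n arbitrary: a vs)
  case (Suc n)
  then obtain b ws where b: "b \<in> neighbours G a" "ws \<in> walks r n b" "vs = a # ws" by auto
  from Suc.IH[OF b(2)] show ?case using b by (cases ws) (auto simp: neighbours_def)
qed (auto split: if_splits)

lemma path_in_walks:
  "vs \<noteq> [] \<Longrightarrow> path_edges vs \<subseteq> G \<Longrightarrow> snd (last vs) = r \<Longrightarrow> vs \<in> walks r (length vs - 1) (hd vs)"
proof (induction vs rule: path_edges.induct)
  case (1 u v vs)
  then have "v # vs \<in> walks r (length vs) v" by simp
  moreover have "v \<in> neighbours G u" using 1 by (simp add: neighbours_def)
  ultimately show ?case by auto
qed auto

definition lam :: real where "lam = 2 * sqrt (real d - 1)"

definition rho :: real where "rho = 1 / sqrt (real d - 1)"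

lemma rho_pos: "0 < rho"
  unfolding rho_def using d2 by simp

text \<open>The decay rate \<open>rho\<close> makes \<open>rho ^ dep\<close> an eigenfunction of the tree adjacency operator, away
  from the root, at the edge \<open>lam\<close> of its spectrum.\<close>

lemma tree_supersolution: "(\<Sum>s\<in>neighbours T t. rho ^ gdist T r s) \<le> lam * rho ^ gdist T r t"
proof -
  interpret R: rooted_tree T d r by (rule rooted)
  define q where "q = sqrt (real d - 1)"
  have q: "0 < q" "q * q = real d - 1" using d2 by (auto simp: q_def)
  have rho: "rho = 1 / q" and lam: "lam = 2 * q" by (auto simp: rho_def lam_def q_def)
  have child: "(\<Sum>s\<in>{x. x \<noteq> r \<and> R.par x = t}. rho ^ R.dep s) =
      real (card {x. x \<noteq> r \<and> R.par x = t}) * (rho * rho ^ R.dep t)"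
  proof -
    have "(\<Sum>s\<in>{x. x \<noteq> r \<and> R.par x = t}. rho ^ R.dep s) = (\<Sum>s\<in>{x. x \<noteq> r \<and> R.par x = t}. rho * rho ^ R.dep t)"
      using R.dep_par by (intro sum.cong refl) auto
    then show ?thesis by simp
  qed
  show ?thesis
  proof (cases "t = r")
    case True
    \<comment> \<open>At the root all \<open>d\<close> neighbours are farther away; the bound uses
      \<open>1 \<le> q * q\<close>, that is, \<open>2 \<le> d\<close>.\<close>
    have "(\<Sum>s\<in>neighbours T t. rho ^ R.dep s) = real d * rho"
      using child True R.card_children_root by (simp add: R.neighbours_root)
    also have "\<dots> = (q * q + 1) / q" using q by (simp add: rho)
    also have "\<dots> \<le> (q * q + q * q) / q"
      using d2 q by (intro divide_right_mono) auto
    also have "\<dots> = lam" using q(1) by (simp add: lam add_divide_distrib)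
    finally show ?thesis using True by simp
  next
    case False
    have eq: "{x. R.par x = t} = {x. x \<noteq> r \<and> R.par x = t}" using False by auto
    have card: "real (card {x. x \<noteq> r \<and> R.par x = t}) = q * q"
      using R.children_nonroot[OF False] eq q d2 by simp
    have notin: "R.par t \<notin> {x. x \<noteq> r \<and> R.par x = t}"
    proof
      assume "R.par t \<in> {x. x \<noteq> r \<and> R.par x = t}"
      then show False using R.dep_par[OF False] R.dep_par[of "R.par t"] by simp
    qed
    have "(\<Sum>s\<in>neighbours T t. rho ^ R.dep s) = rho ^ R.dep (R.par t) + q * q * (rho * rho ^ R.dep t)"
      unfolding R.neighbours_nonroot[OF False] using child card notin R.finite_children by simp
    also have "rho ^ R.dep (R.par t) = q * rho ^ R.dep t"
      using R.dep_par[OF False] q by (simp add: rho)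
    also have "q * rho ^ R.dep t + q * q * (rho * rho ^ R.dep t) = lam * rho ^ R.dep t"
    proof -
      have "q * q * rho = q" using q(1) by (simp add: rho)
      then have "q * q * (rho * rho ^ R.dep t) = q * rho ^ R.dep t" by (simp only: mult.assoc[symmetric])
      then show ?thesis by (simp add: lam)
    qed
    finally show ?thesis by simp
  qed
qed

lemma lam_nonneg: "0 \<le> lam"
  unfolding lam_def using d2 by simp

text \<open>A step in the grandparent graph keeps the tree coordinate and has at most 8 choices; the
  tree steps contribute at most \<open>lam\<close>. Each step thus costs a factor of at most
  \<open>8 + lam\<close>.\<close>

lemma card_walks: "real (card (walks r n a)) \<le> (8 + lam) ^ n * rho ^ gdist T r (snd a)"
proof (induction n arbitrary: a)
  case 0
  then show ?case using rho_pos by (simp add: less_imp_le)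
next
  case (Suc n)
  obtain x t where a: "a = (x, t)" by (cases a)
  let ?F = "\<lambda>b. rho ^ gdist T r (snd b)"
  have disj: "(\<lambda>y. (y, t)) ` neighbours gp x \<inter> Pair x ` neighbours T t = {}"
    by (auto simp: neighbours_def)
  have "card (walks r (Suc n) a) \<le> (\<Sum>b\<in>neighbours G a. card ((#) a ` walks r n b))"
    unfolding walks.simps by (rule card_UN_le[OF finite_neighbours_G])
  also have "\<dots> = (\<Sum>b\<in>neighbours G a. card (walks r n b))"
    by (intro sum.cong card_image) auto
  finally have "real (card (walks r (Suc n) a)) \<le> (\<Sum>b\<in>neighbours G a. real (card (walks r n b)))"
    by (metis of_nat_le_iff of_nat_sum)
  also have "\<dots> \<le> (\<Sum>b\<in>neighbours G a. (8 + lam) ^ n * ?F b)"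
    by (intro sum_mono Suc.IH)
  also have "\<dots> = (8 + lam) ^ n * (\<Sum>b\<in>neighbours G a. ?F b)" by (simp add: sum_distrib_left)
  also have "\<dots> \<le> (8 + lam) ^ n * ((8 + lam) * ?F a)"
  proof (intro mult_left_mono)
    have "(\<Sum>b\<in>neighbours G a. ?F b) = (\<Sum>b\<in>(\<lambda>y. (y, t)) ` neighbours gp x. ?F b) + (\<Sum>b\<in>Pair x ` neighbours T t. ?F b)"
      unfolding a neighbours_G
      by (rule sum.union_disjoint[OF _ _ disj]) (auto simp: finite_gp_neighbours finite_neighbours_T)
    also have "(\<Sum>b\<in>(\<lambda>y. (y, t)) ` neighbours gp x. ?F b) = real (card (neighbours gp x)) * ?F a"
      by (subst sum.reindex) (auto simp: inj_on_def a)
    also have "(\<Sum>b\<in>Pair x ` neighbours T t. ?F b) = (\<Sum>s\<in>neighbours T t. rho ^ gdist T r s)"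
      by (subst sum.reindex) (auto simp: inj_on_def)
    also have "real (card (neighbours gp x)) * ?F a + (\<Sum>s\<in>neighbours T t. rho ^ gdist T r s) \<le> 8 * ?F a + lam * ?F a"
      using card_gp_neighbours[of x] tree_supersolution[where t = t and r = r] rho_pos
      by (intro add_mono mult_right_mono) (auto simp: a)
    finally show "(\<Sum>b\<in>neighbours G a. ?F b) \<le> (8 + lam) * ?F a" by (simp add: distrib_right)
  qed (use lam_nonneg in simp)
  finally show ?case by (simp add: ac_simps)
qed

end

context bernoulli_gp
begin

lemma prb_path_open:
  assumes "distinct vs" "path_edges vs \<subseteq> G"
  shows "prb (\<lambda>\<omega>. path_edges vs \<subseteq> open_edges G \<omega>) = p ^ (length vs - 1)"
proof -
  have "prb (\<lambda>\<omega>. \<forall>e\<in>path_edges vs. \<omega> e \<in> {True}) = (\<Prod>e\<in>path_edges vs. p)"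
    using prb_coordinates[OF finite_path_edges assms(2), of "\<lambda>_. {True}"] p
    by (simp add: measure_pmf_single)
  moreover have "path_edges vs \<subseteq> open_edges G \<omega> \<longleftrightarrow> (\<forall>e\<in>path_edges vs. \<omega> e \<in> {True})" for \<omega>
    using assms(2) by (auto simp: open_edges_def)
  ultimately show ?thesis by (simp add: card_path_edges[OF assms(1)])
qed

lemma pred_path_open: "Measurable.pred PM (\<lambda>\<omega>. path_edges vs \<subseteq> open_edges G \<omega>)"
proof -
  have "Measurable.pred PM (\<lambda>\<omega>. \<forall>e\<in>path_edges vs. e \<in> open_edges G \<omega>)"
    by (intro pred_intros_finite finite_path_edges pred_label)
  then show ?thesis by (simp add: subset_eq)
qed

lemma pred_reaches_fibre: "Measurable.pred PM (\<lambda>\<omega>. \<exists>z. snd z = r \<and> linked (open_edges G \<omega>) a z)"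
  by (intro pred_ex_countable[OF countable_V] pred_intros_logic pred_cluster) auto

text \<open>Union bound over simple paths ending in the fibre: a simple path with \<open>n\<close>
  edges is open with probability \<open>p ^ n\<close>, and the bound of \<open>card_walks\<close>
  leaves a geometric series.\<close>

lemma prb_reaches_fibre:
  assumes "p * (8 + lam) < 1"
  shows "prb (\<lambda>\<omega>. \<exists>z. snd z = r \<and> linked (open_edges G \<omega>) a z)
    \<le> rho ^ gdist T r (snd a) / (1 - p * (8 + lam))"
proof -
  let ?q = "p * (8 + lam)" and ?\<rho> = "rho ^ gdist T r (snd a)"
  let ?W = "\<lambda>n. {vs \<in> walks r n a. distinct vs}"
  let ?O = "\<lambda>vs. {\<omega>\<in>space PM. path_edges vs \<subseteq> open_edges G \<omega>}"
  let ?A = "\<lambda>n. \<Union>vs\<in>?W n. ?O vs"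
  have q: "0 \<le> ?q" using p lam_nonneg by simp
  have O: "?O vs \<in> sets PM" for vs using pred_path_open by (simp add: pred_def)
  have finW: "finite (?W n)" for n using finite_walks by simp
  have A: "?A n \<in> sets PM" for n using O finW by (intro sets.finite_UN) auto
  have bound: "measure PM (?A n) \<le> ?q ^ n * ?\<rho>" for n
  proof -
    have "measure PM (?A n) \<le> (\<Sum>vs\<in>?W n. measure PM (?O vs))"
      using O finW by (intro P.finite_measure_subadditive_finite) auto
    also have "\<dots> = (\<Sum>vs\<in>?W n. p ^ n)"
      using prb_path_open walks_path_edges by (intro sum.cong refl) fastforce
    also have "\<dots> \<le> real (card (walks r n a)) * p ^ n"
    proof -
      have "real (card (?W n)) \<le> real (card (walks r n a))"
        by (intro of_nat_mono card_mono finite_walks) blast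
      then show ?thesis using p by (simp add: mult_right_mono)
    qed
    also have "\<dots> \<le> ((8 + lam) ^ n * ?\<rho>) * p ^ n"
      using p by (intro mult_right_mono card_walks) auto
    finally show ?thesis by (simp add: power_mult_distrib ac_simps)
  qed
  have summ: "summable (\<lambda>n. ?q ^ n * ?\<rho>)"
    using assms q by (intro summable_mult2 summable_geometric) auto
  have summA: "summable (\<lambda>n. measure PM (?A n))"
    by (rule summable_comparison_test'[OF summ]) (use bound in auto)
  have "prb (\<lambda>\<omega>. \<exists>z. snd z = r \<and> linked (open_edges G \<omega>) a z) \<le> measure PM (\<Union>n. ?A n)"
  proof (rule P.finite_measure_mono)
    show "{\<omega>\<in>space PM. \<exists>z. snd z = r \<and> linked (open_edges G \<omega>) a z} \<subseteq> (\<Union>n. ?A n)"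
    proof
      fix \<omega> assume "\<omega> \<in> {\<omega>\<in>space PM. \<exists>z. snd z = r \<and> linked (open_edges G \<omega>) a z}"
      then obtain z where z: "\<omega> \<in> space PM" "snd z = r" "linked (open_edges G \<omega>) a z" by blast
      obtain vs where vs: "vs \<noteq> []" "hd vs = a" "last vs = z" "distinct vs"
        "successively (\<lambda>a b. {a, b} \<in> open_edges G \<omega>) vs"
        using linked_imp_simple_path[OF z(3)] .
      have sub: "path_edges vs \<subseteq> open_edges G \<omega>" using vs(5) by (simp add: successively_path_edges)
      then have "path_edges vs \<subseteq> G" by (auto simp: open_edges_def)
      then have "vs \<in> walks r (length vs - 1) a" using path_in_walks[OF vs(1)] vs z(2) by auto
      then have "\<omega> \<in> ?A (length vs - 1)" using vs(4) z(1) sub by blast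
      then show "\<omega> \<in> (\<Union>n. ?A n)" by blast
    qed
    show "(\<Union>n. ?A n) \<in> sets PM" using A by blast
  qed
  also have "\<dots> \<le> (\<Sum>n. measure PM (?A n))"
    using A summA by (intro P.finite_measure_subadditive_countably) auto
  also have "\<dots> \<le> (\<Sum>n. ?q ^ n * ?\<rho>)"
    by (rule suminf_le[OF bound summA summ])
  also have "\<dots> = ?\<rho> / (1 - ?q)"
    using assms q by (simp add: suminf_mult2[symmetric] suminf_geometric summable_geometric)
  finally show ?thesis .
qed

end

section \<open>Absence of a unique infinite cluster\<close>

context rooted_tree
begin

lemma exists_branch: "v \<noteq> r \<Longrightarrow> \<exists>u. u \<noteq> r \<and> par u = r \<and> v \<in> below par u"
proof (induction "dep v" arbitrary: v rule: less_induct)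
  case less
  show ?case
  proof (cases "par v = r")
    case True
    then show ?thesis using less.prems below_self by metis
  next
    case False
    then obtain u where "u \<noteq> r" "par u = r" "par v \<in> below par u"
      using less.hyps[of "par v"] dep_par[OF less.prems] by auto
    then show ?thesis using below_child by metis
  qed
qed

text \<open>A branch at the root can be left only through the root.\<close>

lemma below_edge:
  assumes "par u = r" "{s, s'} \<in> T" "s \<in> below par u" "s' \<noteq> r"
  shows "s' \<in> below par u"
  using edge_cases[OF assms(2)]
proof
  assume a: "s \<noteq> r \<and> s' = par s"
  then have "s \<noteq> u" using assms by auto
  then show ?thesis using below_parent[OF assms(3)] a by simp
next
  assume "s' \<noteq> r \<and> s = par s'"
  then show ?thesis using below_child[of par s' u] assms(3) by simp
qed

text \<open>A geodesic from \<open>t\<close> to a vertex nearer than the root does not visit the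
  root.\<close>

lemma ball_below:
  assumes "par u = r" "t \<in> below par u"
  shows "gdist T t s < gdist T t r \<Longrightarrow> s \<in> below par u"
proof (induction "gdist T t s" arbitrary: s rule: less_induct)
  case less
  show ?case
  proof (cases "s = t")
    case False
    then obtain s' where s': "{s', s} \<in> T" "gdist T t s = Suc (gdist T t s')"
      using gdist_pred[OF linked] by blast
    then have "s' \<in> below par u" using less by simp
    moreover have "s \<noteq> r" using less.prems by auto
    ultimately show ?thesis using below_edge[OF assms(1) s'(1)] by blast
  qed (use assms in simp)
qed

end

section \<open>Invariance under automorphisms and crossing of a fibre\<close>

context bernoulli_gp
begin

definition in_infinite :: "'a \<times> 'b \<Rightarrow> (('a \<times> 'b) set \<Rightarrow> bool) \<Rightarrow> bool" where
  "in_infinite a \<omega> \<longleftrightarrow> infinite {u. linked (open_edges G \<omega>) a u}"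

lemma pred_in_infinite: "Measurable.pred PM (\<lambda>\<omega>. in_infinite a \<omega>)"
  unfolding in_infinite_def by (rule pred_infinite[OF countable_V pred_cluster])

text \<open>The action of an automorphism on configurations; the restriction to \<open>G\<close>
  keeps the result in the product space.\<close>

definition relabel :: "('a \<times> 'b \<Rightarrow> 'a \<times> 'b) \<Rightarrow> (('a \<times> 'b) set \<Rightarrow> bool) \<Rightarrow> ('a \<times> 'b) set \<Rightarrow> bool" where
  "relabel g \<omega> = (\<lambda>e\<in>G. \<omega> (g ` e))"

lemma Aut_image_edge:
  assumes "g \<in> Aut G"
  shows "inj_on ((`) g) G" "(`) g \<in> G \<rightarrow> G"
proof -
  have "inj g" using assms by (auto simp: Aut_def bij_def)
  then show "inj_on ((`) g) G" by (meson inj_image_eq_iff inj_onI)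
  show "(`) g \<in> G \<rightarrow> G"
  proof
    fix e assume e: "e \<in> G"
    then obtain u v where "e = {u, v}" by (rule G_edgeE)
    then show "g ` e \<in> G" using e Aut_edge[OF assms, of u v] by simp
  qed
qed

lemma distr_relabel:
  assumes "g \<in> Aut G"
  shows "distr PM PM (relabel g) = PM"
  unfolding relabel_def
  by (rule distr_PiM_reindex[OF measure_pmf.prob_space_axioms Aut_image_edge[OF assms]])

lemma measurable_relabel:
  assumes "g \<in> Aut G"
  shows "relabel g \<in> PM \<rightarrow>\<^sub>M PM"
  unfolding relabel_def
proof (rule measurable_restrict)
  fix e assume "e \<in> G"
  then have "g ` e \<in> G" using Aut_image_edge(2)[OF assms] by blast
  then show "(\<lambda>\<omega>. \<omega> (g ` e)) \<in> PM \<rightarrow>\<^sub>M measure_pmf (bernoulli_pmf p)"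
    by (rule measurable_component_singleton)
qed

lemma prb_relabel:
  assumes "g \<in> Aut G" "Measurable.pred PM P"
  shows "prb (\<lambda>\<omega>. P (relabel g \<omega>)) = prb P"
proof -
  have "prb P = measure (distr PM PM (relabel g)) {\<omega>\<in>space PM. P \<omega>}"
    by (simp only: distr_relabel[OF assms(1)])
  also have "\<dots> = measure PM (relabel g -` {\<omega>\<in>space PM. P \<omega>} \<inter> space PM)"
    by (rule measure_distr[OF measurable_relabel[OF assms(1)]]) (use assms(2) in \<open>simp add: pred_def\<close>)
  also have "relabel g -` {\<omega>\<in>space PM. P \<omega>} \<inter> space PM = {\<omega>\<in>space PM. P (relabel g \<omega>)}"
    using measurable_space[OF measurable_relabel[OF assms(1)]] by auto
  finally show ?thesis by simp
qed

lemma open_relabel: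
  assumes "g \<in> Aut G"
  shows "{u, v} \<in> open_edges G (relabel g \<omega>) \<longleftrightarrow> {g u, g v} \<in> open_edges G \<omega>"
  using Aut_edge[OF assms, of u v] by (auto simp: open_edges_def relabel_def)

lemma linked_relabel:
  assumes "g \<in> Aut G"
  shows "linked (open_edges G (relabel g \<omega>)) u v \<longleftrightarrow> linked (open_edges G \<omega>) (g u) (g v)"
proof
  assume "linked (open_edges G (relabel g \<omega>)) u v"
  then show "linked (open_edges G \<omega>) (g u) (g v)"
    by (rule linked_image) (simp add: open_relabel[OF assms])
next
  assume "linked (open_edges G \<omega>) (g u) (g v)"
  then have "linked (open_edges G (relabel g \<omega>)) (inv g (g u)) (inv g (g v))"
    by (rule linked_image) (simp add: open_relabel[OF assms] Aut_inv[OF assms])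
  then show "linked (open_edges G (relabel g \<omega>)) u v" by (simp add: Aut_inv[OF assms])
qed

lemma in_infinite_relabel:
  assumes "g \<in> Aut G"
  shows "in_infinite a (relabel g \<omega>) \<longleftrightarrow> in_infinite (g a) \<omega>"
proof -
  have "inj g" using assms by (auto simp: Aut_def bij_def)
  have "{u. linked (open_edges G \<omega>) (g a) u} = g ` {u. linked (open_edges G (relabel g \<omega>)) a u}"
  proof (intro equalityI subsetI)
    fix v assume v: "v \<in> {u. linked (open_edges G \<omega>) (g a) u}"
    obtain u where "v = g u" using Aut_surj[OF assms] by blast
    then show "v \<in> g ` {u. linked (open_edges G (relabel g \<omega>)) a u}"
      using v by (simp add: linked_relabel[OF assms])
  qed (auto simp: linked_relabel[OF assms])
  then show ?thesis
    unfolding in_infinite_def using finite_image_iff[OF inj_on_subset[OF \<open>inj g\<close> subset_UNIV]] by metis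
qed

text \<open>Continuity from below along an enumeration of the vertices.\<close>

lemma finite_set_meets_infinite:
  assumes "AE \<omega> in PM. \<exists>a. in_infinite a \<omega>" "c < 1"
  obtains F where "finite F" "c < prb (\<lambda>\<omega>. \<exists>a\<in>F. in_infinite a \<omega>)"
proof -
  define f :: "nat \<Rightarrow> 'a \<times> 'b" where "f = from_nat_into UNIV"
  let ?E = "\<lambda>n. {\<omega>\<in>space PM. \<exists>a\<in>f ` {..n}. in_infinite a \<omega>}"
  have E: "?E n \<in> sets PM" for n
  proof -
    have "Measurable.pred PM (\<lambda>\<omega>. \<exists>a\<in>f ` {..n}. in_infinite a \<omega>)"
      by (intro pred_intros_finite pred_in_infinite) auto
    then show ?thesis by (simp add: pred_def)
  qed
  have "incseq ?E" by (rule monoI) fastforce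
  moreover have "range ?E \<subseteq> sets PM" using E by blast
  ultimately have lim: "(\<lambda>n. measure PM (?E n)) \<longlonglongrightarrow> measure PM (\<Union>n. ?E n)"
    by (intro P.finite_Lim_measure_incseq)
  have "measure PM (\<Union>n. ?E n) = 1"
  proof (subst P.prob_eq_1)
    show "(\<Union>n. ?E n) \<in> sets PM" using E by blast
    show "AE \<omega> in PM. \<omega> \<in> (\<Union>n. ?E n)"
      using assms(1) AE_space
    proof eventually_elim
      case (elim \<omega>)
      then obtain a where a: "in_infinite a \<omega>" by blast
      obtain n where "f n = a" unfolding f_def using from_nat_into_surj[OF countable_V, of a] by blast
      then have "\<omega> \<in> ?E n" using a elim by auto
      then show ?case by blast
    qed
  qed
  with lim assms(2) have "eventually (\<lambda>n. c < measure PM (?E n)) sequentially"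
    by (intro order_tendstoD(1)[OF lim]) simp
  then obtain n where "c < measure PM (?E n)" by (auto simp: eventually_sequentially)
  then show ?thesis by (intro that[of "f ` {..n}"]) auto
qed

lemma crossing:
  assumes "rooted_tree T d" "tree_parent T r u = r" "linked (open_edges G \<omega>) a b"
    "snd a \<in> below (tree_parent T r) u" "snd b \<notin> below (tree_parent T r) u"
  shows "\<exists>z. snd z = r \<and> linked (open_edges G \<omega>) a z"
proof (rule ccontr)
  interpret R: rooted_tree T d r by (rule assms)
  assume no: "\<not> ?thesis"
  have "snd b \<in> below R.par u"
    using assms(3)
  proof (induction rule: linked_induct)
    case refl
    show ?case by (rule assms)
  next
    case (step y z)
    have "snd z \<noteq> r" using no linked_trans[OF step(1) linked_edge[OF step(2)]] by blast
    moreover have "snd y = snd z \<or> {snd y, snd z} \<in> T"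
      using step(2) by (auto simp: open_edges_def G_iff')
    ultimately show ?case using R.below_edge[OF assms(2)] step.IH by metis
  qed
  then show False using assms(5) by simp
qed

lemma no_unique_infinite_cluster:
  assumes small: "p * (8 + lam) < 1" and d3: "3 \<le> d"
    and uniq: "AE \<omega> in PM. \<exists>!C. C \<in> clusters (open_edges G \<omega>) \<and> infinite C"
  shows False
proof -
  have ex: "AE \<omega> in PM. \<exists>a. in_infinite a \<omega>"
    using uniq by eventually_elim (auto simp: clusters_def in_infinite_def)
  \<comment> \<open>Above 3/4, the set and its mirror image both meet the infinite cluster with
    probability more than 1/2, while a connection to the fibre between them will have probability
    below 1/4.\<close>
  obtain F where F: "finite F" "3 / 4 < prb (\<lambda>\<omega>. \<exists>a\<in>F. in_infinite a \<omega>)"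
    using finite_set_meets_infinite[OF ex, of "3 / 4"] by auto
  fix t0 :: 'b
  \<comment> \<open>For \<open>d = 2\<close> the decay rate would be 1; hence
    \<open>3 \<le> d\<close>.\<close>
  have rho1: "0 < rho" "rho < 1"
    using d3 by (auto simp: rho_def)
  have "(\<lambda>m. real (card F) * (rho ^ m / (1 - p * (8 + lam)))) \<longlonglongrightarrow> real (card F) * (0 / (1 - p * (8 + lam)))"
    using rho1 small by (intro tendsto_intros LIMSEQ_realpow_zero) auto
  then have "eventually (\<lambda>m. real (card F) * (rho ^ m / (1 - p * (8 + lam))) < 1 / 4) sequentially"
    by (intro order_tendstoD) auto
  then obtain m where m: "real (card F) * (rho ^ m / (1 - p * (8 + lam))) < 1 / 4"
    by (auto simp: eventually_sequentially)
  define M where "M = Max (insert 0 ((\<lambda>a. gdist T t0 (snd a)) ` F))"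
  have M: "gdist T t0 (snd a) \<le> M" if "a \<in> F" for a
    unfolding M_def using F(1) that by (intro Max_ge) auto
  \<comment> \<open>More than \<open>M\<close> away, so that \<open>F\<close> lies in a single
    branch at \<open>r\<close>; the additional \<open>m\<close> keeps every point of
    \<open>F\<close> at least \<open>m\<close> from the fibre over \<open>r\<close>.\<close>
  obtain r where r: "gdist T t0 r = M + m + 1"
    using rooted_tree.exists_dep[OF rooted d2, of t0] by blast
  interpret R: rooted_tree T d r by (rule rooted)
  have far: "m \<le> gdist T r (snd a)" if "a \<in> F" for a
    using gdist_triangle[OF tree_linked tree_linked, where u = t0 and v = "snd a" and x = r] M[OF that] r
      gdist_commute[OF tree_linked, of "snd a" r] by linarith
  have "t0 \<noteq> r" using r by auto
  then obtain u where u: "u \<noteq> r" "R.par u = r" "t0 \<in> below R.par u" using R.exists_branch by blast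
  \<comment> \<open>A second branch at \<open>r\<close>, to receive the mirror image of
    \<open>F\<close>.\<close>
  have "card ({x. x \<noteq> r \<and> R.par x = r} - {u}) = d - 1"
    using R.card_children_root u R.finite_children by simp
  then have "{x. x \<noteq> r \<and> R.par x = r} - {u} \<noteq> {}" using d2 by force
  then obtain u' where u': "u' \<noteq> r" "R.par u' = r" "u' \<noteq> u" by blast
  have "R.par u = R.par u'" using u u' by simp
  then obtain \<phi> where \<phi>: "\<phi> \<in> Aut T" "\<And>v. v \<in> below R.par u \<Longrightarrow> \<phi> v \<in> below R.par u'"
    using R.root_reflection[OF u(1) u'(1)] u'(3) by metis
  let ?g = "map_prod id \<phi>"
  have g: "?g \<in> Aut G" by (rule Aut_map_snd[OF \<phi>(1)])
  have inside: "snd a \<in> below R.par u" if "a \<in> F" for a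
    using R.ball_below[OF u(2,3)] M[OF that] r by simp
  have outside: "snd (?g a) \<notin> below R.par u" if "a \<in> F" for a
  proof -
    have "snd (?g a) \<in> below R.par u'" using \<phi>(2)[OF inside[OF that]] by (cases a) simp
    then show ?thesis using R.siblings_disjoint[OF u(1) u'(1)] u(2) u'(2,3) by auto
  qed
  let ?P = "\<lambda>\<omega>. \<exists>a\<in>F. in_infinite a \<omega>" and ?Q = "\<lambda>\<omega>. \<exists>a\<in>F. in_infinite (?g a) \<omega>"
  let ?C = "\<lambda>\<omega>. \<exists>a\<in>F. \<exists>z. snd z = r \<and> linked (open_edges G \<omega>) a z"
  have Pm: "Measurable.pred PM ?P" and Qm: "Measurable.pred PM ?Q" and Cm: "Measurable.pred PM ?C"
    using F(1) by (intro pred_intros_finite pred_in_infinite pred_reaches_fibre, assumption)+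
  have Q: "prb ?Q = prb ?P"
    using prb_relabel[OF g Pm] by (simp add: in_infinite_relabel[OF g])
  have AE_C: "AE \<omega> in PM. \<not> ?C \<omega> \<longrightarrow> \<not> ?P \<omega> \<or> \<not> ?Q \<omega>"
    using uniq
  proof eventually_elim
    case (elim \<omega>)
    have "?C \<omega>" if P: "?P \<omega>" and Q: "?Q \<omega>"
    proof -
      obtain a b where ab: "a \<in> F" "in_infinite a \<omega>" "b \<in> F" "in_infinite (?g b) \<omega>"
        using P Q by blast
      have "{u. linked (open_edges G \<omega>) a u} = {u. linked (open_edges G \<omega>) (?g b) u}"
        using elim ab(2,4) unfolding in_infinite_def clusters_def by blast
      then have "linked (open_edges G \<omega>) a (?g b)" by auto
      from crossing[OF rooted u(2) this inside[OF ab(1)] outside[OF ab(3)]] show ?thesis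
        using ab(1) by blast
    qed
    then show ?case by blast
  qed
  have "prb (\<lambda>\<omega>. \<not> ?C \<omega>) \<le> prb (\<lambda>\<omega>. \<not> ?P \<omega> \<or> \<not> ?Q \<omega>)"
  proof (rule P.finite_measure_mono_AE)
    have "Measurable.pred PM (\<lambda>\<omega>. \<not> ?P \<omega> \<or> \<not> ?Q \<omega>)"
      by (intro pred_intros_logic Pm Qm)
    then show "{\<omega>\<in>space PM. \<not> ?P \<omega> \<or> \<not> ?Q \<omega>} \<in> sets PM" by (simp only: pred_def)
    show "AE \<omega> in PM. \<omega> \<in> {\<omega>\<in>space PM. \<not> ?C \<omega>} \<longrightarrow> \<omega> \<in> {\<omega>\<in>space PM. \<not> ?P \<omega> \<or> \<not> ?Q \<omega>}"
      using AE_C by eventually_elim blast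
  qed
  also have "\<dots> \<le> prb (\<lambda>\<omega>. \<not> ?P \<omega>) + prb (\<lambda>\<omega>. \<not> ?Q \<omega>)"
    by (intro prb_disj_le pred_intros_logic Pm Qm)
  also have "\<dots> < 1 / 2" using prb_not[OF Pm] prb_not[OF Qm] Q F(2) by simp
  finally have C1: "1 / 2 < prb ?C" using prb_not[OF Cm] by simp
  have "prb ?C \<le> (\<Sum>a\<in>F. prb (\<lambda>\<omega>. \<exists>z. snd z = r \<and> linked (open_edges G \<omega>) a z))"
  proof -
    have "{\<omega>\<in>space PM. ?C \<omega>} = (\<Union>a\<in>F. {\<omega>\<in>space PM. \<exists>z. snd z = r \<and> linked (open_edges G \<omega>) a z})" by auto
    then show ?thesis
      using F(1) pred_reaches_fibre[unfolded pred_def]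
      by (simp only:) (rule P.finite_measure_subadditive_finite, auto)
  qed
  also have "\<dots> \<le> (\<Sum>a\<in>F. rho ^ m / (1 - p * (8 + lam)))"
  proof (rule sum_mono)
    fix a assume "a \<in> F"
    have "rho ^ gdist T r (snd a) \<le> rho ^ m" using far[OF \<open>a \<in> F\<close>] rho1 by (intro power_decreasing) auto
    then show "prb (\<lambda>\<omega>. \<exists>z. snd z = r \<and> linked (open_edges G \<omega>) a z) \<le> rho ^ m / (1 - p * (8 + lam))"
      using prb_reaches_fibre[OF small, of r a] small
      by (meson divide_right_mono diff_ge_0_iff_ge less_imp_le order_trans)
  qed
  also have "\<dots> < 1 / 4" using m by simp
  finally show False using C1 by simp
qed

end

section \<open>The two thresholds compared\<close>

context gp_product
begin

lemma infinite_V: "infinite (UNIV :: ('a \<times> 'b) set)"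
proof
  assume fin: "finite (UNIV :: ('a \<times> 'b) set)"
  fix x :: 'a and t :: 'b
  have "inj (\<lambda>n. ((up ^^ n) x, t))" by (auto intro!: injI simp: funpow_up_inj)
  then show False using fin by (metis finite_imageD finite_subset subset_UNIV infinite_UNIV_nat)
qed

text \<open>Shows that the infimum defining \<open>p_u\<close> is over a nonempty set, as its lower
  bounds require.\<close>

lemma AE_unique_at_1:
  "AE \<omega> in bernoulli_percolation G 1. \<exists>!C. C \<in> clusters (open_edges G \<omega>) \<and> infinite C"
proof -
  interpret bernoulli_gp A T d 1 by unfold_locales auto
  have "AE \<omega> in PM. \<forall>e\<in>G. \<omega> e"
  proof (subst AE_ball_countable[OF countable_G], rule ballI)
    fix e assume e: "e \<in> G"
    have "AE b in measure_pmf (bernoulli_pmf 1). b"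
    proof (unfold AE_measure_pmf_iff, rule ballI)
      fix b assume "b \<in> set_pmf (bernoulli_pmf 1)"
      then show b by (cases b) (auto simp: set_pmf_iff)
    qed
    then show "AE \<omega> in PM. \<omega> e"
      by (rule AE_component[OF e])
  qed
  then have "AE \<omega> in PM. \<exists>!C. C \<in> clusters (open_edges G \<omega>) \<and> infinite C"
  proof eventually_elim
    case (elim \<omega>)
    then have "open_edges G \<omega> = G" by (auto simp: open_edges_def)
    then have "clusters (open_edges G \<omega>) = {UNIV}" using G_linked by (auto simp: clusters_def)
    then show ?case using infinite_V by auto
  qed
  then show ?thesis by (simp only: PM_eq)
qed

lemma p_u_ge:
  assumes "3 \<le> d"
  shows "1 / (8 + lam) \<le> p_u G"
  unfolding p_u_def
proof (rule cInf_greatest)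
  show "{p \<in> {0..1}. AE \<omega> in bernoulli_percolation G p.
      \<exists>!C. C \<in> clusters (open_edges G \<omega>) \<and> infinite C} \<noteq> {}"
    using AE_unique_at_1 by (auto intro!: exI[of _ 1])
  fix p assume "p \<in> {p \<in> {0..1}. AE \<omega> in bernoulli_percolation G p.
      \<exists>!C. C \<in> clusters (open_edges G \<omega>) \<and> infinite C}"
  then have p: "0 \<le> p" "p \<le> 1"
    and uniq: "AE \<omega> in bernoulli_percolation G p. \<exists>!C. C \<in> clusters (open_edges G \<omega>) \<and> infinite C"
    by auto
  interpret bernoulli_gp A T d p by unfold_locales (rule p)+
  have "\<not> p * (8 + lam) < 1"
    using no_unique_infinite_cluster[OF _ assms uniq[unfolded PM_eq]] by blast
  then have "1 \<le> p * (8 + lam)" by simp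
  then show "1 / (8 + lam) \<le> p" using lam_nonneg by (simp add: divide_le_eq)
qed

lemma p_h_less_p_u:
  assumes "18 \<le> d"
  shows "p_h G (rel_weight (Aut G) z) < p_u G"
proof -
  have d: "real (d - 1) = real d - 1" using assms by simp
  define y where "y = sqrt (real d - 1)"
  have y: "y * y = real d - 1" "4 < y"
  proof -
    show "y * y = real d - 1" using assms by (simp add: y_def)
    have "sqrt 16 < sqrt (real d - 1)" using assms by (intro real_sqrt_less_mono) simp
    then show "4 < y" by (simp add: y_def)
  qed
  \<comment> \<open>The product is \<open>y * y - 2 * y - 8\<close>, so its positivity says 8 + lam
    < d - 1. The root 4 is exceeded exactly when d > 17.\<close>
  have "0 < (y - 4) * (y + 2)" using y(2) by simp
  then have less: "8 + lam < real (d - 1)"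
    using y(1) by (simp add: d lam_def flip: y_def) (simp add: algebra_simps)
  have pos: "0 < 8 + lam" using lam_nonneg by simp
  have "1 / real (d - 1) < 1 / (8 + lam)" using less pos by (intro divide_strict_left_mono) auto
  then obtain p where lt: "1 / real (d - 1) < p" "p < 1 / (8 + lam)" using dense by blast
  have "0 \<le> p" using lt(1) by (meson less_imp_le of_nat_0_le_iff order_trans zero_le_divide_1_iff)
  moreover have "p \<le> 1" using lt(2) lam_nonneg by (meson divide_le_eq_1_pos less_imp_le order_trans pos le_add_same_cancel1 one_le_numeral add_increasing2)
  ultimately interpret bernoulli_gp A T d p by unfold_locales
  \<comment> \<open>Any tree vertex can be the root of the branching process.\<close>
  interpret fibre_percolation A T d p "SOME t. True"
    by (intro fibre_percolation.intro bernoulli_gp_axioms rooted)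
  have R: "0 < real (d - 1)" using less pos by linarith
  have "1 < real (d - 1) * p"
    using lt(1)[unfolded pos_divide_less_eq[OF R]] by (simp only: mult.commute)
  from p_h_le[OF this] have "p_h G (rel_weight (Aut G) z) \<le> p" .
  also have "p < 1 / (8 + lam)" by (rule lt)
  also have "\<dots> \<le> p_u G" using assms by (intro p_u_ge) simp
  finally show ?thesis .
qed

end

theorem theorem3p9:
  fixes A :: "'a \<Rightarrow> 'a \<Rightarrow> bool"
    and T :: "'b edges"
    and d :: nat
    and G :: "('a \<times> 'b) edges"
    and \<Gamma> :: "('a \<times> 'b \<Rightarrow> 'a \<times> 'b) set"
    and ref :: "'a \<times> 'b"
    and w :: "'a \<times> 'b \<Rightarrow> real"
  assumes "2 \<le> d"
    and "oriented_tree 2 A"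
    and "regular_tree d T"
  defines "G \<equiv> cartesian_product (grandparent_graph A) T"
    and "\<Gamma> \<equiv> Aut G"
    and "w \<equiv> rel_weight \<Gamma> ref"
  shows "(\<forall>\<beta>>0. AE U in uniform_labels G. F_beta G w \<beta> U = W_beta G w \<beta> U) \<and>
         (AE U in uniform_labels G. FMaxSF G w U = WMaxSF G w U) \<and>
         (18 \<le> d \<longrightarrow> p_h G w < p_u G)"
proof -
  interpret gp_product A T d
    by unfold_locales (rule assms)+
  have G: "cartesian_product (grandparent_graph A) T = gp_product.G A T"
    by (simp add: G_def gp_def)
  show ?thesis
    unfolding w_def \<Gamma>_def assms(4) G
    using AE_F_eq_W_beta AE_FMaxSF_eq_WMaxSF p_h_less_p_u by blast
qed

end
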